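(* Let $P_0=P_0(G,H,\Gamma,W_0)$ be a regular model set in a lcsc group $G$, let $Y=(G\times H)/\Gamma$ with invariant probability measure $m_Y$, and let $(F_t)_{t>0}$ be a weakly admissible sequence of compact and symmetric subsets of $G$ which is almost everywhere good for $(Y,m_Y)$. Then \[\eta_{P_0}(f)=\lim_{t\to\infty}\sigma_t(f)\qquad\text{for all } f\in C_c(G),\] where \[\sigma_t(f):=\frac{1}{m_G(F_t)}\sum_{x\in P_0\cap F_t}\ \sum_{y\in P_0}f(x^{-1}y).\]
   Context: lcsc means locally compact second countable; $m_G$ denotes a fixed Haar measure on $G$. A lattice in a lcsc group $L$ is a discrete subgroup $\Gamma<L$ such that $L/\Gamma$ admits an $L$-invariant probability measure. A cut-and-project scheme is a triple $(G,H,\Gamma)$ with $G,H$ lcsc groups and $\Gamma<G\times H$ a lattice such that the coordinate projection $\pi_G$ is injective on $\Gamma$ and $\pi_H(\Gamma)$ is dense in $H$. Put $\Gamma_G=\pi_G(\Gamma)$ and $\tau := \pi_H\circ(\pi_G|_\Gamma)^{-1}:\Gamma_G\to H$. A regular model set in $G$ is a set $P_0=P_0(G,H,\Gamma,W_0):=\tau^{-1}(W_0)$, where $W_0\subset H$ is compact with non-empty interior, is Jordan-measurable ($m_H(\partial W_0)=0$), has dense interior ($W_0$ is the closure of its interior), has trivial stabilizer $\{h\in H : hW_0=W_0\}=\{e\}$, and is $\Gamma$-regular: $\partial W_0\cap\pi_H(\Gamma)=\emptyset$. The Chabauty--Fell topology on the set $\mathcal C(G)$ of closed subsets of $G$ is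 generated by the sets $\{C : C\cap V\neq\emptyset\}$ ($V$ open) and $\{C : C\cap K=\emptyset\}$ ($K$ compact). $G$ acts on $\mathcal C(G)$ by left translation; $X_{P_0}$ is the closure of $G.P_0$, and $X_{P_0}^\times := X_{P_0}\setminus\{\emptyset\}$. For a regular model set there is a unique $G$-invariant probability measure $\nu$ on $X^\times_{P_0}$. For $f\in C_c(G)$ put $\mathcal Pf(P):=\sum_{x\in P}f(x)$. The auto-correlation measure $\eta_{P_0}$ is the unique positive-definite Radon measure on $G$ with $\eta_{P_0}(f^**f)=\|\mathcal Pf\|^2_{L^2(X_{P_0}^\times,\nu)}$ for all $f\in C_c(G)$, where $f^*(g)=\overline{f(g^{-1})}$, $(f_1*f_2)(g)=\int_G f_1(r)f_2(r^{-1}g)\,dm_G(r)$, and $\eta$ is positive-definite if $\eta(f^**f)\ge 0$ for all $f\in C_c(G)$. Weak admissibility: fix an admissible metric on $G$ (proper, left-invariant, inducing the topology), let $B_\delta$ be the open ball of radius $\delta$ around $e$, and write $L_\delta=LB_\delta$ for $L\subset G$. A sequence $(F_t)_{t>0}$ of compact subsets of $G$ is weakly admissible if each $F_t$ has positive Haar measure and there are continuous functions $\alpha,\beta:[0,1)\to\mathbb R_+$ with $\alpha(0)=\beta(0)=0$ such that $(F_t)_\delta\subset F_{t+\alpha(\delta)}$ and $\sup_s\frac{m_G(F_{s+\delta})}{m_G(F_s)}=1+\beta(\delta)$ for all $t>0$ and $\delta\in(0,1)$. Almost everywhere good: $G$ acts on $Y$ by left multiplication in the first factor; let $\beta_t$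 be the probability measure $\beta_t(\phi)=\frac{1}{m_G(F_t)}\int_{F_t}\phi\,dm_G$ on $G$, and $(\beta_t*f)(y)=\int_G f(g^{-1}y)\,d\beta_t(g)$. The sequence $(F_t)$ (of compact sets of positive measure) is almost everywhere good for $(Y,m_Y)$ if for all $f\in L^2(Y,m_Y)$ one has $(\beta_t*f)(y)\to\int_Y f\,dm_Y$ as $t\to\infty$ for $m_Y$-almost every $y\in Y$. *)

theory Defs
  imports "HOL-Analysis.Analysis" "HOL-Probability.Probability_Measure"
begin

text \<open>
  Groups are not assumed to be abelian: as in \<^class>\<open>group_add\<close>, the group operation is
  merely written additively, so \<open>x + y\<close>, \<open>- x\<close>, \<open>0\<close> and \<open>- x + y\<close> stand for
  \<open>xy\<close>, \<open>x\<close> inverse, the neutral element and \<open>x\<close> inverse times \<open>y\<close>.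
  Locally compact groups are Hausdorff by convention.
\<close>

class lcsc_group_add = topological_group_add + t2_space + second_countable_topology +
  assumes locally_compact_UNIV: "\<exists>U K. open U \<and> compact K \<and> x \<in> U \<and> U \<subseteq> K"

lemma locally_compact_space_lcsc:
  "locally_compact_space (euclidean :: 'a::lcsc_group_add topology)"
  unfolding locally_compact_space_def using locally_compact_UNIV by auto

instance prod :: (topological_monoid_add, topological_monoid_add) topological_monoid_add
proof
  fix a b :: "'a \<times> 'b"
  have "((\<lambda>x. (fst (fst x) + fst (snd x), snd (fst x) + snd (snd x))) \<longlongrightarrow>
          (fst a + fst b, snd a + snd b)) (nhds a \<times>\<^sub>F nhds b)"
    by (intro tendsto_intros filterlim_fst filterlim_snd)
  then show "((\<lambda>x. fst x + snd x) \<longlongrightarrow> a + b) (nhds a \<times>\<^sub>F nhds b)"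
    by (simp add: plus_prod_def)
qed

instance prod :: (topological_group_add, topological_group_add) topological_group_add
proof
  fix a :: "'a \<times> 'b"
  have eq: "uminus = (\<lambda>x :: 'a \<times> 'b. (- fst x, - snd x))"
    by (rule ext) (rule uminus_prod_def)
  show "(uminus \<longlongrightarrow> - a) (nhds a)"
    unfolding eq by (intro tendsto_intros filterlim_ident)
qed

instance prod :: (lcsc_group_add, lcsc_group_add) lcsc_group_add
proof
  fix x :: "'a \<times> 'b"
  obtain U K where 1: "open U" "compact K" "fst x \<in> U" "U \<subseteq> K"
    using locally_compact_UNIV by blast
  obtain V L where 2: "open V" "compact L" "snd x \<in> V" "V \<subseteq> L"
    using locally_compact_UNIV by blast
  show "\<exists>U K. open U \<and> compact K \<and> x \<in> U \<and> U \<subseteq> K"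
    using 1 2 by (intro exI[of _ "U \<times> V"] exI[of _ "K \<times> L"])
      (auto simp: open_Times compact_Times mem_Times_iff)
qed

definition translate :: "'a::plus \<Rightarrow> 'a set \<Rightarrow> 'a set" where
  "translate g A = (+) g ` A"

definition Cc :: "('a::topological_space \<Rightarrow> complex) set" where
  "Cc = {f. continuous_on UNIV f \<and> compact (closure {x. f x \<noteq> 0})}"

text \<open>
  On a locally compact second countable space, a Borel measure that is finite on compact sets is
  automatically regular.
\<close>

definition radon_measure :: "'a::topological_space measure \<Rightarrow> bool" where
  "radon_measure \<mu> \<longleftrightarrow> sets \<mu> = sets borel \<and> (\<forall>K. compact K \<longrightarrow> emeasure \<mu> K < \<infinity>)"

definition haar_measure :: "'a::lcsc_group_add measure \<Rightarrow> bool" where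
  "haar_measure m \<longleftrightarrow> radon_measure m \<and> emeasure m UNIV \<noteq> 0 \<and>
     (\<forall>g. \<forall>A\<in>sets borel. emeasure m (translate g A) = emeasure m A)"

definition conv_fun ::
    "'a::lcsc_group_add measure \<Rightarrow> ('a \<Rightarrow> complex) \<Rightarrow> ('a \<Rightarrow> complex) \<Rightarrow> 'a \<Rightarrow> complex" where
  "conv_fun m f1 f2 g = (LINT r|m. f1 r * f2 (- r + g))"

definition involution :: "('a::uminus \<Rightarrow> complex) \<Rightarrow> 'a \<Rightarrow> complex" where
  "involution f g = cnj (f (- g))"

definition positive_definite :: "'a::lcsc_group_add measure \<Rightarrow> 'a measure \<Rightarrow> bool" where
  "positive_definite m \<eta> \<longleftrightarrow>
     (\<forall>f\<in>Cc. (LINT x|\<eta>. conv_fun m (involution f) f x) \<in> \<real>\<^sub>\<ge>\<^sub>0)"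

definition borel_of :: "'a topology \<Rightarrow> 'a measure" where
  "borel_of X = sigma (topspace X) {U. openin X U}"

text \<open>
  Both kinds of spaces acted upon below consist of subsets of a group (left cosets of a subgroup,
  respectively closed subsets), on which the group acts by left translation.
\<close>

definition invariant_prob :: "'a::lcsc_group_add set topology \<Rightarrow> 'a set measure \<Rightarrow> bool" where
  "invariant_prob X \<mu> \<longleftrightarrow> prob_space \<mu> \<and> sets \<mu> = sets (borel_of X) \<and>
     (\<forall>g. \<forall>A\<in>sets \<mu>. emeasure \<mu> (translate g ` A) = emeasure \<mu> A)"

definition is_subgroup :: "'a::group_add set \<Rightarrow> bool" where
  "is_subgroup \<Gamma> \<longleftrightarrow> 0 \<in> \<Gamma> \<and> (\<forall>x\<in>\<Gamma>. \<forall>y\<in>\<Gamma>. x + y \<in> \<Gamma>) \<and> (\<forall>x\<in>\<Gamma>. - x \<in> \<Gamma>)"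

definition left_coset :: "'a::plus set \<Rightarrow> 'a \<Rightarrow> 'a set" where
  "left_coset \<Gamma> x = translate x \<Gamma>"

definition quotient_top :: "'a::lcsc_group_add set \<Rightarrow> 'a set topology" where
  "quotient_top \<Gamma> = topology (\<lambda>V. V \<subseteq> range (left_coset \<Gamma>) \<and> open (left_coset \<Gamma> -` V))"

lemma openin_quotient_top:
  "openin (quotient_top \<Gamma>) V \<longleftrightarrow> V \<subseteq> range (left_coset \<Gamma>) \<and> open (left_coset \<Gamma> -` V)"
proof -
  have "istopology (\<lambda>V. V \<subseteq> range (left_coset \<Gamma>) \<and> open (left_coset \<Gamma> -` V))"
    unfolding istopology_def
  proof (intro conjI allI impI)
    fix S T assume "S \<subseteq> range (left_coset \<Gamma>) \<and> open (left_coset \<Gamma> -` S)"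
      and "T \<subseteq> range (left_coset \<Gamma>) \<and> open (left_coset \<Gamma> -` T)"
    then show "S \<inter> T \<subseteq> range (left_coset \<Gamma>)" "open (left_coset \<Gamma> -` (S \<inter> T))"
      by (blast, simp add: vimage_Int open_Int)
  next
    fix K assume *: "\<forall>S\<in>K. S \<subseteq> range (left_coset \<Gamma>) \<and> open (left_coset \<Gamma> -` S)"
    show "\<Union>K \<subseteq> range (left_coset \<Gamma>)"
      using * by (intro Union_least) simp
    show "open (left_coset \<Gamma> -` \<Union>K)"
      using * by (simp add: vimage_Union open_UN)
  qed
  then show ?thesis
    by (simp add: quotient_top_def topology_inverse')
qed

lemma topspace_quotient_top: "topspace (quotient_top \<Gamma>) = range (left_coset \<Gamma>)"
proof
  show "topspace (quotient_top \<Gamma>) \<subseteq> range (left_coset \<Gamma>)"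
    unfolding topspace_def openin_quotient_top by (rule Union_least) simp
  have "left_coset \<Gamma> -` range (left_coset \<Gamma>) = UNIV"
    by auto
  then have "openin (quotient_top \<Gamma>) (range (left_coset \<Gamma>))"
    by (simp add: openin_quotient_top)
  then show "range (left_coset \<Gamma>) \<subseteq> topspace (quotient_top \<Gamma>)"
    by (rule openin_subset)
qed

definition lattice_subgroup :: "'a::lcsc_group_add set \<Rightarrow> bool" where
  "lattice_subgroup \<Gamma> \<longleftrightarrow> is_subgroup \<Gamma> \<and> discrete \<Gamma> \<and> (\<exists>\<mu>. invariant_prob (quotient_top \<Gamma>) \<mu>)"

definition cut_and_project :: "('g::lcsc_group_add \<times> 'h::lcsc_group_add) set \<Rightarrow> bool" where
  "cut_and_project \<Gamma> \<longleftrightarrow> lattice_subgroup \<Gamma> \<and> inj_on fst \<Gamma> \<and> closure (snd ` \<Gamma>) = UNIV"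

definition star_map :: "('g \<times> 'h) set \<Rightarrow> 'g \<Rightarrow> 'h" where
  "star_map \<Gamma> g = snd (the_inv_into \<Gamma> fst g)"

definition model_set :: "('g \<times> 'h) set \<Rightarrow> 'h set \<Rightarrow> 'g set" where
  "model_set \<Gamma> W = {g \<in> fst ` \<Gamma>. star_map \<Gamma> g \<in> W}"

definition regular_window ::
    "'h::lcsc_group_add measure \<Rightarrow> ('g \<times> 'h) set \<Rightarrow> 'h set \<Rightarrow> bool" where
  "regular_window mH \<Gamma> W \<longleftrightarrow>
     compact W \<and> interior W \<noteq> {} \<and> emeasure mH (frontier W) = 0 \<and>
     W = closure (interior W) \<and> {h. translate h W = W} = {0} \<and>
     frontier W \<inter> snd ` \<Gamma> = {}"

text \<open>
  The compact set \<open>K = {}\<close> contributes the set of all closed sets to the generating family, so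
  the underlying set of the following topology is \<open>{C. closed C}\<close>.
\<close>

definition chabauty_fell :: "'a::topological_space set topology" where
  "chabauty_fell = topology_generated_by
     ({{C. closed C \<and> C \<inter> V \<noteq> {}} | V. open V} \<union> {{C. closed C \<and> C \<inter> K = {}} | K. compact K})"

lemma topspace_chabauty_fell: "topspace chabauty_fell = {C. closed C}"
proof
  show "topspace chabauty_fell \<subseteq> {C :: 'a set. closed C}"
    unfolding chabauty_fell_def topology_generated_by_topspace by (rule Union_least) auto
  have "{C :: 'a set. closed C} \<in> {{C. closed C \<and> C \<inter> K = {}} | K. compact K}"
    by (rule CollectI, rule exI[of _ "{}"]) auto
  then show "{C :: 'a set. closed C} \<subseteq> topspace chabauty_fell"
    unfolding chabauty_fell_def topology_generated_by_topspace by (intro Union_upper UnI2)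
qed

definition trans_hull :: "'a::lcsc_group_add set \<Rightarrow> 'a set set" where
  "trans_hull P = chabauty_fell closure_of (range (\<lambda>g. translate g P))"

definition punctured_hull_top :: "'a::lcsc_group_add set \<Rightarrow> 'a set topology" where
  "punctured_hull_top P = subtopology chabauty_fell (trans_hull P - {{}})"

text \<open>
  For \<open>f\<close> compactly supported and \<open>P\<close> locally finite only finitely many terms of the following
  sum are nonzero.
\<close>

definition periodization :: "('a \<Rightarrow> complex) \<Rightarrow> 'a set \<Rightarrow> complex" where
  "periodization f P = (\<Sum>\<^sub>\<infinity>x\<in>P. f x)"

definition autocorrelation ::
    "'a::lcsc_group_add measure \<Rightarrow> 'a set measure \<Rightarrow> 'a measure \<Rightarrow> bool" where
  "autocorrelation m \<nu> \<eta> \<longleftrightarrow> radon_measure \<eta> \<and> positive_definite m \<eta> \<and>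
     (\<forall>f\<in>Cc. (LINT x|\<eta>. conv_fun m (involution f) f x) =
              complex_of_real (LINT P|\<nu>. (cmod (periodization f P))\<^sup>2))"

definition admissible_metric :: "('a::lcsc_group_add \<Rightarrow> 'a \<Rightarrow> real) \<Rightarrow> bool" where
  "admissible_metric d \<longleftrightarrow>
     Metric_space UNIV d \<and> Metric_space.mtopology UNIV d = euclidean \<and>
     (\<forall>x r. compact (Metric_space.mcball UNIV d x r)) \<and>
     (\<forall>g x y. d (g + x) (g + y) = d x y)"

definition thicken :: "('a::lcsc_group_add \<Rightarrow> 'a \<Rightarrow> real) \<Rightarrow> real \<Rightarrow> 'a set \<Rightarrow> 'a set" where
  "thicken d \<delta> L = {x + b | x b. x \<in> L \<and> b \<in> Metric_space.mball UNIV d 0 \<delta>}"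

definition weakly_admissible ::
    "('a::lcsc_group_add \<Rightarrow> 'a \<Rightarrow> real) \<Rightarrow> 'a measure \<Rightarrow> (real \<Rightarrow> 'a set) \<Rightarrow> bool" where
  "weakly_admissible d m F \<longleftrightarrow>
     (\<forall>t>0. compact (F t) \<and> emeasure m (F t) > 0) \<and>
     (\<exists>\<alpha> \<beta> :: real \<Rightarrow> real.
        continuous_on {0..<1} \<alpha> \<and> continuous_on {0..<1} \<beta> \<and>
        (\<forall>\<delta>\<in>{0..<1}. \<alpha> \<delta> \<ge> 0 \<and> \<beta> \<delta> \<ge> 0) \<and> \<alpha> 0 = 0 \<and> \<beta> 0 = 0 \<and>
        (\<forall>t>0. \<forall>\<delta>\<in>{0<..<1}. thicken d \<delta> (F t) \<subseteq> F (t + \<alpha> \<delta>)) \<and>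
        (\<forall>\<delta>\<in>{0<..<1}.
           (SUP s\<in>{0<..}. emeasure m (F (s + \<delta>)) / emeasure m (F s)) = ennreal (1 + \<beta> \<delta>)))"

definition act_fst ::
    "'g::lcsc_group_add \<Rightarrow> ('g \<times> 'h::lcsc_group_add) set \<Rightarrow> ('g \<times> 'h) set" where
  "act_fst g y = translate (g, 0) y"

definition ball_average ::
    "'g::lcsc_group_add measure \<Rightarrow> (real \<Rightarrow> 'g set) \<Rightarrow> real \<Rightarrow>
      (('g \<times> 'h::lcsc_group_add) set \<Rightarrow> complex) \<Rightarrow> ('g \<times> 'h) set \<Rightarrow> complex" where
  "ball_average m F t f y = (LINT g|uniform_measure m (F t). f (act_fst (- g) y))"

definition ae_good ::
    "'g::lcsc_group_add measure \<Rightarrow> (real \<Rightarrow> 'g set) \<Rightarrow>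
      ('g \<times> 'h::lcsc_group_add) set measure \<Rightarrow> bool" where
  "ae_good m F mY \<longleftrightarrow>
     (\<forall>t>0. compact (F t) \<and> emeasure m (F t) > 0) \<and>
     (\<forall>f \<in> borel_measurable mY. integrable mY (\<lambda>y. (cmod (f y))\<^sup>2) \<longrightarrow>
        (AE y in mY. ((\<lambda>t. ball_average m F t f y) \<longlongrightarrow> (LINT y|mY. f y)) at_top))"

definition sampled_autocorrelation ::
    "'a::lcsc_group_add measure \<Rightarrow> 'a set \<Rightarrow> (real \<Rightarrow> 'a set) \<Rightarrow> real \<Rightarrow> ('a \<Rightarrow> complex) \<Rightarrow> complex" where
  "sampled_autocorrelation m P F t f =
     (\<Sum>x\<in>P \<inter> F t. \<Sum>\<^sub>\<infinity>y\<in>P. f (- x + y)) / complex_of_real (measure m (F t))"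

end

theory Submission
  imports Defs
begin

text \<open>
  Write \<open>\<sigma>\<^sub>t(f)\<close> as a finite sum over \<open>\<delta> \<in> \<Gamma>\<close> of \<open>f (fst \<delta>)\<close> times the normalised number
  of lattice points in \<open>F t \<times> (W0 \<inter> (W0 - snd \<delta>))\<close>. A coset of \<open>\<Gamma>\<close> is a random locally
  finite subset of the product group; its intensity is a Haar measure, so the pointwise ergodic
  theorem counts the points of almost every coset in such boxes, and weak admissibility together
  with symmetry extends the count to every coset. Every nonempty \<open>P\<close> in the hull is sandwiched
  between the model sets of one coset with windows \<open>interior W0\<close> and \<open>W0\<close>; hence the sampled
  autocorrelations of all such \<open>P\<close> converge to one limit. On the other hand, the defining property
  of \<open>\<eta>\<close> identifies the intensity of the random set \<open>P \<times> P\<close> with the image of \<open>mG \<otimes> \<eta>\<close> under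
  \<open>(x, z) \<mapsto> (x, x + z)\<close>. So the mean over the hull of the sampled autocorrelation is \<open>\<eta>(f)\<close> for
  each \<open>t\<close>, and dominated convergence concludes.
\<close>

subsection \<open>Locally compact second countable groups\<close>

text \<open>Genericity is known only for almost every coset, while \<open>P0\<close> comes from the
  single coset \<open>\<Gamma>\<close> and elements of the hull from unspecified ones. The way out
  is that a null set contains no nonempty open set, so every coset has generic cosets arbitrarily
  near. Passing to one of them displaces \<open>F t\<close> on the left, whereas weak admissibility
  thickens on the right; inversion exchanges the sides, and symmetry of \<open>F t\<close> lets it
  act inside the family. The groups are neither abelian nor assumed unimodular, yet the convolution
  of \<open>involution f\<close> with \<open>f\<close> becomes a correlation of \<open>x\<close>
  with \<open>x + z\<close> only after replacing the variable by its inverse. The lattice provides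
  this: a nontrivial modular function would make some translation contract a probability space. The
  measure \<open>\<eta>\<close> is prescribed on functions \<open>f^* * f\<close> alone. Mixed terms
  come from polarisation: the real combination \<open>u + v\<close> yields their sum, and
  \<open>u + \<i> v\<close> shows that they coincide. Points of a hull element over the frontier of
  the window are out of control, but the frontier is null, so both bounds of the sandwich have the
  same density.\<close>

lemma lcsc_compact_neighbourhood:
  fixes x :: "'a::lcsc_group_add"
  assumes "open U" "x \<in> U"
  obtains V K where "open V" "compact K" "x \<in> V" "V \<subseteq> K" "K \<subseteq> U"
proof -
  have H: "Hausdorff_space (euclidean :: 'a topology) \<or> regular_space (euclidean :: 'a topology)"
    unfolding Hausdorff_space_def disjnt_def open_openin[symmetric]
    by (intro disjI1 allI impI, elim conjE, drule hausdorff) blast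
  have "neighbourhood_base_of (compactin (euclidean :: 'a topology)) euclidean"
    by (rule iffD1[OF locally_compact_space_neighbourhood_base[OF H] locally_compact_space_lcsc])
  then have "\<exists>V K. open V \<and> compact K \<and> x \<in> V \<and> V \<subseteq> K \<and> K \<subseteq> U"
    using assms unfolding neighbourhood_base_of by simp
  then show ?thesis using that by blast
qed

text \<open>Compact closures of basis sets that stay inside \<open>U\<close> already cover
  \<open>U\<close>; second countability leaves countably many of them, and finite unions make the
  sequence increase. Inner and outer regularity of Haar measure are later read off from such
  sequences.\<close>

lemma open_eq_incseq_compact:
  fixes U :: "'a::lcsc_group_add set"
  assumes "open U"
  obtains K :: "nat \<Rightarrow> 'a set" where "\<And>n. compact (K n)" "incseq K" "(\<Union>n. K n) = U"
proof -
  obtain B :: "'a set set" where B: "countable B" "topological_basis B"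
    using ex_countable_basis by auto
  \<comment> \<open>\<open>{}\<close> keeps \<open>C\<close> nonempty, which the enumeration
    \<open>from_nat_into\<close> needs when \<open>U\<close> is empty.\<close>
  define C where "C = insert {} {closure b | b. b \<in> B \<and> compact (closure b) \<and> closure b \<subseteq> U}"
  have "C \<subseteq> insert {} (closure ` B)" by (auto simp: C_def)
  then have countC: "countable C"
    using B(1) by (meson countable_image countable_insert countable_subset)
  have U: "\<Union>C = U"
  proof
    show "U \<subseteq> \<Union>C"
    proof
      fix x assume "x \<in> U"
      then obtain V K where VK: "open V" "compact K" "x \<in> V" "V \<subseteq> K" "K \<subseteq> U"
        using lcsc_compact_neighbourhood assms by metis
      obtain b where b: "b \<in> B" "x \<in> b" "b \<subseteq> V"
        using topological_basisE[OF B(2) VK(1,3)] by metis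
      have "closure b \<subseteq> K"
        using b VK by (meson closure_minimal compact_imp_closed dual_order.trans)
      then have "compact (closure b)" "closure b \<subseteq> U"
        using VK compact_Int_closed[of K "closure b"] by (auto simp: Int_absorb1)
      then show "x \<in> \<Union>C"
        using b closure_subset[of b] by (auto simp: C_def)
    qed
  qed (auto simp: C_def)
  have compact_C: "compact c" if "c \<in> C" for c using that by (auto simp: C_def)
  define K where "K n = (\<Union>i\<le>n. from_nat_into C i)" for n
  have ne: "C \<noteq> {}" by (simp add: C_def)
  have inC: "from_nat_into C i \<in> C" for i using from_nat_into[OF ne] .
  show ?thesis
  proof
    show "compact (K n)" for n
      unfolding K_def using inC by (intro compact_UN) (auto simp: compact_C)
    show "incseq K" by (auto simp: incseq_def K_def intro: order.trans)
    have "(\<Union>n. K n) = (\<Union>i. from_nat_into C i)" unfolding K_def by auto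
    also have "\<dots> = \<Union>C" using countC ne by (simp add: UN_from_nat_into)
    finally show "(\<Union>n. K n) = U" using U by simp
  qed
qed

lemma compact_subset_open_relcompact:
  fixes W :: "'a::lcsc_group_add set"
  assumes "compact W" "open U" "W \<subseteq> U"
  obtains V K where "open V" "compact K" "W \<subseteq> V" "V \<subseteq> K" "K \<subseteq> U"
proof -
  have "\<forall>x\<in>W. \<exists>V K. open V \<and> compact K \<and> x \<in> V \<and> V \<subseteq> K \<and> K \<subseteq> U"
    using lcsc_compact_neighbourhood assms by (metis subsetD)
  then obtain V K where VK: "\<And>x. x \<in> W \<Longrightarrow> open (V x) \<and> compact (K x) \<and> x \<in> V x \<and> V x \<subseteq> K x \<and> K x \<subseteq> U"
    by metis
  obtain T where T: "T \<subseteq> W" "finite T" "W \<subseteq> (\<Union>x\<in>T. V x)"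
    using compactE_image[OF assms(1), of W V] VK by (metis UN_I subsetI)
  show ?thesis
  proof
    show "open (\<Union>x\<in>T. V x)" using T VK by auto
    show "compact (\<Union>x\<in>T. K x)" using T VK by auto
    show "W \<subseteq> (\<Union>x\<in>T. V x)" "(\<Union>x\<in>T. V x) \<subseteq> (\<Union>x\<in>T. K x)" "(\<Union>x\<in>T. K x) \<subseteq> U"
      using T VK by (auto, blast+)
  qed
qed

text \<open>The tube lemma around \<open>{0} \<times> K\<close>. Both signs are provided because a
  window is moved by \<open>v\<close> for the upper count and moved back by \<open>- v\<close> for
  the lower one.\<close>

lemma compact_translate_nbhd:
  fixes K :: "'a::lcsc_group_add set"
  assumes "compact K" "open U" "K \<subseteq> U"
  obtains N where "open N" "0 \<in> N" "\<And>v k. v \<in> N \<Longrightarrow> k \<in> K \<Longrightarrow> v + k \<in> U"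
    "\<And>v k. v \<in> N \<Longrightarrow> k \<in> K \<Longrightarrow> - v + k \<in> U"
proof -
  define W where "W = {p::'a\<times>'a. fst p + snd p \<in> U \<and> - fst p + snd p \<in> U}"
  have "open W"
  proof -
    have "open ((\<lambda>p::'a\<times>'a. fst p + snd p) -` U)" "open ((\<lambda>p::'a\<times>'a. - fst p + snd p) -` U)"
      by (intro open_vimage[OF assms(2)] continuous_intros)+
    moreover have "W = (\<lambda>p::'a\<times>'a. fst p + snd p) -` U \<inter> (\<lambda>p::'a\<times>'a. - fst p + snd p) -` U"
      by (auto simp: W_def)
    ultimately show ?thesis by (simp add: open_Int)
  qed
  moreover have "{0} \<times> K \<subseteq> W" using assms by (auto simp: W_def)
  ultimately obtain N where "0 \<in> N" "open N" "N \<times> K \<subseteq> W"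
    using Elementary_Topology.tube_lemma[OF assms(1)] by metis
  then have "\<And>v k. v \<in> N \<Longrightarrow> k \<in> K \<Longrightarrow> (v, k) \<in> W" by auto
  then show ?thesis using that[OF \<open>open N\<close> \<open>0 \<in> N\<close>] by (simp add: W_def)
qed

lemma translate_vimage: "translate (g::'a::group_add) A = (+) (- g) -` A"
  by (force simp: translate_def image_iff intro!: bexI[of _ "- g + _"])

lemma mem_translate: "x \<in> translate (g::'a::group_add) A \<longleftrightarrow> - g + x \<in> A"
  by (simp add: translate_vimage)

lemma translate_0: "translate (0::'a::group_add) A = A"
  by (simp add: set_eq_iff mem_translate)

lemma translate_translate: "translate (g::'a::group_add) (translate h A) = translate (g + h) A"
  by (auto simp: set_eq_iff mem_translate minus_add add.assoc diff_conv_add_uminus simp del: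
    add_uminus_conv_diff)

lemma open_translate: "open A \<Longrightarrow> open (translate (g::'a::topological_group_add) A)"
  unfolding translate_vimage by (intro open_vimage) (auto intro!: continuous_intros)

lemma borel_translate: "A \<in> sets borel \<Longrightarrow> translate (g::'a::topological_group_add) A \<in> sets borel"
  unfolding translate_vimage
  using measurable_sets[OF borel_measurable_continuous_onI[of "(+) (- g)"], of A]
  by (simp add: continuous_on_add continuous_on_const continuous_on_id)

lemma card_translate: "card (translate (g::'a::group_add) A) = card A"
  by (simp add: translate_def card_image)

lemma translate_Int: "translate (g::'a::group_add) (A \<inter> B) = translate g A \<inter> translate g B"
  by (auto simp: set_eq_iff mem_translate)

subsection \<open>Counting points of random locally finite sets\<close>

text \<open>The Hausdorff property separates finitely many points at once. Taking the separating
  sets from a basis turns the presence of \<open>n\<close> points into a countable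
  condition.\<close>

lemma finite_disjoint_basis:
  fixes T :: "'a::t2_space set"
  assumes "topological_basis B" "finite T" "T \<subseteq> V" "open V"
  obtains b where "\<And>x. x \<in> T \<Longrightarrow> b x \<in> B \<and> x \<in> b x \<and> b x \<subseteq> V" "disjoint_family_on b T"
proof -
  have "\<exists>p. open (fst p) \<and> open (snd p) \<and> x \<in> fst p \<and> y \<in> snd p \<and> fst p \<inter> snd p = {}"
    if "x \<noteq> y" for x y :: 'a
    using hausdorff[OF that] by auto
  then obtain p where p: "\<And>x y::'a. x \<noteq> y \<Longrightarrow> open (fst (p x y)) \<and> open (snd (p x y)) \<and>
      x \<in> fst (p x y) \<and> y \<in> snd (p x y) \<and> fst (p x y) \<inter> snd (p x y) = {}"
    by metis
  define U W where "U x y = fst (p x y)" and "W x y = snd (p x y)" for x y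
  have UW: "\<And>x y::'a. x \<noteq> y \<Longrightarrow> open (U x y) \<and> open (W x y) \<and> x \<in> U x y \<and> y \<in> W x y \<and> U x y \<inter> W x y
    = {}"
    using p by (simp add: U_def W_def)
  \<comment> \<open>The separating pair is chosen for ordered pairs without any symmetry, so
    \<open>x\<close> must be kept in \<open>U x y\<close> as first member of \<open>(x, y)\<close>
    and in \<open>W y x\<close> as second member of \<open>(y, x)\<close>.\<close>
  define O' where "O' x = V \<inter> (\<Inter>y\<in>T - {x}. U x y \<inter> W y x)" for x
  have "open (O' x)" for x
    unfolding O'_def using assms UW by (auto intro!: open_INT open_Int)
  moreover have "x \<in> O' x" if "x \<in> T" for x
  proof -
    have "x \<in> U x y \<inter> W y x" if "y \<in> T - {x}" for y
      using UW[of x y] UW[of y x] that by auto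
    then show ?thesis using assms(3) that by (auto simp: O'_def)
  qed
  ultimately have O': "open (O' x)" "x \<in> T \<Longrightarrow> x \<in> O' x" for x by auto
  have "\<forall>x\<in>T. \<exists>b\<in>B. x \<in> b \<and> b \<subseteq> O' x"
    using topological_basisE[OF assms(1)] O' by metis
  then obtain b where b: "\<And>x. x \<in> T \<Longrightarrow> b x \<in> B \<and> x \<in> b x \<and> b x \<subseteq> O' x" by metis
  show ?thesis
  proof
    show "b x \<in> B \<and> x \<in> b x \<and> b x \<subseteq> V" if "x \<in> T" for x
      using b[OF that] by (auto simp: O'_def)
    show "disjoint_family_on b T"
      unfolding disjoint_family_on_def
    proof (intro ballI impI)
      fix x y assume xy: "x \<in> T" "y \<in> T" "x \<noteq> y"
      have "b x \<subseteq> U x y" "b y \<subseteq> W x y" using b xy by (auto simp: O'_def)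
      then show "b x \<inter> b y = {}" using UW[OF xy(3)] by auto
    qed
  qed
qed

text \<open>Measurability is demanded only for the events of hitting an open set, which is what the
  quotient topology and the Fell topology supply directly. The exhaustion \<open>E\<close> makes
  counts locally finite, so that complements can be handled by subtraction. The instances are the
  cosets in the quotient and \<open>P \<times> P\<close> for \<open>P\<close> in the hull.\<close>

locale random_set =
  fixes M :: "'w measure" and S :: "'w \<Rightarrow> 'a::{second_countable_topology, t2_space} set"
    and E :: "nat \<Rightarrow> 'a set"
  assumes hit_open: "\<And>V. open V \<Longrightarrow> {w \<in> space M. S w \<inter> V \<noteq> {}} \<in> sets M"
    and open_E: "\<And>n. open (E n)" and incseq_E: "incseq E" and UN_E: "(\<Union>n. E n) = UNIV"
    and finite_E: "\<And>w n. w \<in> space M \<Longrightarrow> finite (S w \<inter> E n)"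
begin

text \<open>Counting measure instead of \<open>card\<close>, since an infinite intersection has to
  count as infinity and not as 0.\<close>

definition cnt :: "'a set \<Rightarrow> 'w \<Rightarrow> ennreal" where
  "cnt A w = emeasure (count_space UNIV) (S w \<inter> A)"

text \<open>At least \<open>n\<close> points lie in \<open>V\<close> iff some \<open>n\<close>
  pairwise disjoint basis sets inside \<open>V\<close> are all hit. There are only countably many
  finite families of basis sets, so hitting events suffice.\<close>

lemma card_le_open:
  assumes "open V"
  shows "{w \<in> space M. \<exists>T. T \<subseteq> S w \<inter> V \<and> finite T \<and> card T = n} \<in> sets M" (is "?L \<in> _")
proof -
  obtain B :: "'a set set" where B: "countable B" "topological_basis B"
    using ex_countable_basis by auto
  define D where "D = {F. finite F \<and> F \<subseteq> B \<and> card F = n \<and> disjoint F \<and> \<Union>F \<subseteq> V}"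
  have "D \<subseteq> {F. F \<subseteq> B \<and> finite F}" by (auto simp: D_def)
  then have countD: "countable D"
    using countable_Collect_finite_subset[OF B(1)]
      by (auto elim!: countable_subset[rotated] simp: conj_commute)
  have "?L = (\<Union>F\<in>D. {w \<in> space M. \<forall>b\<in>F. S w \<inter> b \<noteq> {}})" (is "_ = ?R")
  proof (intro set_eqI iffI)
    fix w assume "w \<in> ?L"
    then obtain T where w: "w \<in> space M" and T: "T \<subseteq> S w \<inter> V" "finite T" "card T = n" by auto
    obtain b where b: "\<And>x. x \<in> T \<Longrightarrow> b x \<in> B \<and> x \<in> b x \<and> b x \<subseteq> V" "disjoint_family_on b T"
      using finite_disjoint_basis[OF B(2) T(2) _ assms] T(1) by (metis le_inf_iff)
    have inj: "inj_on b T"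
    proof (rule inj_onI, rule ccontr)
      fix x y assume "x \<in> T" "y \<in> T" "b x = b y" "x \<noteq> y"
      then show False using b(1)[of x] disjoint_family_onD[OF b(2), of x y] by auto
    qed
    have "b ` T \<in> D"
      using b T inj disjoint_family_on_disjoint_image[OF b(2)] by (auto simp: D_def card_image)
    moreover have "\<forall>c\<in>b ` T. S w \<inter> c \<noteq> {}" using b T by blast
    ultimately show "w \<in> ?R" using w by blast
  next
    fix w assume "w \<in> ?R"
    then obtain F where F: "F \<in> D" "w \<in> space M" "\<forall>b\<in>F. S w \<inter> b \<noteq> {}" by auto
    then have "\<forall>b\<in>F. \<exists>x. x \<in> S w \<inter> b" by blast
    then obtain x where x: "\<And>b. b \<in> F \<Longrightarrow> x b \<in> S w \<inter> b" by metis
    have dis: "disjoint F" using F by (simp add: D_def)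
    have "inj_on x F"
    proof (rule inj_onI)
      fix b c assume "b \<in> F" "c \<in> F" "x b = x c"
      then have "b \<inter> c \<noteq> {}" using x[of b] x[of c] by auto
      then show "b = c" using dis \<open>b \<in> F\<close> \<open>c \<in> F\<close> by (auto simp: disjoint_def)
    qed
    then show "w \<in> ?L"
      using F x by (auto simp: D_def card_image subset_eq intro!: exI[of _ "x ` F"])
  qed
  also have "\<dots> \<in> sets M"
  proof (intro sets.countable_UN'' countD)
    fix F assume "F \<in> D"
    then have "finite F" "\<And>b. b \<in> F \<Longrightarrow> open b"
      using B(2) by (auto simp: D_def topological_basis_open)
    then show "{w \<in> space M. \<forall>b\<in>F. S w \<inter> b \<noteq> {}} \<in> sets M"
      by (intro sets.sets_Collect_finite_All hit_open) auto
  qed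
  finally show ?thesis .
qed

lemma cnt_open_measurable:
  assumes "open V"
  shows "cnt V \<in> borel_measurable M"
proof (rule borel_measurableI_greater)
  fix y :: ennreal
  have "{w \<in> space M. y < cnt V w} =
    (\<Union>n\<in>{n::nat. y < of_nat n}. {w \<in> space M. \<exists>T. T \<subseteq> S w \<inter> V \<and> finite T \<and> card T = n})"
  proof (intro set_eqI iffI)
    fix w assume "w \<in> {w \<in> space M. y < cnt V w}"
    then have w: "w \<in> space M" "y < cnt V w" by auto
    show "w \<in> (\<Union>n\<in>{n::nat. y < of_nat n}. {w \<in> space M. \<exists>T. T \<subseteq> S w \<inter> V \<and> finite T \<and> card T = n})"
    proof (cases "finite (S w \<inter> V)")
      case True
      then have "cnt V w = of_nat (card (S w \<inter> V))"
        by (simp add: cnt_def emeasure_count_space)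
      then show ?thesis using w True by (auto intro!: exI[of _ "card (S w \<inter> V)"])
    next
      case False
      then have "y < \<infinity>" using w by (simp add: cnt_def emeasure_count_space)
      then obtain n :: nat where n: "y < of_nat n"
        using ennreal_Ex_less_of_nat by (metis infinity_ennreal_def)
      obtain T where "finite T" "card T = n" "T \<subseteq> S w \<inter> V"
        using infinite_arbitrarily_large[OF False] by blast
      then show ?thesis using n w by auto
    qed
  next
    fix w assume "w \<in> (\<Union>n\<in>{n::nat. y < of_nat n}. {w \<in> space M. \<exists>T. T \<subseteq> S w \<inter> V \<and> finite T \<and> card T
      = n})"
    then obtain T where w: "w \<in> space M" "y < of_nat (card T)" "T \<subseteq> S w \<inter> V" "finite T" by auto
    have "of_nat (card T) = emeasure (count_space UNIV) T"
      using w by (simp add: emeasure_count_space)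
    also have "\<dots> \<le> cnt V w" unfolding cnt_def by (rule emeasure_mono) (use w in auto)
    finally show "w \<in> {w \<in> space M. y < cnt V w}" using w by auto
  qed
  also have "\<dots> \<in> sets M"
    by (intro sets.countable_UN'' card_le_open assms) auto
  finally show "{w \<in> space M. y < cnt V w} \<in> sets M" .
qed

text \<open>A Dynkin argument starting from open sets. It runs inside a fixed \<open>E n\<close>,
  where counts are finite and the count of a complement is a difference; letting \<open>n\<close>
  grow removes the restriction.\<close>

lemma cnt_measurable [measurable]:
  assumes A: "A \<in> sets borel"
  shows "cnt A \<in> borel_measurable M"
proof -
  have *: "cnt (A \<inter> E n) \<in> borel_measurable M" for n
  proof -
    have "Int_stable {V::'a set. open V}" by (auto simp: Int_stable_def)
    moreover have "{V::'a set. open V} \<subseteq> Pow UNIV" by auto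
    moreover have "A \<in> sigma_sets UNIV {V::'a set. open V}" using A by (simp add: borel_def)
    ultimately show ?thesis
    proof (induct rule: sigma_sets_induct_disjoint)
      case (basic A)
      then show ?case by (intro cnt_open_measurable) (auto intro: open_E)
    next
      case empty
      then show ?case by (simp add: cnt_def[abs_def])
    next
      case (compl A)
      have "cnt ((UNIV - A) \<inter> E n) w = cnt (E n) w - cnt (A \<inter> E n) w" if "w \<in> space M" for w
      proof -
        have fin: "finite (S w \<inter> (A \<inter> E n))" using finite_E[OF that, of n]
          by (rule rev_finite_subset) auto
        have "S w \<inter> ((UNIV - A) \<inter> E n) = (S w \<inter> E n) - (S w \<inter> (A \<inter> E n))" by auto
        then show ?thesis unfolding cnt_def
          using fin by (simp only:) (rule emeasure_Diff, auto)
      qed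
      then show ?case
        using compl cnt_open_measurable[OF open_E]
        by (subst measurable_cong[of _ _ "\<lambda>w. cnt (E n) w - cnt (A \<inter> E n) w"])
          (auto intro!: borel_measurable_minus_ennreal)
    next
      case (union F)
      have "cnt (\<Union>(range F) \<inter> E n) w = (\<Sum>i. cnt (F i \<inter> E n) w)" for w
      proof -
        have "S w \<inter> (\<Union>(range F) \<inter> E n) = (\<Union>i. S w \<inter> (F i \<inter> E n))" by auto
        moreover have "disjoint_family (\<lambda>i. S w \<inter> (F i \<inter> E n))"
          using union(1) by (auto simp: disjoint_family_on_def)
        ultimately show ?thesis
          by (simp add: cnt_def suminf_emeasure)
      qed
      then show ?case using union(3) by (subst measurable_cong) auto
    qed
  qed
  have "cnt A w = (SUP n. cnt (A \<inter> E n) w)" for w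
  proof -
    have "(\<Union>n. S w \<inter> (A \<inter> E n)) = S w \<inter> A" using UN_E by auto
    moreover have "incseq (\<lambda>n. S w \<inter> (A \<inter> E n))" using incseq_E by (fastforce simp: incseq_def)
    ultimately show ?thesis unfolding cnt_def by (subst SUP_emeasure_incseq) auto
  qed
  then show ?thesis using * by (subst measurable_cong) auto
qed

lemma nn_integral_indicator_points [simp]:
  "(\<integral>\<^sup>+x. indicator A x \<partial>count_space (S w)) = cnt A w"
proof -
  have "(\<integral>\<^sup>+x. indicator A x \<partial>count_space (S w))
    = (\<integral>\<^sup>+x. indicator A x \<partial>restrict_space (count_space UNIV) (S w))"
    by (simp add: restrict_count_space)
  also have "\<dots> = (\<integral>\<^sup>+x. indicator (S w \<inter> A) x \<partial>count_space UNIV)"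
    by (subst nn_integral_restrict_space) (auto intro!: nn_integral_cong split: split_indicator simp
      del: nn_integral_indicator)
  finally show ?thesis by (simp add: cnt_def)
qed

lemma nn_integral_point_measurable:
  assumes "F \<in> borel_measurable borel"
  shows "(\<lambda>w. \<integral>\<^sup>+x. F x \<partial>count_space (S w)) \<in> borel_measurable M"
  using assms
proof (induct rule: borel_measurable_induct)
  case (cong f g)
  then have "f = g" by auto
  then show ?case using cong by simp
next
  case (set A)
  then show ?case using set by simp
next
  case (mult u c)
  then show ?case by (simp add: nn_integral_cmult)
next
  case (add u v)
  then show ?case by (simp add: nn_integral_add)
next
  case (seq U)
  have "(\<integral>\<^sup>+x. (SUP i. U i) x \<partial>count_space (S w)) = (SUP i. \<integral>\<^sup>+x. U i x \<partial>count_space (S w))" for w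
    using seq by (subst nn_integral_monotone_convergence_SUP[symmetric]) (auto simp:
      SUP_apply[abs_def])
  then show ?case using seq by simp
qed

text \<open>Known as the first moment measure, or mean measure, of a point process.\<close>

definition intensity :: "'a measure" where
  "intensity = measure_of UNIV (sets borel) (\<lambda>A. \<integral>\<^sup>+w. cnt A w \<partial>M)"

lemma sets_intensity [simp, measurable_cong]: "sets intensity = sets borel"
  unfolding intensity_def using sets.sigma_sets_eq[of "borel :: 'a measure"] by simp

lemma emeasure_intensity:
  assumes "A \<in> sets borel"
  shows "emeasure intensity A = (\<integral>\<^sup>+w. cnt A w \<partial>M)"
proof -
  have ca: "countably_additive (sets borel) (\<lambda>A. \<integral>\<^sup>+w. cnt A w \<partial>M)"
    unfolding countably_additive_def
  proof (intro allI impI)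
    fix A :: "nat \<Rightarrow> 'a set"
    assume A: "range A \<subseteq> sets borel" "disjoint_family A" "\<Union>(range A) \<in> sets borel"
    have "(\<Sum>i. cnt (A i) w) = cnt (\<Union>(range A)) w" for w
    proof -
      have "S w \<inter> \<Union>(range A) = (\<Union>i. S w \<inter> A i)" by auto
      moreover have "disjoint_family (\<lambda>i. S w \<inter> A i)"
        using A(2) by (auto simp: disjoint_family_on_def)
      ultimately show ?thesis by (simp add: cnt_def suminf_emeasure)
    qed
    then show "(\<Sum>i. \<integral>\<^sup>+w. cnt (A i) w \<partial>M) = (\<integral>\<^sup>+w. cnt (\<Union>(range A)) w \<partial>M)"
      using A by (subst nn_integral_suminf[symmetric]) auto
  qed
  show ?thesis
    unfolding intensity_def
  proof (rule emeasure_measure_of_sigma[OF _ _ ca assms])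
    show "sigma_algebra UNIV (sets (borel :: 'a measure))"
      by (metis sets.sigma_algebra_axioms space_borel)
    show "positive (sets borel) (\<lambda>A. \<integral>\<^sup>+w. cnt A w \<partial>M)" by (simp add: positive_def cnt_def)
  qed
qed

text \<open>Campbell's formula. For indicators it is the definition of \<open>intensity\<close>; it
  extends through linear combinations and monotone limits.\<close>

lemma nn_integral_intensity:
  assumes "F \<in> borel_measurable borel"
  shows "(\<integral>\<^sup>+x. F x \<partial>intensity) = (\<integral>\<^sup>+w. \<integral>\<^sup>+x. F x \<partial>count_space (S w) \<partial>M)"
  using assms
proof (induct rule: borel_measurable_induct)
  case (cong f g)
  then have "f = g" by auto
  then show ?case using cong by simp
next
  case (set A)
  then show ?case using set by (simp add: emeasure_intensity)
next
  case (mult u c)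
  then show ?case
    by (simp add: nn_integral_cmult nn_integral_point_measurable)
next
  case (add u v)
  then show ?case by (simp add: nn_integral_add nn_integral_point_measurable)
next
  case (seq U)
  have *: "(\<integral>\<^sup>+x. (SUP i. U i) x \<partial>count_space (S w))
    = (SUP i. \<integral>\<^sup>+x. U i x \<partial>count_space (S w))" for w
    using seq by (subst nn_integral_monotone_convergence_SUP[symmetric]) (auto simp:
      SUP_apply[abs_def])
  have inc: "incseq (\<lambda>i w. \<integral>\<^sup>+x. U i x \<partial>count_space (S w))"
    using \<open>incseq U\<close> by (auto simp: incseq_def le_fun_def intro!: nn_integral_mono)
  have "(\<integral>\<^sup>+x. (SUP i. U i) x \<partial>intensity) = (SUP i. \<integral>\<^sup>+x. U i x \<partial>intensity)"
    using seq by (subst nn_integral_monotone_convergence_SUP[symmetric]) (auto simp: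
      SUP_apply[abs_def])
  also have "\<dots> = (SUP i. \<integral>\<^sup>+w. \<integral>\<^sup>+x. U i x \<partial>count_space (S w) \<partial>M)" using seq by simp
  also have "\<dots> = (\<integral>\<^sup>+w. (SUP i. \<integral>\<^sup>+x. U i x \<partial>count_space (S w)) \<partial>M)"
    using inc seq by (intro nn_integral_monotone_convergence_SUP[symmetric]
      nn_integral_point_measurable)
  finally show ?case using * by simp
qed

end

subsection \<open>Uniqueness of Haar measure\<close>

lemma radon_measure_sigma_finite:
  fixes m :: "'a::lcsc_group_add measure"
  assumes "radon_measure m"
  shows "sigma_finite_measure m"
proof -
  obtain K :: "nat \<Rightarrow> 'a set" where K: "\<And>n. compact (K n)" "(\<Union>n. K n) = UNIV"
    using open_eq_incseq_compact[OF open_UNIV] by metis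
  have sets: "sets m = sets borel" and fin: "\<And>K. compact K \<Longrightarrow> emeasure m K < \<infinity>"
    using assms by (auto simp: radon_measure_def)
  have [simp]: "space m = UNIV" using sets_eq_imp_space_eq[OF sets] by simp
  show ?thesis
    using K fin by (intro sigma_finite_measure.intro exI[of _ "range K"])
      (auto simp: sets less_top[symmetric] intro!: borel_compact)
qed

text \<open>Haar measure without nontriviality, so that a measure compared with a Haar measure need
  not be known to be nonzero beforehand.\<close>

definition left_invariant :: "'a::lcsc_group_add measure \<Rightarrow> bool" where
  "left_invariant m \<longleftrightarrow> radon_measure m \<and>
     (\<forall>g. \<forall>A\<in>sets borel. emeasure m (translate g A) = emeasure m A)"

lemma haar_measure_iff: "haar_measure m \<longleftrightarrow> left_invariant m \<and> emeasure m UNIV \<noteq> 0"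
  by (auto simp: haar_measure_def left_invariant_def)

lemma left_invariantD:
  assumes "left_invariant m"
  shows "sets m = sets borel" "space m = UNIV" "sigma_finite_measure m"
    "\<And>K. compact K \<Longrightarrow> emeasure m K < \<infinity>"
    "\<And>g A. A \<in> sets borel \<Longrightarrow> emeasure m (translate g A) = emeasure m A"
proof -
  show s: "sets m = sets borel" using assms by (simp add: left_invariant_def radon_measure_def)
  show "space m = UNIV" using sets_eq_imp_space_eq[OF s] by simp
  show "sigma_finite_measure m" using assms
    by (simp add: left_invariant_def radon_measure_sigma_finite)
  show "emeasure m K < \<infinity>" if "compact K" for K
    using assms that by (simp add: left_invariant_def radon_measure_def)
  show "emeasure m (translate g A) = emeasure m A" if "A \<in> sets borel" for g A
    using assms that by (simp add: left_invariant_def)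
qed

lemma measurable_plus_left [measurable]:
  "(\<lambda>x. g + x) \<in> borel_measurable (borel :: 'a::lcsc_group_add measure)"
  by (intro borel_measurable_continuous_onI continuous_intros)

lemma measurable_plus_right [measurable]:
  "(\<lambda>x. x + g) \<in> borel_measurable (borel :: 'a::lcsc_group_add measure)"
  by (intro borel_measurable_continuous_onI continuous_intros)

lemma measurable_uminus_group [measurable]:
  "uminus \<in> borel_measurable (borel :: 'a::lcsc_group_add measure)"
  by (intro borel_measurable_continuous_onI continuous_intros)

lemma measurable_pair_plus [measurable]:
  "(\<lambda>p. fst p + snd p) \<in> borel \<Otimes>\<^sub>M borel \<rightarrow>\<^sub>M (borel :: 'a::lcsc_group_add measure)"
  unfolding borel_prod by (intro borel_measurable_continuous_onI continuous_intros)

lemma measurable_pair_minus_plus [measurable]: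
  "(\<lambda>p. - fst p + snd p) \<in> borel \<Otimes>\<^sub>M borel \<rightarrow>\<^sub>M (borel :: 'a::lcsc_group_add measure)"
  unfolding borel_prod by (intro borel_measurable_continuous_onI continuous_intros)

lemma left_invariant_nn_integral:
  assumes m: "left_invariant m" and f: "f \<in> borel_measurable borel"
  shows "(\<integral>\<^sup>+x. f (g + x) \<partial>m) = (\<integral>\<^sup>+x. f x \<partial>m)"
proof -
  note [measurable_cong] = left_invariantD(1)[OF m]
  have "distr m borel ((+) g) = m"
  proof (rule measure_eqI)
    fix A assume "A \<in> sets (distr m borel ((+) g))"
    then have A: "A \<in> sets borel" by simp
    have "emeasure (distr m borel ((+) g)) A = emeasure m ((+) g -` A)"
      using A left_invariantD(2)[OF m] by (subst emeasure_distr) simp_all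
    also have "(+) g -` A = translate (- g) A" by (simp add: translate_vimage)
    finally show "emeasure (distr m borel ((+) g)) A = emeasure m A"
      using left_invariantD(5)[OF m A] by simp
  qed (simp add: left_invariantD[OF m])
  then have "(\<integral>\<^sup>+x. f x \<partial>m) = (\<integral>\<^sup>+x. f x \<partial>distr m borel ((+) g))" by simp
  also have "\<dots> = (\<integral>\<^sup>+x. f (g + x) \<partial>m)"
    using f by (subst nn_integral_distr) auto
  finally show ?thesis by simp
qed

text \<open>
  Weil's uniqueness argument: applied to \<open>n\<close> and to \<open>m\<close>, it exhibits both as the same measure
  divided by the same density.
\<close>

lemma left_invariant_swap:
  fixes m n :: "'a::lcsc_group_add measure"
  assumes m: "left_invariant m" and n: "left_invariant n"
    and A: "A \<in> sets borel" and B: "B \<in> sets borel"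
  shows "(\<integral>\<^sup>+x. indicator A x * emeasure m ((\<lambda>y. y + x) -` B) \<partial>n)
           = emeasure n B * emeasure m (uminus -` A)"
proof -
  note [measurable_cong] = left_invariantD(1)[OF m] left_invariantD(1)[OF n]
  note [measurable] = A B
  interpret m: sigma_finite_measure m by (rule left_invariantD(3)[OF m])
  interpret n: sigma_finite_measure n by (rule left_invariantD(3)[OF n])
  interpret mn: pair_sigma_finite m n ..
  have vB: "(\<lambda>y. y + x) -` B \<in> sets borel" for x
    using measurable_sets[OF measurable_plus_right B, of x] by simp
  have vA: "uminus -` A \<in> sets borel"
    using measurable_sets[OF measurable_uminus_group A] by simp
  have "(\<integral>\<^sup>+x. indicator A x * emeasure m ((\<lambda>y. y + x) -` B) \<partial>n)
      = (\<integral>\<^sup>+x. \<integral>\<^sup>+y. indicator A x * indicator B (y + x) \<partial>m \<partial>n)"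
  proof (rule nn_integral_cong)
    fix x
    have "(\<integral>\<^sup>+y. indicator B (y + x) \<partial>m) = (\<integral>\<^sup>+y. indicator ((\<lambda>y. y + x) -` B) y \<partial>m)"
      by (simp add: indicator_def vimage_def)
    also have "\<dots> = emeasure m ((\<lambda>y. y + x) -` B)"
      using vB by (simp add: left_invariantD(1)[OF m])
    finally show "indicator A x * emeasure m ((\<lambda>y. y + x) -` B)
      = (\<integral>\<^sup>+y. indicator A x * indicator B (y + x) \<partial>m)"
      by (subst nn_integral_cmult) auto
  qed
  also have "\<dots> = (\<integral>\<^sup>+y. \<integral>\<^sup>+x. indicator A x * indicator B (y + x) \<partial>n \<partial>m)"
    by (rule mn.Fubini') measurable
  also have "\<dots> = (\<integral>\<^sup>+y. \<integral>\<^sup>+x. indicator A (- y + x) * indicator B x \<partial>n \<partial>m)"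
  proof (rule nn_integral_cong)
    fix y
    show "(\<integral>\<^sup>+x. indicator A x * indicator B (y + x) \<partial>n) = (\<integral>\<^sup>+x. indicator A (- y
      + x) * indicator B x \<partial>n :: ennreal)"
      using left_invariant_nn_integral[OF n, of "\<lambda>x. indicator A (- y + x) * indicator B x" y]
      by (simp add: add.assoc[symmetric])
  qed
  also have "\<dots> = (\<integral>\<^sup>+x. \<integral>\<^sup>+y. indicator A (- y + x) * indicator B x \<partial>m \<partial>n)"
    by (rule mn.Fubini'[symmetric]) measurable
  also have "\<dots> = (\<integral>\<^sup>+x. emeasure m (uminus -` A) * indicator B x \<partial>n)"
  proof (rule nn_integral_cong)
    fix x
    have "(\<integral>\<^sup>+y. indicator A (- y + x) * indicator B x \<partial>m) = (\<integral>\<^sup>+y. indicator A (- y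
      + x) \<partial>m) * indicator B x"
      by (rule nn_integral_multc) measurable
    \<comment> \<open>Replacing \<open>y\<close> by \<open>x + y\<close> turns
      \<open>- y + x\<close> into \<open>- y\<close>, so the inner integral is independent of
      \<open>x\<close> and factors out.\<close>
    also have "(\<integral>\<^sup>+y. indicator A (- y + x) \<partial>m) = (\<integral>\<^sup>+y. indicator A (- (x + y) + x) \<partial>m :: ennreal)"
      by (rule left_invariant_nn_integral[OF m, symmetric]) measurable
    also have "\<dots> = (\<integral>\<^sup>+y. indicator (uminus -` A) y \<partial>m)"
      by (simp add: minus_add indicator_def vimage_def)
    also have "\<dots> = emeasure m (uminus -` A)"
      using vA by (simp add: left_invariantD(1)[OF m])
    finally show "(\<integral>\<^sup>+y. indicator A (- y + x) * indicator B x \<partial>m)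
      = emeasure m (uminus -` A) * indicator B x" .
  qed
  also have "\<dots> = emeasure n B * emeasure m (uminus -` A)"
    by (subst nn_integral_cmult) (auto simp: left_invariantD(1)[OF n] mult.commute)
  finally show ?thesis .
qed

lemma haar_measureD: "haar_measure m \<Longrightarrow> left_invariant m"
  by (simp add: haar_measure_iff)

text \<open>If \<open>U\<close> were null, countably many of its translates (Lindelof) would cover
  the whole group and make the measure zero.\<close>

lemma haar_open_pos:
  fixes m :: "'a::lcsc_group_add measure"
  assumes m: "haar_measure m" and U: "open U" "U \<noteq> {}"
  shows "emeasure m U > 0"
proof (rule ccontr)
  assume "\<not> emeasure m U > 0"
  then have 0: "emeasure m U = 0" by simp
  obtain u where u: "u \<in> U" using U by auto
  note D = left_invariantD[OF haar_measureD[OF m]]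
  have "\<And>S. S \<in> range (\<lambda>g. translate g U) \<Longrightarrow> open S" using U by (auto intro: open_translate)
  then obtain F where F: "F \<subseteq> range (\<lambda>g. translate g U)" "countable F" "\<Union>F
    = \<Union>(range (\<lambda>g. translate g U))"
    using Lindelof by metis
  have "x \<in> translate (x - u) U" for x using u by (simp add: mem_translate minus_diff_eq add.assoc)
  then have "\<Union>F = UNIV" unfolding F(3) by blast
  moreover have "\<Union>F \<in> null_sets m"
    using F U 0 D by (intro null_sets_UN'[of F
      "\<lambda>x. x", simplified]) (auto intro!: null_setsI borel_open open_translate)
  ultimately show False using m by (simp add: haar_measure_iff null_setsD1)
qed

lemma relcompact_open_exists:
  obtains B :: "'a::lcsc_group_add set" and K where "open B" "0 \<in> B" "compact K" "B \<subseteq> K"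
  using locally_compact_UNIV[of "0::'a"] by metis

text \<open>This is the weight in Weil's argument; positivity and finiteness are what allow dividing
  by it.\<close>

lemma haar_open_vimage_right:
  fixes m :: "'a::lcsc_group_add measure"
  assumes m: "haar_measure m" and B: "open B" "0 \<in> B" "compact K" "B \<subseteq> K"
  shows "emeasure m ((\<lambda>y. y + x) -` B) > 0" "emeasure m ((\<lambda>y. y + x) -` B) < \<infinity>"
proof -
  have "open ((\<lambda>y. y + x) -` B)" by (intro open_vimage B continuous_intros)
  moreover have "- x \<in> (\<lambda>y. y + x) -` B" using B by simp
  ultimately show "emeasure m ((\<lambda>y. y + x) -` B) > 0" using haar_open_pos[OF m] by blast
  have "(\<lambda>y. y + x) -` B \<subseteq> (\<lambda>y. y - x) ` K"
  proof
    fix y assume "y \<in> (\<lambda>y. y + x) -` B"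
    then show "y \<in> (\<lambda>y. y - x) ` K" using B by (intro image_eqI[of _ _ "y
      + x"]) (auto simp: add.assoc)
  qed
  moreover have c: "compact ((\<lambda>y. y - x) ` K)"
    using B unfolding diff_conv_add_uminus by (intro compact_continuous_image continuous_intros)
  ultimately have "emeasure m ((\<lambda>y. y + x) -` B) \<le> emeasure m ((\<lambda>y. y - x) ` K)"
    using left_invariantD(1)[OF haar_measureD[OF m]] borel_compact[OF c]
      by (intro emeasure_mono) auto
  also have "\<dots> < \<infinity>" using left_invariantD(4)[OF haar_measureD[OF m] c] .
  finally show "emeasure m ((\<lambda>y. y + x) -` B) < \<infinity>" .
qed

lemma measurable_emeasure_vimage_right:
  assumes m: "left_invariant (m :: 'a::lcsc_group_add measure)" and B: "B \<in> sets borel"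
  shows "(\<lambda>x. emeasure m ((\<lambda>y. y + x) -` B)) \<in> borel_measurable borel"
proof -
  note [measurable_cong] = left_invariantD(1)[OF m]
  note [measurable] = B
  interpret m: sigma_finite_measure m by (rule left_invariantD(3)[OF m])
  have "emeasure m ((\<lambda>y. y + x) -` B) = (\<integral>\<^sup>+y. indicator B (y + x) \<partial>m)" for x
  proof -
    have "(\<lambda>y. y + x) -` B \<in> sets borel"
      using measurable_sets[OF measurable_plus_right B, of x] by simp
    then have "emeasure m ((\<lambda>y. y + x) -` B) = (\<integral>\<^sup>+y. indicator ((\<lambda>y. y + x) -` B) y \<partial>m)"
      by (simp add: left_invariantD(1)[OF m])
    then show ?thesis by (simp add: indicator_def vimage_def)
  qed
  moreover have "(\<lambda>x. \<integral>\<^sup>+y. indicator B (y + x) \<partial>m) \<in> borel_measurable borel" by measurable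
  ultimately show ?thesis by simp
qed

text \<open>The factor is the ratio of the masses of one relatively compact open set
  \<open>B\<close>, whose mass under \<open>m\<close> is positive and finite. It is zero exactly
  when \<open>n\<close> vanishes.\<close>

lemma left_invariant_unique:
  fixes m n :: "'a::lcsc_group_add measure"
  assumes m: "haar_measure m" and n: "left_invariant n"
  obtains c where "c < \<infinity>" "\<And>A. A \<in> sets borel \<Longrightarrow> emeasure n A = c * emeasure m A"
proof -
  obtain B :: "'a set" and K where BK: "open B" "0 \<in> B" "compact K" "B \<subseteq> K"
    by (rule relcompact_open_exists)
  have B: "B \<in> sets borel" using BK by auto
  note lm = haar_measureD[OF m]
  note D = left_invariantD[OF lm] and Dn = left_invariantD[OF n]
  define h where "h x = emeasure m ((\<lambda>y. y + x) -` B)" for x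
  have h [measurable]: "h \<in> borel_measurable borel"
    unfolding h_def by (rule measurable_emeasure_vimage_right[OF lm B])
  have hpos: "0 < h x" "h x < \<infinity>" for x
    using haar_open_vimage_right[OF m BK] by (auto simp: h_def)
  note [measurable_cong] = D(1) Dn(1)
  have eq: "scale_measure (emeasure m B) (density n h) = scale_measure (emeasure n B) (density m h)"
  proof (rule measure_eqI)
    fix A assume "A \<in> sets (scale_measure (emeasure m B) (density n h))"
    then have A: "A \<in> sets borel" by (simp add: Dn)
    have "emeasure (density n h) A = emeasure n B * emeasure m (uminus -` A)"
      using left_invariant_swap[OF lm n A B] A
        by (subst emeasure_density) (auto simp: h_def Dn mult.commute)
    moreover have "emeasure (density m h) A = emeasure m B * emeasure m (uminus -` A)"
      using left_invariant_swap[OF lm lm A B] A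
        by (subst emeasure_density) (auto simp: h_def D mult.commute)
    ultimately show "emeasure (scale_measure (emeasure m B) (density n h)) A
        = emeasure (scale_measure (emeasure n B) (density m h)) A"
      by (simp add: mult_ac)
  qed (simp add: D Dn)
  have main: "emeasure m B * emeasure n A = emeasure n B * emeasure m A" if A:
    "A \<in> sets borel" for A
  proof -
    note [measurable] = A
    \<comment> \<open>The indicator divided by the weight \<open>h\<close>; integrating it cancels
      the two densities in \<open>eq\<close>.\<close>
    let ?g = "\<lambda>x. indicator A x * inverse (h x)"
    have g: "h x * ?g x = indicator A x" for x
    proof -
      have "h x * inverse (h x) = 1"
        using hpos[of x] ennreal_divide_self[of "h x"] unfolding divide_ennreal_def
        by (simp add: less_top[symmetric])
      then show ?thesis
        unfolding mult.left_commute[of "h x" "indicator A x"] by (simp only: mult_1_right)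
    qed
    have "(\<integral>\<^sup>+x. ?g x \<partial>scale_measure (emeasure m B) (density n h)) = emeasure m B * emeasure n A"
      using A by (subst nn_integral_scale_measure) (auto simp: nn_integral_density g Dn)
    moreover have "(\<integral>\<^sup>+x. ?g x \<partial>scale_measure (emeasure n B) (density m h))
      = emeasure n B * emeasure m A"
      using A by (subst nn_integral_scale_measure) (auto simp: nn_integral_density g D)
    ultimately show ?thesis using eq by simp
  qed
  have pB: "emeasure m B > 0" using haar_open_pos[OF m] BK by auto
  have fB: "emeasure l B < \<infinity>" if "left_invariant l" for l
  proof -
    have "emeasure l B \<le> emeasure l K"
      using BK left_invariantD(1)[OF that] by (intro emeasure_mono) (auto intro: borel_compact)
    also have "\<dots> < \<infinity>" using left_invariantD(4)[OF that BK(3)] .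
    finally show ?thesis .
  qed
  show ?thesis
  proof
    show "emeasure n B / emeasure m B < \<infinity>"
      using pB fB[OF n] by (auto simp: ennreal_divide_eq_top_iff less_top[symmetric])
    fix A :: "'a set" assume A: "A \<in> sets borel"
    have "emeasure n A = emeasure n A * emeasure m B / emeasure m B"
      using pB fB[OF lm] by (subst ennreal_mult_divide_eq) auto
    also have "\<dots> = emeasure n B / emeasure m B * emeasure m A"
      unfolding mult.commute[of "emeasure n A"] main[OF A]
      unfolding divide_ennreal_def by (simp only: mult_ac)
    finally show "emeasure n A = emeasure n B / emeasure m B * emeasure m A" .
  qed
qed

text \<open>Left and right translations commute, so a right translate of Haar measure is again left
  invariant and uniqueness applies. The factor is a value of the modular function; nothing forces it
  to be 1 at this stage.\<close>

lemma haar_right_translate: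
  fixes m :: "'a::lcsc_group_add measure"
  assumes m: "haar_measure m"
  obtains c where "0 < c" "c < \<infinity>"
    "\<And>A. A \<in> sets borel \<Longrightarrow> emeasure m ((\<lambda>y. y + g) -` A) = c * emeasure m A"
proof -
  note lm = haar_measureD[OF m]
  note D = left_invariantD[OF lm]
  note [measurable_cong] = D(1)
  define n where "n = distr m borel (\<lambda>y. y + g)"
  have en: "emeasure n A = emeasure m ((\<lambda>y. y + g) -` A)" if "A \<in> sets borel" for A
    unfolding n_def using that D by (subst emeasure_distr) auto
  have "left_invariant n"
    unfolding left_invariant_def radon_measure_def
  proof (intro conjI allI impI ballI)
    show "sets n = sets borel" by (simp add: n_def)
    fix K :: "'a set" assume K: "compact K"
    have "(\<lambda>y. y + g) -` K = (\<lambda>y. y - g) ` K"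
      by (auto simp: image_iff diff_conv_add_uminus add.assoc simp del: add_uminus_conv_diff intro!:
        bexI[of _ "_ + g"])
    moreover have "compact ((\<lambda>y. y - g) ` K)"
      using K unfolding diff_conv_add_uminus by (intro compact_continuous_image continuous_intros)
    ultimately show "emeasure n K < \<infinity>" using K D(4) by (simp add: en borel_compact)
  next
    fix h and A :: "'a set" assume A: "A \<in> sets borel"
    have "(\<lambda>y. y + g) -` translate h A = translate h ((\<lambda>y. y + g) -` A)"
      by (auto simp: mem_translate add.assoc)
    moreover have "(\<lambda>y. y + g) -` A \<in> sets borel"
      using measurable_sets[OF measurable_plus_right A, of g] by simp
    ultimately show "emeasure n (translate h A) = emeasure n A"
      using A D(5) by (simp add: en borel_translate)
  qed
  then obtain c where c: "c < \<infinity>" "\<And>A. A \<in> sets borel \<Longrightarrow> emeasure n A = c * emeasure m A"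
    using left_invariant_unique[OF m] by metis
  have "emeasure n UNIV \<noteq> 0" using m by (simp add: en haar_measure_iff)
  then have "c \<noteq> 0" using c(2)[of UNIV] by auto
  then show ?thesis using that[of c] c en by (auto simp: zero_less_iff_neq_zero)
qed

subsection \<open>The space of cosets of a lattice\<close>

text \<open>The members are both open and relatively compact: openness makes their counts
  measurable, compactness makes the intersections with a coset finite.\<close>

lemma lcsc_open_exhaustion:
  "\<exists>E :: nat \<Rightarrow> 'a::lcsc_group_add set. (\<forall>n. open (E n) \<and> (\<exists>K. compact K \<and> E n \<subseteq> K)) \<and> incseq E
    \<and> (\<Union>n. E n) = UNIV"
proof -
  obtain C :: "nat \<Rightarrow> 'a set" where C: "\<And>n. compact (C n)" "(\<Union>n. C n) = UNIV"
    using open_eq_incseq_compact[OF open_UNIV] by metis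
  have "\<forall>n. \<exists>V. open V \<and> C n \<subseteq> V \<and> (\<exists>K. compact K \<and> V \<subseteq> K)"
    using compact_subset_open_relcompact[OF C(1) open_UNIV subset_UNIV] by metis
  then obtain V where V: "\<And>n. open (V n)" "\<And>n. C n \<subseteq> V n" "\<And>n. \<exists>K. compact K \<and> V n \<subseteq> K"
    by metis
  then obtain K where K: "\<And>n. compact (K n)" "\<And>n. V n \<subseteq> K n" by metis
  show ?thesis
  proof (intro exI[of _ "\<lambda>n. \<Union>i\<le>n. V i"] conjI allI)
    show "open (\<Union>i\<le>n. V i)" for n using V by auto
    show "\<exists>L. compact L \<and> (\<Union>i\<le>n. V i) \<subseteq> L" for n
    proof (intro exI conjI)
      show "compact (\<Union>i\<le>n. K i)" using K by (intro compact_UN) auto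
      show "(\<Union>i\<le>n. V i) \<subseteq> (\<Union>i\<le>n. K i)" using K(2) by (intro UN_mono) auto
    qed
    show "incseq (\<lambda>n. \<Union>i\<le>n. V i)" by (auto simp: incseq_def intro: order.trans)
    have "(\<Union>n. C n) \<subseteq> (\<Union>n. \<Union>i\<le>n. V i)" using V(2) by (intro UN_mono) auto
    then show "(\<Union>n. \<Union>i\<le>n. V i) = UNIV" unfolding C(2) by auto
  qed
qed

definition exhaustion :: "nat \<Rightarrow> 'a::lcsc_group_add set" where
  "exhaustion = (SOME E. (\<forall>n. open (E n) \<and> (\<exists>K. compact K \<and> E n \<subseteq> K)) \<and> incseq E \<and> (\<Union>n. E n)
    = UNIV)"

lemma exhaustion:
  "open (exhaustion n :: 'a::lcsc_group_add set)" "\<exists>K. compact K \<and> (exhaustion n :: 'a set) \<subseteq> K"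
  "incseq (exhaustion :: nat \<Rightarrow> 'a set)" "(\<Union>n. exhaustion n :: 'a set) = UNIV"
proof -
  have E: "(\<forall>n. open (exhaustion n :: 'a set) \<and> (\<exists>K. compact K \<and> (exhaustion n :: 'a set) \<subseteq> K)) \<and>
      incseq (exhaustion :: nat \<Rightarrow> 'a set) \<and> (\<Union>n. exhaustion n :: 'a set) = UNIV"
    unfolding exhaustion_def by (rule someI_ex[OF lcsc_open_exhaustion])
  show "open (exhaustion n :: 'a set)" "\<exists>K. compact K \<and> (exhaustion n :: 'a set) \<subseteq> K"
    using conjunct1[OF E] by simp_all
  show "incseq (exhaustion :: nat \<Rightarrow> 'a set)" "(\<Union>n. exhaustion n :: 'a set) = UNIV"
    using conjunct2[OF E] by simp_all
qed

lemma emeasure_count_image_inj: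
  assumes "inj_on f A"
  shows "emeasure (count_space UNIV) (f ` A) = emeasure (count_space UNIV) A"
  using assms by (cases "finite A") (auto simp: emeasure_count_space card_image finite_image_iff)

locale lattice_quotient =
  fixes \<Gamma> :: "'a::lcsc_group_add set" and mY :: "'a set measure"
  assumes lattice: "lattice_subgroup \<Gamma>"
    and inv: "invariant_prob (quotient_top \<Gamma>) mY"
begin

lemma subgroup: "0 \<in> \<Gamma>" "x \<in> \<Gamma> \<Longrightarrow> y \<in> \<Gamma> \<Longrightarrow> x + y \<in> \<Gamma>" "x \<in> \<Gamma> \<Longrightarrow> - x \<in> \<Gamma>"
  using lattice by (auto simp: lattice_subgroup_def is_subgroup_def)

lemma mem_coset: "z \<in> left_coset \<Gamma> x \<longleftrightarrow> - x + z \<in> \<Gamma>"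
  by (simp add: left_coset_def mem_translate)

lemma coset_self: "x \<in> left_coset \<Gamma> x"
  by (simp add: mem_coset subgroup)

lemma coset_eq: "z \<in> left_coset \<Gamma> x \<Longrightarrow> left_coset \<Gamma> z = left_coset \<Gamma> x"
proof -
  assume "z \<in> left_coset \<Gamma> x"
  then have z: "- x + z \<in> \<Gamma>" by (simp only: mem_coset)
  have "- z + u \<in> \<Gamma> \<longleftrightarrow> - x + u \<in> \<Gamma>" for u
  proof
    assume u: "- z + u \<in> \<Gamma>"
    show "- x + u \<in> \<Gamma>" using subgroup(2)[OF z u] by (simp add: add.assoc)
  next
    assume u: "- x + u \<in> \<Gamma>"
    show "- z + u \<in> \<Gamma>" using subgroup(2)[OF subgroup(3)[OF z] u] by (simp add: minus_add add.assoc)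
  qed
  then show ?thesis unfolding set_eq_iff mem_coset by blast
qed

lemma coset_diff: "x \<in> left_coset \<Gamma> u \<Longrightarrow> z \<in> left_coset \<Gamma> u \<Longrightarrow> - x + z \<in> \<Gamma>"
  using coset_eq[of x u] mem_coset[of z x] by simp

lemma coset_add: "x \<in> left_coset \<Gamma> u \<Longrightarrow> \<gamma> \<in> \<Gamma> \<Longrightarrow> x + \<gamma> \<in> left_coset \<Gamma> u"
  using subgroup(2)[of "- u + x" \<gamma>] by (simp add: mem_coset add.assoc)

lemma translate_coset: "translate g (left_coset \<Gamma> x) = left_coset \<Gamma> (g + x)"
  by (simp add: left_coset_def translate_translate)

lemma sets_mY: "sets mY = sigma_sets (range (left_coset \<Gamma>)) {U. openin (quotient_top \<Gamma>) U}"
proof -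
  have "{U. openin (quotient_top \<Gamma>) U} \<subseteq> Pow (range (left_coset \<Gamma>))"
    using openin_subset by (auto simp: topspace_quotient_top[symmetric] simp del:
      topspace_quotient_top)
  then show ?thesis
    using inv by (simp add: invariant_prob_def borel_of_def topspace_quotient_top sets_measure_of)
qed

lemma space_mY: "space mY = range (left_coset \<Gamma>)"
proof -
  have "space mY = space (borel_of (quotient_top \<Gamma>))"
    using inv by (intro sets_eq_imp_space_eq) (simp add: invariant_prob_def)
  also have "\<dots> = range (left_coset \<Gamma>)"
    by (simp add: borel_of_def topspace_quotient_top space_measure_of_conv)
  finally show ?thesis .
qed

lemma openin_sets_mY: "openin (quotient_top \<Gamma>) U \<Longrightarrow> U \<in> sets mY"
  by (simp add: sets_mY)

lemma measurable_into_mY: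
  assumes "\<And>x. x \<in> space N \<Longrightarrow> f x \<in> range (left_coset \<Gamma>)"
    and "\<And>U. openin (quotient_top \<Gamma>) U \<Longrightarrow> f -` U \<inter> space N \<in> sets N"
  shows "f \<in> N \<rightarrow>\<^sub>M mY"
  using assms by (intro measurable_sigma_sets[OF sets_mY]) (auto simp: openin_quotient_top)

lemma measurable_left_coset [measurable]: "left_coset \<Gamma> \<in> borel \<rightarrow>\<^sub>M mY"
  by (rule measurable_into_mY) (auto simp: openin_quotient_top)

lemma measurable_translate_mY [measurable]: "translate g \<in> mY \<rightarrow>\<^sub>M mY"
proof (rule measurable_into_mY)
  fix U assume U: "openin (quotient_top \<Gamma>) U"
  have "left_coset \<Gamma> -` (translate g -` U \<inter> space mY) = (\<lambda>x. g + x) -` (left_coset \<Gamma> -` U)"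
    by (auto simp: space_mY translate_coset)
  moreover have "open \<dots>"
    using U by (intro open_vimage continuous_intros) (simp add: openin_quotient_top)
  ultimately have "openin (quotient_top \<Gamma>) (translate g -` U \<inter> space mY)"
    by (auto simp: openin_quotient_top space_mY)
  then show "translate g -` U \<inter> space mY \<in> sets mY" by (rule openin_sets_mY)
qed (auto simp: space_mY translate_coset)

sublocale prob_space mY
  using inv by (simp add: invariant_prob_def)

lemma emeasure_translate_mY: "A \<in> sets mY \<Longrightarrow> emeasure mY (translate g ` A) = emeasure mY A"
  using inv by (simp add: invariant_prob_def)

lemma nn_integral_translate_mY:
  assumes "F \<in> borel_measurable mY"
  shows "(\<integral>\<^sup>+y. F (translate g y) \<partial>mY) = (\<integral>\<^sup>+y. F y \<partial>mY)"
proof -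
  have "distr mY mY (translate g) = mY"
  proof (rule measure_eqI)
    fix A assume "A \<in> sets (distr mY mY (translate g))"
    then have A: "A \<in> sets mY" by simp
    have "translate g -` A \<inter> space mY = translate (- g) ` A"
    proof (intro set_eqI iffI)
      fix y assume "y \<in> translate g -` A \<inter> space mY"
      then show "y \<in> translate (- g) ` A"
        by (intro image_eqI[of _ _ "translate g y"]) (auto simp: translate_translate translate_0)
    next
      fix y assume "y \<in> translate (- g) ` A"
      then show "y \<in> translate g -` A \<inter> space mY"
        using sets.sets_into_space[OF A]
          by (auto simp: translate_translate translate_0 space_mY translate_coset)
    qed
    then show "emeasure (distr mY mY (translate g)) A = emeasure mY A"
      using A by (simp add: emeasure_distr emeasure_translate_mY)
  qed simp
  then have "(\<integral>\<^sup>+y. F y \<partial>mY) = (\<integral>\<^sup>+y. F y \<partial>distr mY mY (translate g))" by simp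
  also have "\<dots> = (\<integral>\<^sup>+y. F (translate g y) \<partial>mY)"
    using assms by (subst nn_integral_distr) auto
  finally show ?thesis by simp
qed

text \<open>Continuity of \<open>- p + q\<close> at the origin turns isolation of \<open>0\<close>
  in \<open>\<Gamma>\<close> into a neighbourhood whose left translates contain at most one point of
  any coset.\<close>

lemma separating_nbhd:
  obtains V where "open V" "0 \<in> V" "\<And>p q. p \<in> V \<Longrightarrow> q \<in> V \<Longrightarrow> - p + q \<in> \<Gamma> \<Longrightarrow> p = q"
proof -
  have "0 isolated_in \<Gamma>"
    using lattice subgroup(1) by (auto simp: lattice_subgroup_def dest: discreteD)
  then obtain U where U: "open U" "U \<inter> \<Gamma> = {0}" by (auto simp: isolated_in_def)
  have "open ((\<lambda>p. - fst p + snd p) -` U)"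
    by (intro open_vimage U continuous_intros)
  moreover have "(0, 0) \<in> (\<lambda>p. - fst p + snd p) -` U" using U by auto
  ultimately obtain A B where AB: "open A" "open B" "(0::'a, 0::'a) \<in> A \<times> B" "A \<times> B \<subseteq> (\<lambda>p. - fst p
    + snd p) -` U"
    by (rule open_prod_elim)
  show ?thesis
  proof
    show "open (A \<inter> B)" "0 \<in> A \<inter> B" using AB by auto
    fix p q assume "p \<in> A \<inter> B" "q \<in> A \<inter> B" "- p + q \<in> \<Gamma>"
    then have "- p + q \<in> U \<inter> \<Gamma>" using AB(4) by auto
    then have "- p + q = 0" using U by auto
    then show "p = q" by (metis add.right_neutral add_minus_cancel)
  qed
qed

text \<open>Finitely many translates of a separating neighbourhood cover \<open>K\<close>, each with
  at most one point of a coset. The bound is uniform in the coset, so that counts over compact sets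
  are bounded functions on the quotient.\<close>

lemma card_coset_bound:
  assumes K: "compact K"
  obtains n where "\<And>x. finite (left_coset \<Gamma> x \<inter> K)" "\<And>x. card (left_coset \<Gamma> x \<inter> K) \<le> n"
proof -
  obtain V where V: "open V" "0 \<in> V" "\<And>p q. p \<in> V \<Longrightarrow> q \<in> V \<Longrightarrow> - p + q \<in> \<Gamma> \<Longrightarrow> p = q"
    by (rule separating_nbhd) blast
  have "K \<subseteq> (\<Union>z\<in>K. translate z V)" using V by (auto simp: mem_translate)
  then obtain T where T: "T \<subseteq> K" "finite T" "K \<subseteq> (\<Union>z\<in>T. translate z V)"
    using compactE_image[OF K, of K "\<lambda>z. translate z V"] V by (metis open_translate)
  have one: "finite (left_coset \<Gamma> x \<inter> translate z V) \<and> card (left_coset \<Gamma> x \<inter> translate z V)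
    \<le> 1" for x z
  proof -
    have "p = q" if "p \<in> left_coset \<Gamma> x \<inter> translate z V"
      "q \<in> left_coset \<Gamma> x \<inter> translate z V" for p q
    proof -
      have "- (- z + p) + (- z + q) = - p + q" by (simp add: minus_add add.assoc)
      then have "- z + p = - z + q"
        using that coset_diff[of p x q] by (intro V(3)) (auto simp: mem_translate)
      then show ?thesis by simp
    qed
    then have "left_coset \<Gamma> x \<inter> translate z V = {} \<or> (\<exists>p. left_coset \<Gamma> x \<inter> translate z V = {p})"
      by blast
    then show ?thesis by (metis card.empty card_1_singleton_iff finite.emptyI finite.insertI
      le_numeral_extra(4) zero_le_one One_nat_def)
  qed
  have "finite (left_coset \<Gamma> x \<inter> K) \<and> card (left_coset \<Gamma> x \<inter> K) \<le> card T" for x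
  proof
    have sub: "left_coset \<Gamma> x \<inter> K \<subseteq> (\<Union>z\<in>T. left_coset \<Gamma> x \<inter> translate z V)" using T(3) by blast
    have fin: "finite (\<Union>z\<in>T. left_coset \<Gamma> x \<inter> translate z V)" using T(2) one
      by (intro finite_UN_I) simp_all
    show "finite (left_coset \<Gamma> x \<inter> K)" using sub fin by (rule finite_subset)
    have "card (left_coset \<Gamma> x \<inter> K) \<le> card (\<Union>z\<in>T. left_coset \<Gamma> x \<inter> translate z V)"
      using fin sub by (rule card_mono)
    also have "\<dots> \<le> (\<Sum>z\<in>T. card (left_coset \<Gamma> x \<inter> translate z V))" using T(2) by (rule card_UN_le)
    also have "\<dots> \<le> (\<Sum>z\<in>T. 1)" using one by (intro sum_mono) simp
    finally show "card (left_coset \<Gamma> x \<inter> K) \<le> card T" by simp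
  qed
  then show ?thesis using that[of "card T"] by simp
qed

lemma finite_coset_compact: "compact K \<Longrightarrow> finite (left_coset \<Gamma> x \<inter> K)"
  using card_coset_bound by metis

text \<open>A point of the quotient is a coset, hence itself a subset of the group: the random set
  is the identity map. Hitting \<open>V\<close> pulls back along \<open>left_coset \<Gamma>\<close>
  to a union of right translates of \<open>V\<close>, so it is an open event.\<close>

sublocale random_set mY "\<lambda>y. y" exhaustion
proof
  fix V :: "'a set" assume V: "open V"
  have "left_coset \<Gamma> -` {y \<in> space mY. y \<inter> V \<noteq> {}} = (\<Union>\<gamma>\<in>\<Gamma>. (\<lambda>x. x + \<gamma>) -` V)"
  proof (intro set_eqI iffI)
    fix x assume "x \<in> left_coset \<Gamma> -` {y \<in> space mY. y \<inter> V \<noteq> {}}"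
    then obtain z where "z \<in> left_coset \<Gamma> x" "z \<in> V" by auto
    then show "x \<in> (\<Union>\<gamma>\<in>\<Gamma>. (\<lambda>x. x + \<gamma>) -` V)" by (auto simp: mem_coset intro!: bexI[of _ "- x + z"])
  next
    fix x assume "x \<in> (\<Union>\<gamma>\<in>\<Gamma>. (\<lambda>x. x + \<gamma>) -` V)"
    then obtain \<gamma> where "\<gamma> \<in> \<Gamma>" "x + \<gamma> \<in> V" by auto
    then show "x \<in> left_coset \<Gamma> -` {y \<in> space mY. y \<inter> V \<noteq> {}}"
      using coset_add[OF coset_self] by (auto simp: space_mY)
  qed
  moreover have "open \<dots>" using V by (intro open_UN ballI open_vimage continuous_intros)
  ultimately show "{y \<in> space mY. y \<inter> V \<noteq> {}} \<in> sets mY"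
    by (intro openin_sets_mY) (auto simp: openin_quotient_top space_mY)
next
  show "finite (y \<inter> exhaustion n)" if y: "y \<in> space mY" for y n
  proof -
    obtain K where K: "compact K" "(exhaustion n :: 'a set) \<subseteq> K" using exhaustion(2)[of n] by auto
    obtain x where x: "y = left_coset \<Gamma> x" using y by (auto simp: space_mY)
    have "y \<inter> exhaustion n \<subseteq> left_coset \<Gamma> x \<inter> K" using K x by auto
    then show ?thesis using finite_coset_compact[OF K(1)] by (rule finite_subset)
  qed
qed (use exhaustion in auto)

lemma cnt_translate: "cnt (translate g A) (translate g y) = cnt A y"
  unfolding cnt_def translate_Int[symmetric] unfolding translate_def
  by (rule emeasure_count_image_inj) simp

text \<open>Counts are equivariant under translation, so invariance of \<open>mY\<close> passes to
  the mean count; the uniform bound on counts gives finiteness on compact sets.\<close>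

lemma left_invariant_intensity: "left_invariant intensity"
  unfolding left_invariant_def radon_measure_def
proof (intro conjI allI impI ballI)
  fix K :: "'a set" assume K: "compact K"
  then obtain n where n: "\<And>x. finite (left_coset \<Gamma> x \<inter> K)" "\<And>x. card (left_coset \<Gamma> x \<inter> K) \<le> n"
    by (rule card_coset_bound) blast
  have "emeasure intensity K = (\<integral>\<^sup>+y. cnt K y \<partial>mY)" using K
    by (intro emeasure_intensity borel_compact)
  also have "\<dots> \<le> (\<integral>\<^sup>+y. of_nat n \<partial>mY)"
    using n by (intro nn_integral_mono) (auto simp: cnt_def space_mY emeasure_count_space)
  also have "\<dots> < \<infinity>" by (simp add: emeasure_space_1 ennreal_of_nat_eq_real_of_nat)
  finally show "emeasure intensity K < \<infinity>" .
next
  fix g and A :: "'a set" assume A: "A \<in> sets borel"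
  have "emeasure intensity (translate g A) = (\<integral>\<^sup>+y. cnt (translate g A) y \<partial>mY)"
    using A by (intro emeasure_intensity borel_translate)
  also have "\<dots> = (\<integral>\<^sup>+y. cnt (translate g A) (translate g y) \<partial>mY)"
    using A by (intro nn_integral_translate_mY[symmetric] cnt_measurable borel_translate)
  also have "\<dots> = emeasure intensity A" using A by (simp add: cnt_translate emeasure_intensity)
  finally show "emeasure intensity (translate g A) = emeasure intensity A" .
qed simp

lemma haar_intensity: "haar_measure intensity"
proof -
  have "1 = (\<integral>\<^sup>+y. 1 \<partial>mY)" by (simp add: emeasure_space_1)
  also have "\<dots> \<le> (\<integral>\<^sup>+y. cnt UNIV y \<partial>mY)"
  proof (rule nn_integral_mono)
    fix y assume "y \<in> space mY"
    then obtain x where x: "x \<in> y" using coset_self by (auto simp: space_mY)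
    have "1 = emeasure (count_space UNIV) {x}" by (simp add: emeasure_count_space)
    also have "\<dots> \<le> cnt UNIV y" unfolding cnt_def using x by (intro emeasure_mono) auto
    finally show "1 \<le> cnt UNIV y" .
  qed
  also have "\<dots> = emeasure intensity UNIV" by (simp add: emeasure_intensity)
  finally have "emeasure intensity UNIV \<noteq> 0" by (metis not_one_le_zero)
  then show ?thesis using left_invariant_intensity by (simp add: haar_measure_iff)
qed

section \<open>Unimodularity forced by the lattice\<close>

lemma intensity_right_lattice:
  assumes A: "A \<in> sets borel" and \<gamma>: "\<gamma> \<in> \<Gamma>"
  shows "emeasure intensity ((\<lambda>z. z + \<gamma>) -` A) = emeasure intensity A"
proof -
  have "cnt ((\<lambda>z. z + \<gamma>) -` A) y = cnt A y" if y: "y \<in> space mY" for y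
  proof -
    obtain u where u: "y = left_coset \<Gamma> u" using y by (auto simp: space_mY)
    \<comment> \<open>Right translation by \<open>\<gamma>\<close> maps each coset onto itself and
      therefore only permutes the points being counted.\<close>
    have "(\<lambda>z. z + \<gamma>) ` (y \<inter> (\<lambda>z. z + \<gamma>) -` A) = y \<inter> A"
    proof (intro set_eqI iffI)
      fix z assume "z \<in> y \<inter> A"
      then show "z \<in> (\<lambda>z. z + \<gamma>) ` (y \<inter> (\<lambda>z. z + \<gamma>) -` A)"
        using coset_add[of z u "- \<gamma>"] subgroup(3)[OF \<gamma>]
        by (intro image_eqI[of _ _ "z
          + - \<gamma>"]) (auto simp: u add.assoc simp del: add_uminus_conv_diff)
    qed (use coset_add \<gamma> u in auto)
    moreover have "inj_on (\<lambda>z. z + \<gamma>) (y \<inter> (\<lambda>z. z + \<gamma>) -` A)" by (auto simp: inj_on_def)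
    ultimately show ?thesis
      unfolding cnt_def by (metis emeasure_count_image_inj)
  qed
  moreover have "(\<lambda>z. z + \<gamma>) -` A \<in> sets borel"
    using measurable_sets[OF measurable_plus_right A, of \<gamma>] by simp
  ultimately show ?thesis using A by (simp add: emeasure_intensity cong: nn_integral_cong)
qed

text \<open>By right invariance under the lattice, \<open>w\<close> lives on the quotient.
  Translation by \<open>g\<close> carries each sublevel set onto the one with level multiplied by
  \<open>c\<close>, without changing its mass. Iteration shrinks the sublevel sets to nothing, so
  all of them are null; yet they exhaust a probability space.\<close>

lemma no_contraction:
  fixes w :: "'a \<Rightarrow> real"
  assumes w [measurable]: "w \<in> borel_measurable borel" and pos: "\<And>x. 0 < w x"
    and \<Gamma>: "\<And>x \<gamma>. \<gamma> \<in> \<Gamma> \<Longrightarrow> w (x + \<gamma>) = w x"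
    and g: "\<And>x. w (g + x) = c * w x" and c: "0 < c" "c < 1"
  shows False
proof -
  \<comment> \<open>The sublevel set of \<open>w\<close> on the quotient, written through a count so
    that its measurability comes from \<open>cnt_measurable\<close>.\<close>
  define Y where "Y s = {y \<in> space mY. cnt {x. w x < s} y \<noteq> 0}" for s
  have [measurable]: "Y s \<in> sets mY" for s unfolding Y_def by measurable
  have Y: "left_coset \<Gamma> x \<in> Y s \<longleftrightarrow> w x < s" for x s
  proof -
    have "w z = w x" if "z \<in> left_coset \<Gamma> x" for z
      using \<Gamma>[of "- x + z" x] that by (simp add: mem_coset)
    then have "left_coset \<Gamma> x \<inter> {x. w x < s} = (if w x < s then left_coset \<Gamma> x else {})" by auto
    moreover have "left_coset \<Gamma> x \<noteq> {}" using coset_self by auto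
    moreover have "emeasure (count_space UNIV) A \<noteq> 0" if "A \<noteq> {}" for A :: "'a set"
      using that by (cases "finite A") (auto simp: emeasure_count_space)
    ultimately show ?thesis by (auto simp: Y_def space_mY cnt_def)
  qed
  have "translate g ` Y s = Y (c * s)" for s
  proof (intro set_eqI iffI)
    fix y assume "y \<in> translate g ` Y s"
    then obtain z where z: "z \<in> Y s" "y = translate g z" by auto
    then obtain x where "z = left_coset \<Gamma> x" by (auto simp: Y_def space_mY)
    then show "y \<in> Y (c * s)" using z c by (simp add: translate_coset Y g)
  next
    fix y assume y: "y \<in> Y (c * s)"
    then obtain x where x: "y = left_coset \<Gamma> x" by (auto simp: Y_def space_mY)
    have "c * w (- g + x) = w x" using g[of "- g + x"] by (simp add: add.assoc[symmetric])
    then have "c * w (- g + x) < c * s" using y x by (simp add: Y)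
    then have "left_coset \<Gamma> (- g + x) \<in> Y s" using c by (simp add: Y)
    then show "y \<in> translate g ` Y s"
      using x by (intro image_eqI) (auto simp: translate_coset add.assoc[symmetric])
  qed
  then have step: "emeasure mY (Y (c * s)) = emeasure mY (Y s)" for s
    using emeasure_translate_mY[of "Y s" g] by simp
  have iter: "emeasure mY (Y (c ^ n * s)) = emeasure mY (Y s)" for n s
    by (induction n) (simp_all add: step mult.assoc)
  have "emeasure mY (Y s) = 0" if "s > 0" for s
  proof -
    have dec: "decseq (\<lambda>n. Y (c ^ n * s))"
    proof (rule decseq_SucI, rule subsetI)
      fix n y assume y: "y \<in> Y (c ^ Suc n * s)"
      then obtain x where x: "y = left_coset \<Gamma> x" by (auto simp: Y_def space_mY)
      have "c ^ Suc n * s \<le> c ^ n * s" using c that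
        by (intro mult_right_mono power_Suc_le_self) auto
      then show "y \<in> Y (c ^ n * s)" using y x by (simp add: Y del: power_Suc)
    qed
    have "(\<Inter>n. Y (c ^ n * s)) = {}"
    proof (rule ccontr)
      assume "(\<Inter>n. Y (c ^ n * s)) \<noteq> {}"
      then obtain y where y: "\<And>n. y \<in> Y (c ^ n * s)" by auto
      then obtain x where x: "y = left_coset \<Gamma> x" using y[of 0] by (auto simp: Y_def space_mY)
      have "w x \<le> c ^ n * s" for n using y[of n] x by (simp add: Y)
      moreover have "(\<lambda>n. c ^ n * s) \<longlonglongrightarrow> 0"
        using c by (intro tendsto_mult_left_zero LIMSEQ_realpow_zero) auto
      ultimately have "w x \<le> 0" by (intro LIMSEQ_le_const) auto
      then show False using pos[of x] by simp
    qed
    moreover have "(\<lambda>n. emeasure mY (Y (c ^ n * s))) \<longlonglongrightarrow> emeasure mY (\<Inter>n. Y (c ^ n * s))"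
      by (rule Lim_emeasure_decseq[OF _ dec]) auto
    ultimately show ?thesis unfolding iter by (simp add: LIMSEQ_const_iff)
  qed
  then have "(\<Union>n. Y (real (Suc n))) \<in> null_sets mY"
    by (intro null_sets_UN null_setsI) auto
  moreover have "(\<Union>n. Y (real (Suc n))) = space mY"
  proof -
    have "\<exists>n. w x < real (Suc n)" for x using reals_Archimedean2[of "w x"]
      by (metis less_Suc_eq of_nat_less_iff order.strict_trans)
    then show ?thesis by (auto simp: space_mY Y) (auto simp: Y_def space_mY)
  qed
  ultimately show False using emeasure_space_1 by (simp add: null_setsD1)
qed

text \<open>The mass of the right translates of one set \<open>B\<close>, viewed as a function
  \<open>w\<close> of the translating element, is invariant under the lattice, and left translation
  by \<open>g\<close> multiplies it by the modular factor \<open>c\<close> of \<open>g\<close>. So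
  \<open>c < 1\<close> would give a contraction by \<open>g\<close>, and \<open>c > 1\<close> one by
  \<open>- g\<close>.\<close>

lemma intensity_right_invariant:
  assumes A: "A \<in> sets borel"
  shows "emeasure intensity ((\<lambda>z. z + g) -` A) = emeasure intensity A"
proof -
  obtain B :: "'a set" and K where B: "open B" "0 \<in> B" "compact K" "B \<subseteq> K"
    by (rule relcompact_open_exists)
  have bB: "B \<in> sets borel" using B by auto
  obtain c where c: "0 < c" "c < \<infinity>" "\<And>A. A \<in> sets borel \<Longrightarrow> emeasure intensity ((\<lambda>y. y + g) -` A)
    = c * emeasure intensity A"
    using haar_right_translate[OF haar_intensity, of g] by metis
  define w where "w x = enn2real (emeasure intensity ((\<lambda>y. y + x) -` B))" for x
  have meas: "w \<in> borel_measurable borel"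
    unfolding w_def using measurable_emeasure_vimage_right[OF left_invariant_intensity bB] by simp
  note wB = haar_open_vimage_right[OF haar_intensity B]
  have pos: "0 < w x" for x
    unfolding w_def using wB[of x] by (simp add: enn2real_positive_iff)
  have vB: "(\<lambda>y. y + x) -` B \<in> sets borel" for x
    using measurable_sets[OF measurable_plus_right bB, of x] by simp
  have \<Gamma>: "w (x + \<gamma>) = w x" if "\<gamma> \<in> \<Gamma>" for x \<gamma>
  proof -
    have "emeasure intensity ((\<lambda>y. y + (x + \<gamma>)) -` B) = emeasure intensity ((\<lambda>y. y + x) -` ((\<lambda>y. y
      + \<gamma>) -` B))"
      by (simp add: vimage_def add.assoc)
    also have "\<dots> = emeasure intensity ((\<lambda>y. y + x) -` B)"
    proof -
      \<comment> \<open>The modular factor of \<open>x\<close> reduces invariance of the translated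
        set to that of \<open>B\<close> itself.\<close>
      obtain e where e: "\<And>A. A \<in> sets borel \<Longrightarrow> emeasure intensity ((\<lambda>y. y + x) -` A)
        = e * emeasure intensity A"
        using haar_right_translate[OF haar_intensity, of x] by metis
      show ?thesis using vB bB that by (simp add: e intensity_right_lattice)
    qed
    finally show ?thesis by (simp add: w_def)
  qed
  have g: "w (g + x) = enn2real c * w x" for x
  proof -
    have "emeasure intensity ((\<lambda>y. y + (g + x)) -` B) = emeasure intensity ((\<lambda>y. y + g) -` ((\<lambda>y. y
      + x) -` B))"
      by (simp add: vimage_def add.assoc)
    then show ?thesis using vB by (simp add: w_def c enn2real_mult)
  qed
  have c': "0 < enn2real c" using c by (simp add: enn2real_positive_iff)
  have "\<not> enn2real c < 1" using no_contraction[OF meas pos \<Gamma> g c'] by blast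
  moreover have "\<not> enn2real c > 1"
  proof
    assume 1: "enn2real c > 1"
    have "w (- g + x) = inverse (enn2real c) * w x" for x
      using g[of "- g + x"] c' by (simp add: add.assoc[symmetric] field_simps)
    from no_contraction[OF meas pos \<Gamma> this] show False using 1 by (simp add: inverse_less_1_iff)
  qed
  ultimately have "enn2real c = 1" by simp
  then have "c = 1" using c by (metis ennreal_1 ennreal_enn2real infinity_ennreal_def)
  then show ?thesis using c(3)[OF A] by simp
qed

text \<open>A coset outside \<open>N\<close> has no point in the preimage of \<open>N\<close>, so
  the expected count there vanishes.\<close>

lemma null_lift:
  assumes "N \<in> null_sets mY"
  shows "left_coset \<Gamma> -` N \<in> null_sets intensity"
proof -
  have N: "N \<in> sets mY" "emeasure mY N = 0" using assms by auto
  have m: "left_coset \<Gamma> -` N \<in> sets borel" using measurable_sets[OF measurable_left_coset N(1)]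
    by simp
  have *: "cnt (left_coset \<Gamma> -` N) y = 0" if y: "y \<in> space mY" "y \<notin> N" for y
  proof -
    obtain x where x: "y = left_coset \<Gamma> x" using y by (auto simp: space_mY)
    have "y \<inter> left_coset \<Gamma> -` N = {}"
      using coset_eq[of _ x] y by (auto simp: x)
    then show ?thesis by (simp add: cnt_def)
  qed
  have "AE y in mY. cnt (left_coset \<Gamma> -` N) y = 0"
    using AE_not_in[OF assms] AE_space by eventually_elim (rule *)
  then have "(\<integral>\<^sup>+y. cnt (left_coset \<Gamma> -` N) y \<partial>mY) = 0"
    using m by (subst nn_integral_0_iff_AE) auto
  then show ?thesis using m by (intro null_setsI) (auto simp: emeasure_intensity)
qed

text \<open>Haar measure charges every nonempty open set, so a property of almost every coset holds
  for a coset with a representative in any prescribed open set. This is the bridge from the ergodic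
  theorem to an arbitrary coset.\<close>

lemma AE_coset_dense:
  assumes "AE y in mY. Q y" and U: "open U" "U \<noteq> {}"
  obtains z where "z \<in> U" "Q (left_coset \<Gamma> z)"
proof -
  obtain N where N: "N \<in> null_sets mY" "{y \<in> space mY. \<not> Q y} \<subseteq> N"
    using assms(1) by (auto simp: eventually_ae_filter)
  have "emeasure intensity U > 0" using haar_open_pos[OF haar_intensity U] .
  then have "\<not> U \<subseteq> left_coset \<Gamma> -` N"
    using null_lift[OF N(1)] U
      by (metis borel_open null_sets_subset null_setsD1 sets_intensity less_irrefl)
  then obtain z where "z \<in> U" "left_coset \<Gamma> z \<notin> N" by auto
  then show ?thesis using N(2) that[of z] by (auto simp: space_mY)
qed

end

subsection \<open>Counting lattice points in boxes\<close>

text \<open>Removing from a relatively compact open neighbourhood the compact sets that exhaust the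
  complement of \<open>W\<close> leaves open sets decreasing to \<open>W\<close>; finite mass makes
  the measures converge.\<close>

lemma compact_outer_regular:
  fixes m :: "'a::lcsc_group_add measure"
  assumes m: "left_invariant m" and W: "compact W" and less: "measure m W < a"
  obtains V K where "open V" "compact K" "W \<subseteq> V" "V \<subseteq> K" "measure m V < a"
proof -
  note D = left_invariantD[OF m]
  obtain V0 K0 where V0: "open V0" "compact K0" "W \<subseteq> V0" "V0 \<subseteq> K0"
    using compact_subset_open_relcompact[OF W open_UNIV subset_UNIV] by metis
  have "open (- W)" using W by (simp add: compact_imp_closed open_Compl)
  then obtain C :: "nat \<Rightarrow> 'a set" where C: "\<And>n. compact (C n)" "incseq C" "(\<Union>n. C n) = - W"
    by (rule open_eq_incseq_compact) blast
  define V where "V n = V0 - C n" for n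
  have oV: "open (V n)" for n unfolding V_def by (intro open_Diff V0(1) compact_imp_closed C(1))
  have fin0: "emeasure m V0 < \<infinity>"
  proof -
    have "emeasure m V0 \<le> emeasure m K0" using V0 D
      by (intro emeasure_mono) (auto intro: borel_compact)
    then show ?thesis using D(4)[OF V0(2)] by simp
  qed
  have "(\<lambda>n. measure m (V n)) \<longlonglongrightarrow> measure m (\<Inter>n. V n)"
  proof (rule Lim_measure_decseq)
    show "range V \<subseteq> sets m" using oV D by auto
    show "decseq V" using C(2) by (auto simp: V_def decseq_def incseq_def)
    show "emeasure m (V n) \<noteq> \<infinity>" for n
    proof -
      have "emeasure m (V n) \<le> emeasure m V0"
        using V0 D by (intro emeasure_mono) (auto simp: V_def)
      then show ?thesis using fin0 by auto
    qed
  qed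
  moreover have "(\<Inter>n. V n) = W"
  proof -
    have "(\<Inter>n. V n) = V0 - (\<Union>n. C n)" by (auto simp: V_def)
    then show ?thesis using C(3) V0 by auto
  qed
  ultimately have "eventually (\<lambda>n. measure m (V n) < a) sequentially"
    using less by (auto intro: order_tendstoD)
  then obtain n where n: "measure m (V n) < a" by (auto simp: eventually_sequentially)
  have "W \<inter> C n = {}" using C(3) by auto
  then have "W \<subseteq> V n" using V0 by (auto simp: V_def)
  moreover have "V n \<subseteq> K0" using V0 by (auto simp: V_def)
  ultimately show ?thesis using that[OF oV V0(2)] n by blast
qed

lemma open_inner_regular:
  fixes m :: "'a::lcsc_group_add measure"
  assumes m: "left_invariant m" and V: "open V" "V \<subseteq> L" "compact L" and less: "a < measure m V"
  obtains K where "compact K" "K \<subseteq> V" "a < measure m K"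
proof -
  note D = left_invariantD[OF m]
  obtain C :: "nat \<Rightarrow> 'a set" where C: "\<And>n. compact (C n)" "incseq C" "(\<Union>n. C n) = V"
    using V(1) by (rule open_eq_incseq_compact) blast
  have "emeasure m V \<le> emeasure m L" using V D by (intro emeasure_mono) (auto intro: borel_compact)
  then have fin: "emeasure m V \<noteq> \<infinity>" using D(4)[OF V(3)] by auto
  have "(\<lambda>n. measure m (C n)) \<longlonglongrightarrow> measure m (\<Union>n. C n)"
    using C D fin by (intro Lim_measure_incseq) (auto intro: borel_compact)
  then have "eventually (\<lambda>n. a < measure m (C n)) sequentially"
    using less by (auto intro: order_tendstoD simp: C(3))
  then obtain n where "a < measure m (C n)" by (auto simp: eventually_sequentially)
  then show ?thesis using that[OF C(1)[of n]] C(3) by auto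
qed

section \<open>Product Haar measure and the density of the lattice\<close>

lemma left_invariant_pair:
  fixes m :: "'a::lcsc_group_add measure" and n :: "'b::lcsc_group_add measure"
  assumes m: "left_invariant m" and n: "left_invariant n"
  shows "left_invariant (m \<Otimes>\<^sub>M n)"
proof -
  note Dm = left_invariantD[OF m] and Dn = left_invariantD[OF n]
  interpret m: sigma_finite_measure m by (rule Dm(3))
  interpret n: sigma_finite_measure n by (rule Dn(3))
  have sets: "sets (m \<Otimes>\<^sub>M n) = sets borel"
    using sets_pair_measure_cong[OF Dm(1) Dn(1)] unfolding borel_prod .
  show ?thesis
    unfolding left_invariant_def radon_measure_def
  proof (intro conjI allI impI ballI)
    fix K :: "('a \<times> 'b) set" assume K: "compact K"
    have c: "compact (fst ` K)" "compact (snd ` K)"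
      using K by (intro compact_continuous_image continuous_on_fst continuous_on_snd
        continuous_on_id; assumption)+
    have "emeasure (m \<Otimes>\<^sub>M n) K \<le> emeasure (m \<Otimes>\<^sub>M n) (fst ` K \<times> snd ` K)"
      using c by (intro emeasure_mono subset_fst_snd pair_measureI) (simp_all add: Dm Dn
        borel_compact)
    also have "\<dots> = emeasure m (fst ` K) * emeasure n (snd ` K)"
      using c by (intro n.emeasure_pair_measure_Times) (simp_all add: Dm Dn borel_compact)
    also have "\<dots> < \<infinity>" using Dm(4)[OF c(1)] Dn(4)[OF c(2)] by (simp add: ennreal_mult_less_top)
    finally show "emeasure (m \<Otimes>\<^sub>M n) K < \<infinity>" .
  next
    fix g :: "'a \<times> 'b" and A :: "('a \<times> 'b) set" assume A: "A \<in> sets borel"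
    obtain a b where g: "g = (a, b)" by (cases g)
    have tA: "translate g A \<in> sets (m \<Otimes>\<^sub>M n)" and A': "A \<in> sets (m \<Otimes>\<^sub>M n)"
      using A borel_translate[OF A] by (simp_all only: sets)
    have [measurable]: "A \<in> sets (borel \<Otimes>\<^sub>M borel)" using A unfolding borel_prod .
    note [measurable_cong] = Dm(1) Dn(1)
    have "emeasure (m \<Otimes>\<^sub>M n) (translate g A) = (\<integral>\<^sup>+x. \<integral>\<^sup>+y. indicator (translate g A) (x, y) \<partial>n \<partial>m)"
      using tA by (rule n.emeasure_pair_measure)
    also have "\<dots> = (\<integral>\<^sup>+x. \<integral>\<^sup>+y. indicator A (- a + x, - b + y) \<partial>n \<partial>m)"
      by (simp add: g indicator_def mem_translate uminus_prod_def plus_prod_def)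
    also have "\<dots> = (\<integral>\<^sup>+x. \<integral>\<^sup>+y. indicator A (- a + x, y) \<partial>n \<partial>m)"
      by (intro nn_integral_cong left_invariant_nn_integral[OF n, of
        "\<lambda>y. indicator A (_, y)"]) measurable
    also have "\<dots> = (\<integral>\<^sup>+x. \<integral>\<^sup>+y. indicator A (x, y) \<partial>n \<partial>m)"
      by (intro left_invariant_nn_integral[OF m, of "\<lambda>x. \<integral>\<^sup>+y. indicator A (x, y) \<partial>n"]) measurable
    also have "\<dots> = emeasure (m \<Otimes>\<^sub>M n) A"
      using A' by (rule n.emeasure_pair_measure[symmetric])
    finally show "emeasure (m \<Otimes>\<^sub>M n) (translate g A) = emeasure (m \<Otimes>\<^sub>M n) A" .
  qed (rule sets)
qed

lemma haar_pair:
  fixes m :: "'a::lcsc_group_add measure" and n :: "'b::lcsc_group_add measure"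
  assumes m: "haar_measure m" and n: "haar_measure n"
  shows "haar_measure (m \<Otimes>\<^sub>M n)"
proof -
  note Dm = left_invariantD[OF haar_measureD[OF m]] and Dn = left_invariantD[OF haar_measureD[OF n]]
  interpret n: sigma_finite_measure n by (rule Dn(3))
  have "emeasure (m \<Otimes>\<^sub>M n) (UNIV \<times> UNIV) = emeasure m UNIV * emeasure n UNIV"
    using Dm Dn by (intro n.emeasure_pair_measure_Times) auto
  then show ?thesis
    using m n left_invariant_pair[OF haar_measureD[OF m] haar_measureD[OF n]]
    by (auto simp: haar_measure_iff)
qed

locale cut_project = lattice_quotient \<Gamma> mY
  for \<Gamma> :: "('g::lcsc_group_add \<times> 'h::lcsc_group_add) set" and mY +
  fixes mG :: "'g measure" and mH :: "'h measure"
  assumes haar_G: "haar_measure mG" and haar_H: "haar_measure mH"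
begin

lemmas invG = haar_measureD[OF haar_G]
lemmas invH = haar_measureD[OF haar_H]
lemmas DG = left_invariantD[OF invG]
lemmas DH = left_invariantD[OF invH]

text \<open>The mean count and the product of the Haar measures are both left invariant on the
  product group, so uniqueness leaves a single factor, nonzero because the intensity is itself a
  Haar measure.\<close>

lemma intensity_product:
  "\<exists>c>0. \<forall>A\<in>sets borel. \<forall>B\<in>sets borel. emeasure intensity (A \<times> B)
    = ennreal c * emeasure mG A * emeasure mH B"
proof -
  interpret H: sigma_finite_measure mH by (rule DH(3))
  obtain c where c: "c < \<infinity>" "\<And>A. A \<in> sets borel \<Longrightarrow> emeasure intensity A = c * emeasure (mG \<Otimes>\<^sub>M mH) A"
    using left_invariant_unique[OF haar_pair[OF haar_G haar_H] left_invariant_intensity] by metis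
  have "emeasure intensity UNIV \<noteq> 0" using haar_intensity by (simp add: haar_measure_iff)
  then have "c \<noteq> 0" using c(2)[of UNIV] by auto
  then have "enn2real c > 0" "c = ennreal (enn2real c)"
    using c(1) by (auto simp: enn2real_positive_iff zero_less_iff_neq_zero)
  moreover have "emeasure intensity (A \<times> B) = c * emeasure mG A * emeasure mH B"
    if A: "A \<in> sets borel" and B: "B \<in> sets borel" for A B
  proof -
    have "A \<times> B \<in> sets (borel \<Otimes>\<^sub>M borel)" using A B by (rule pair_measureI)
    then have "emeasure intensity (A \<times> B) = c * emeasure (mG \<Otimes>\<^sub>M mH) (A \<times> B)"
      unfolding borel_prod by (rule c(2))
    also have "emeasure (mG \<Otimes>\<^sub>M mH) (A \<times> B) = emeasure mG A * emeasure mH B"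
      using A B DG DH by (intro H.emeasure_pair_measure_Times) auto
    finally show ?thesis by (simp add: mult.assoc)
  qed
  ultimately show ?thesis by metis
qed

text \<open>The reciprocal of the covolume of \<open>\<Gamma>\<close> with respect to the product of
  the two Haar measures.\<close>

definition dens :: real where
  "dens = (SOME c. c > 0 \<and> (\<forall>A\<in>sets borel. \<forall>B\<in>sets borel. emeasure intensity (A \<times> B)
    = ennreal c * emeasure mG A * emeasure mH B))"

lemma dens_props:
  "dens > 0 \<and> (\<forall>A\<in>sets borel. \<forall>B\<in>sets borel. emeasure intensity (A \<times> B)
    = ennreal dens * emeasure mG A * emeasure mH B)"
  unfolding dens_def by (rule someI_ex) (use intensity_product in auto)

lemma dens_pos: "dens > 0" using dens_props by simp

lemma emeasure_intensity_Times:
  "A \<in> sets borel \<Longrightarrow> B \<in> sets borel \<Longrightarrow> emeasure intensity (A \<times> B)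
    = ennreal dens * emeasure mG A * emeasure mH B"
  using dens_props by simp

text \<open>Right invariance of the intensity, tested on a box: translating by \<open>(g, 0)\<close>
  affects only the first side, and the mass of the second side is positive and finite, hence
  cancels.\<close>

lemma mG_right_invariant:
  assumes A: "A \<in> sets borel"
  shows "emeasure mG ((\<lambda>z. z + g) -` A) = emeasure mG A"
proof -
  obtain B :: "'h set" and K where B: "open B" "0 \<in> B" "compact K" "B \<subseteq> K"
    by (rule relcompact_open_exists)
  have bB: "B \<in> sets borel" using B by auto
  have vA: "(\<lambda>z. z + g) -` A \<in> sets borel"
    using measurable_sets[OF measurable_plus_right A, of g] by simp
  have AB: "A \<times> B \<in> sets borel"
    using pair_measureI[OF A bB] by (simp only: borel_prod)
  have "(\<lambda>z. z + (g, 0)) -` (A \<times> B) = ((\<lambda>z. z + g) -` A) \<times> B" by (auto simp: plus_prod_def)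
  then have "ennreal dens * emeasure mG ((\<lambda>z. z + g) -` A) * emeasure mH B
    = ennreal dens * emeasure mG A * emeasure mH B"
    using intensity_right_invariant[OF AB, of "(g, 0)"] A bB vA
      by (simp add: emeasure_intensity_Times)
  moreover have "emeasure mH B > 0" using haar_open_pos[OF haar_H] B by auto
  moreover have "emeasure mH B < \<infinity>"
  proof -
    have "emeasure mH B \<le> emeasure mH K" using B DH
      by (intro emeasure_mono) (auto intro: borel_compact)
    then show ?thesis using DH(4)[OF B(3)] by simp
  qed
  ultimately show ?thesis using dens_pos
    by (auto simp: mult.commute[of _ "emeasure mH B"] ennreal_mult_cancel_left)
qed

text \<open>In the swap formula with both measures equal, right invariance makes the weight
  constant, and it cancels.\<close>

lemma mG_uminus:
  assumes A: "A \<in> sets borel"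
  shows "emeasure mG (uminus -` A) = emeasure mG A"
proof -
  obtain B :: "'g set" and K where B: "open B" "0 \<in> B" "compact K" "B \<subseteq> K"
    by (rule relcompact_open_exists)
  have bB: "B \<in> sets borel" using B by auto
  have "emeasure mG B * emeasure mG (uminus -` A) = (\<integral>\<^sup>+x. indicator A x * emeasure mG B \<partial>mG)"
    using left_invariant_swap[OF invG invG A bB] by (simp add: mG_right_invariant[OF bB])
  also have "\<dots> = emeasure mG B * emeasure mG A"
    using A DG by (subst nn_integral_multc) (auto simp: mult.commute)
  finally have "emeasure mG B * emeasure mG (uminus -` A) = emeasure mG B * emeasure mG A" .
  moreover have "emeasure mG B > 0" using haar_open_pos[OF haar_G] B by auto
  moreover have "emeasure mG B < \<infinity>"
  proof -
    have "emeasure mG B \<le> emeasure mG K" using B DG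
      by (intro emeasure_mono) (auto intro: borel_compact)
    then show ?thesis using DG(4)[OF B(3)] by simp
  qed
  ultimately show ?thesis by (auto simp: ennreal_mult_cancel_left)
qed

lemma finite_coset_Times:
  assumes "y \<in> space mY" "compact K" "A \<subseteq> K" "compact L" "B \<subseteq> L"
  shows "finite (y \<inter> (A \<times> B))"
proof -
  obtain x where "y = left_coset \<Gamma> x" using assms(1) by (auto simp: space_mY)
  then have "finite (y \<inter> (K \<times> L))" using finite_coset_compact[OF compact_Times] assms by simp
  then show ?thesis by (rule rev_finite_subset) (use assms in auto)
qed

lemma cnt_finite: "finite (y \<inter> A) \<Longrightarrow> cnt A y = of_nat (card (y \<inter> A))"
  by (simp add: cnt_def emeasure_count_space)

lemma cnt_shift: "cnt (U \<times> B) (translate (- g, 0) y) = cnt (translate g U \<times> B) y"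
proof -
  have "U \<times> B = translate (- g, 0) (translate g U \<times> B)"
    by (auto simp: set_eq_iff mem_translate uminus_prod_def plus_prod_def)
  then show ?thesis using cnt_translate[of "(- g, 0)" "translate g U \<times> B" y] by simp
qed

lemma cnt_shift_measurable [measurable]:
  assumes "y \<in> space mY" and U: "open U" and B: "B \<in> sets borel"
  shows "(\<lambda>g. cnt (U \<times> B) (translate (- g, 0) y)) \<in> borel_measurable mG"
proof -
  obtain x where x: "y = left_coset \<Gamma> x" using assms(1) by (auto simp: space_mY)
  have "(\<lambda>g. (- g, 0) + x) \<in> borel_measurable borel"
    by (intro borel_measurable_continuous_onI continuous_intros)
  then have "(\<lambda>g. left_coset \<Gamma> ((- g, 0) + x)) \<in> borel \<rightarrow>\<^sub>M mY"
    by (rule measurable_compose) (rule measurable_left_coset)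
  moreover have "U \<times> B \<in> sets borel"
    using pair_measureI[of U borel B borel] U B by (simp only: borel_prod) auto
  ultimately have "(\<lambda>g. cnt (U \<times> B) (left_coset \<Gamma> ((- g, 0) + x))) \<in> borel_measurable borel"
    by (intro measurable_compose[OF _ cnt_measurable])
  then show ?thesis
    unfolding x translate_coset by (subst measurable_cong_sets[OF DG(1) refl])
qed

lemma sum_shift_indicator:
  assumes "finite (T :: ('g \<times> 'h) set)"
  shows "(\<Sum>p\<in>T. indicator U (- g + fst p) :: ennreal) = of_nat (card (T \<inter> (translate g U \<times> UNIV)))"
proof -
  have "(\<Sum>p\<in>T. indicator U (- g + fst p) :: ennreal) = (\<Sum>p\<in>T. indicator (translate g U \<times> UNIV) p)"
    by (intro sum.cong) (auto simp: indicator_def mem_translate mem_Times_iff)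
  also have "\<dots> = of_nat (card (T \<inter> (translate g U \<times> UNIV)))"
    using assms by (simp add: indicator_def sum.If_cases Int_def)
  finally show ?thesis .
qed

text \<open>Symmetry of \<open>U\<close> replaces \<open>- g + a\<close> by its inverse
  \<open>- a + g\<close>, after which left invariance alone is enough.\<close>

lemma nn_integral_symmetric_indicator:
  assumes U: "open U" "\<And>u. u \<in> U \<Longrightarrow> - u \<in> U"
  shows "(\<integral>\<^sup>+g. indicator U (- g + a) \<partial>mG) = emeasure mG U"
proof -
  have sym: "- u \<in> U \<longleftrightarrow> u \<in> U" for u using U(2)[of u] U(2)[of "- u"] by auto
  have "- (- g + a) \<in> U \<longleftrightarrow> - a + g \<in> U" for g by (simp add: minus_add)
  then have "indicator U (- g + a) = (indicator U (- a + g) :: ennreal)" for g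
    using sym[of "- g + a"] by (auto simp: indicator_def)
  then have "(\<integral>\<^sup>+g. indicator U (- g + a) \<partial>mG) = (\<integral>\<^sup>+g. indicator U (- a + g) \<partial>mG)" by simp
  also have "\<dots> = (\<integral>\<^sup>+g. indicator U g \<partial>mG)"
    using U by (intro left_invariant_nn_integral[OF invG]) auto
  also have "\<dots> = emeasure mG U" using U DG by simp
  finally show ?thesis .
qed

lemma measurable_shift_indicator [measurable]:
  "open U \<Longrightarrow> (\<lambda>g. indicator U (- g + a) :: ennreal) \<in> borel_measurable mG"
proof -
  assume U: "open U"
  have "(\<lambda>g. - g + a) -` U \<in> sets mG"
    using U by (auto simp: DG intro!: borel_open open_vimage continuous_intros)
  moreover have "(\<lambda>g. indicator U (- g + a) :: ennreal) = indicator ((\<lambda>g. - g + a) -` U)"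
    by (auto simp: indicator_def)
  ultimately show ?thesis by simp
qed

text \<open>Each counted point is spread over a neighbourhood: a point \<open>p\<close> contributes
  exactly the mass of \<open>U\<close> to the integral, through those \<open>g\<close> with
  \<open>- g + fst p\<close> in \<open>U\<close>, and these all lie in \<open>A'\<close>. The
  ergodic theorem controls such integrals of local counts, not the counts in large boxes
  themselves.\<close>

lemma count_upper:
  assumes y: "y \<in> space mY" and U: "open U" "\<And>u. u \<in> U \<Longrightarrow> - u \<in> U"
    and A: "compact A" and A': "A' \<in> sets borel" and B: "B \<in> sets borel" "B \<subseteq> L" "compact L"
    and sub: "\<And>a u. a \<in> A \<Longrightarrow> u \<in> U \<Longrightarrow> a + u \<in> A'"
  shows "cnt (A \<times> B) y * emeasure mG U
    \<le> (\<integral>\<^sup>+g. cnt (U \<times> B) (translate (- g, 0) y) * indicator A' g \<partial>mG)"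
proof -
  define T where "T = y \<inter> (A \<times> B)"
  have fin: "finite T" unfolding T_def by (rule finite_coset_Times[OF y A _ B(3,2)]) simp
  have 1: "indicator U (- g + fst p) \<le> (indicator U (- g + fst p) * indicator A' g :: ennreal)" if
    "p \<in> T" for p g
  proof -
    have "g \<in> A'" if "- g + fst p \<in> U"
    proof -
      have "- (- g + fst p) \<in> U" using U(2) that by blast
      then have "fst p + (- (- g + fst p)) \<in> A'" using \<open>p \<in> T\<close> by (intro sub) (auto simp: T_def)
      then show ?thesis by (simp add: minus_add add.assoc[symmetric])
    qed
    then show ?thesis by (auto simp: indicator_def)
  qed
  have "cnt (A \<times> B) y * emeasure mG U = (\<Sum>p\<in>T. emeasure mG U)"
    using fin by (simp add: cnt_finite T_def)
  also have "\<dots> = (\<Sum>p\<in>T. \<integral>\<^sup>+g. indicator U (- g + fst p) \<partial>mG)"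
    using nn_integral_symmetric_indicator[OF U] by simp
  also have "\<dots> \<le> (\<Sum>p\<in>T. \<integral>\<^sup>+g. indicator U (- g + fst p) * indicator A' g \<partial>mG)"
    using 1 by (intro sum_mono nn_integral_mono)
  also have "\<dots> = (\<integral>\<^sup>+g. (\<Sum>p\<in>T. indicator U (- g + fst p) * indicator A' g) \<partial>mG)"
    using A' U by (intro nn_integral_sum[symmetric] borel_measurable_times_ennreal
      measurable_shift_indicator
        borel_measurable_indicator) (simp_all add: DG)
  also have "\<dots> \<le> (\<integral>\<^sup>+g. cnt (U \<times> B) (translate (- g, 0) y) * indicator A' g \<partial>mG)"
  proof (rule nn_integral_mono)
    fix g
    have "(\<Sum>p\<in>T. indicator U (- g + fst p) :: ennreal)
      = emeasure (count_space UNIV) (T \<inter> (translate g U \<times> UNIV))"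
      using fin by (subst sum_shift_indicator) (simp_all add: emeasure_count_space)
    also have "\<dots> \<le> emeasure (count_space UNIV) (y \<inter> (translate g U \<times> B))"
      by (rule emeasure_mono) (auto simp: T_def)
    finally have "(\<Sum>p\<in>T. indicator U (- g + fst p) :: ennreal) \<le> cnt (U \<times> B) (translate (- g, 0) y)"
      unfolding cnt_shift by (simp add: cnt_def)
    then show "(\<Sum>p\<in>T. indicator U (- g + fst p) * indicator A' g)
      \<le> cnt (U \<times> B) (translate (- g, 0) y) * indicator A' g"
      unfolding sum_distrib_right[symmetric] by (rule mult_right_mono) simp
  qed
  finally show ?thesis .
qed

text \<open>The reverse comparison: for \<open>g\<close> in \<open>A\<close> every point seen in
  \<open>translate g U\<close> lies over \<open>A'\<close>, so the integral spreads only points that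
  are counted on the right.\<close>

lemma count_lower:
  assumes y: "y \<in> space mY" and U: "open U" "\<And>u. u \<in> U \<Longrightarrow> - u \<in> U"
    and A': "compact A'" and B: "B \<subseteq> L" "compact L"
    and sub: "\<And>a u. a \<in> A \<Longrightarrow> u \<in> U \<Longrightarrow> a + u \<in> A'"
  shows "(\<integral>\<^sup>+g. cnt (U \<times> B) (translate (- g, 0) y) * indicator A g \<partial>mG)
    \<le> cnt (A' \<times> B) y * emeasure mG U"
proof -
  define T where "T = y \<inter> (A' \<times> B)"
  have fin: "finite T" unfolding T_def by (rule finite_coset_Times[OF y A' _ B(2,1)]) simp
  have "(\<integral>\<^sup>+g. cnt (U \<times> B) (translate (- g, 0) y) * indicator A g \<partial>mG)
      \<le> (\<integral>\<^sup>+g. (\<Sum>p\<in>T. indicator U (- g + fst p)) \<partial>mG)"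
  proof (rule nn_integral_mono)
    fix g
    have "cnt (U \<times> B) (translate (- g, 0) y) \<le> (\<Sum>p\<in>T. indicator U (- g + fst p))" if g: "g \<in> A"
    proof -
      have "translate g U \<subseteq> A'"
      proof
        fix z assume "z \<in> translate g U"
        then have "g + (- g + z) \<in> A'" using g by (intro sub) (auto simp: mem_translate)
        then show "z \<in> A'" by (simp add: add.assoc[symmetric])
      qed
      then have "emeasure (count_space UNIV) (y \<inter> (translate g U \<times> B))
        \<le> emeasure (count_space UNIV) (T \<inter> (translate g U \<times> UNIV))"
        by (intro emeasure_mono) (auto simp: T_def)
      then show ?thesis
        unfolding cnt_shift sum_shift_indicator[OF fin] using fin
          by (simp add: cnt_def emeasure_count_space)
    qed
    then show "cnt (U \<times> B) (translate (- g, 0) y) * indicator A g \<le> (\<Sum>p\<in>T. indicator U (- g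
      + fst p))"
      by (auto simp: indicator_def)
  qed
  also have "\<dots> = (\<Sum>p\<in>T. \<integral>\<^sup>+g. indicator U (- g + fst p) \<partial>mG)"
    using U by (intro nn_integral_sum measurable_shift_indicator)
  also have "\<dots> = (\<Sum>p\<in>T. emeasure mG U)"
    using nn_integral_symmetric_indicator[OF U] by simp
  also have "\<dots> = cnt (A' \<times> B) y * emeasure mG U"
    using fin by (simp add: cnt_finite T_def)
  finally show ?thesis .
qed

end

context cut_project
begin

lemma cnt_box_bound:
  assumes "compact K" "U \<subseteq> K" "compact L" "B \<subseteq> L"
  obtains n :: nat where "\<forall>y\<in>space mY. cnt (U \<times> B) y \<le> of_nat n"
proof -
  obtain n where n: "\<And>x. finite (left_coset \<Gamma> x \<inter> (K \<times> L))" "\<And>x. card (left_coset \<Gamma> x \<inter> (K \<times> L))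
    \<le> n"
    using card_coset_bound[OF compact_Times[OF assms(1,3)]] by metis
  have "cnt (U \<times> B) y \<le> of_nat n" if y: "y \<in> space mY" for y
  proof -
    obtain x where x: "y = left_coset \<Gamma> x" using y by (auto simp: space_mY)
    have "cnt (U \<times> B) y \<le> cnt (K \<times> L) y"
      unfolding cnt_def using assms by (intro emeasure_mono) auto
    also have "\<dots> = of_nat (card (y \<inter> (K \<times> L)))" using n x by (intro cnt_finite) simp
    also have "\<dots> \<le> of_nat n" using n x by simp
    finally show ?thesis .
  qed
  then show ?thesis using that by blast
qed

lemma Times_borel: "A \<in> sets borel \<Longrightarrow> B \<in> sets borel \<Longrightarrow> A \<times> B \<in> sets (borel :: ('g \<times> 'h) measure)"
  using pair_measureI[of A borel B borel] unfolding borel_prod .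

end

section \<open>Counting along a weakly admissible symmetric family\<close>

locale sampling = cut_project \<Gamma> mY mG mH
  for \<Gamma> :: "('g::lcsc_group_add \<times> 'h::lcsc_group_add) set" and mY mG mH +
  fixes d :: "'g \<Rightarrow> 'g \<Rightarrow> real" and F :: "real \<Rightarrow> 'g set"
  assumes adm: "admissible_metric d" and weak: "weakly_admissible d mG F"
    and sym: "\<And>t. t > 0 \<Longrightarrow> uminus ` F t = F t" and good: "ae_good mG F mY"
begin

sublocale metric: Metric_space UNIV d
  using adm by (simp add: admissible_metric_def)

lemma d_left: "d (g + x) (g + y) = d x y"
  using adm by (simp add: admissible_metric_def)

lemma open_ball: "open {u. d x u < r}"
proof -
  have "openin metric.mtopology (metric.mball x r)" by (rule metric.openin_mball)
  moreover have "metric.mball x r = {u. d x u < r}" by (auto simp: metric.in_mball)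
  ultimately show ?thesis using adm by (simp add: admissible_metric_def)
qed

lemma compact_cball: "compact {u. d x u \<le> r}"
proof -
  have "compact (metric.mcball x r)" using adm by (simp add: admissible_metric_def)
  moreover have "metric.mcball x r = {u. d x u \<le> r}" by (auto simp: metric.in_mcball)
  ultimately show ?thesis by simp
qed

lemma ball_uminus: "d 0 u < r \<Longrightarrow> d 0 (- u) < r"
  using d_left[of u 0 "- u"] metric.commute[of u 0] by simp

lemma F_compact: "t > 0 \<Longrightarrow> compact (F t)" and F_pos: "t > 0 \<Longrightarrow> emeasure mG (F t) > 0"
  using weak by (simp_all add: weakly_admissible_def)

lemma F_finite: "t > 0 \<Longrightarrow> emeasure mG (F t) < \<infinity>"
  using F_compact DG(4) by simp

lemma F_sets: "t > 0 \<Longrightarrow> F t \<in> sets mG"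
  using F_compact DG(1) by (simp add: borel_compact)

lemma emeasure_F: "t > 0 \<Longrightarrow> emeasure mG (F t) = ennreal (measure mG (F t))"
  using F_finite[of t] by (intro emeasure_eq_ennreal_measure) simp

lemma F_measure_pos: "t > 0 \<Longrightarrow> measure mG (F t) > 0"
  using F_pos[of t] emeasure_F[of t] by simp

lemma F_uminus: "t > 0 \<Longrightarrow> - x \<in> F t \<longleftrightarrow> x \<in> F t"
  using sym[of t] by (metis image_eqI minus_minus imageE)

text \<open>Thickening is stated for radii, growth of the measure for increments of the parameter,
  and \<open>\<alpha>\<close> converts the one into the other. A radius whose increment falls where
  \<open>\<beta>\<close> is below \<open>\<epsilon>\<close> serves both. Thickening on the left
  follows because inversion exchanges the sides and preserves each \<open>F t\<close>.\<close>

lemma admissible_step: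
  assumes "\<epsilon> > 0"
  obtains \<delta> a where "\<delta> > 0" "a \<ge> 0"
    "\<And>t x u. t > 0 \<Longrightarrow> x \<in> F t \<Longrightarrow> d 0 u < \<delta> \<Longrightarrow> x + u \<in> F (t + a) \<and> u + x \<in> F (t + a)"
    "\<And>t. t > 0 \<Longrightarrow> measure mG (F (t + a)) \<le> (1 + \<epsilon>) * measure mG (F t)"
proof -
  have "\<exists>\<alpha> \<beta> :: real \<Rightarrow> real.
        continuous_on {0..<1} \<alpha> \<and> continuous_on {0..<1} \<beta> \<and>
        (\<forall>\<delta>\<in>{0..<1}. \<alpha> \<delta> \<ge> 0 \<and> \<beta> \<delta> \<ge> 0) \<and> \<alpha> 0 = 0 \<and> \<beta> 0 = 0 \<and>
        (\<forall>t>0. \<forall>\<delta>\<in>{0<..<1}. thicken d \<delta> (F t) \<subseteq> F (t + \<alpha> \<delta>)) \<and>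
        (\<forall>\<delta>\<in>{0<..<1}.
           (SUP s\<in>{0<..}. emeasure mG (F (s + \<delta>)) / emeasure mG (F s)) = ennreal (1 + \<beta> \<delta>))"
    using weak unfolding weakly_admissible_def by (rule conjunct2)
  then obtain \<alpha> \<beta> :: "real \<Rightarrow> real" where
    cont: "continuous_on {0..<1} \<alpha>" "continuous_on {0..<1} \<beta>" and
    nn: "\<forall>\<delta>\<in>{0..<1}. \<alpha> \<delta> \<ge> 0 \<and> \<beta> \<delta> \<ge> 0" and z: "\<alpha> 0 = 0" "\<beta> 0 = 0" and
    thick: "\<forall>t>0. \<forall>\<delta>\<in>{0<..<1}. thicken d \<delta> (F t) \<subseteq> F (t + \<alpha> \<delta>)" and
    sup: "\<forall>\<delta>\<in>{0<..<1}. (SUP s\<in>{0<..}. emeasure mG (F (s + \<delta>)) / emeasure mG (F s)) = ennreal (1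
      + \<beta> \<delta>)"
    by (elim exE conjE)
  obtain e where e: "e > 0" "\<And>x. x \<in> {0..<1} \<Longrightarrow> dist x 0 < e \<Longrightarrow> dist (\<beta> x) (\<beta> 0) < \<epsilon>"
    using cont(2)[unfolded continuous_on_iff, rule_format, of 0 \<epsilon>] assms by auto
  \<comment> \<open>The increment must stay below \<open>e\<close> for the bound on
    \<open>\<beta>\<close> and below 1 to lie in its domain.\<close>
  have "min e 1 > 0" using e by simp
  then obtain s where s: "s > 0" "\<And>x. x \<in> {0..<1} \<Longrightarrow> dist x 0 < s \<Longrightarrow> dist (\<alpha> x) (\<alpha> 0) < min e 1"
    using cont(1)[unfolded continuous_on_iff, rule_format, of 0 "min e 1"] by auto
  define \<delta> where "\<delta> = min (s / 2) (1 / 2)"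
  have \<delta>: "\<delta> \<in> {0<..<1}" "\<delta> < s" using s by (auto simp: \<delta>_def)
  define a where "a = \<alpha> \<delta>"
  have "dist (\<alpha> \<delta>) (\<alpha> 0) < min e 1" using \<delta> by (intro s(2)) (auto simp: dist_real_def)
  then have a: "a \<ge> 0" "a < e" "a < 1" using nn[rule_format, of \<delta>] \<delta> z
    by (auto simp: a_def dist_real_def)
  show ?thesis
  proof
    show "\<delta> > 0" "a \<ge> 0" using \<delta> a by auto
    fix t x u assume t: "t > 0" and x: "x \<in> F t" and u: "d 0 u < \<delta>"
    have *: "x' + u' \<in> F (t + a)" if "x' \<in> F t" "d 0 u' < \<delta>" for x' u'
      using thick[rule_format, OF t \<delta>(1)] that unfolding thicken_def a_def
        by (auto simp: metric.in_mball)
    have "- x + - u \<in> F (t + a)"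
      using F_uminus[OF t] x ball_uminus[OF u] by (intro *) simp_all
    then have "- (u + x) \<in> F (t + a)" by (simp only: minus_add)
    then have "u + x \<in> F (t + a)" using F_uminus[of "t + a" "u + x"] t a by simp
    then show "x + u \<in> F (t + a) \<and> u + x \<in> F (t + a)" using *[OF x u] by simp
  next
    fix t :: real assume t: "t > 0"
    have ba: "0 \<le> \<beta> a" "\<beta> a \<le> \<epsilon>" using e(2)[of a] a nn[rule_format, of a] z
      by (auto simp: dist_real_def)
    \<comment> \<open>The supremum is prescribed for positive increments only, so
      \<open>a = 0\<close> is treated apart, with \<open>\<beta> 0 = 0\<close>.\<close>
    have "measure mG (F (t + a)) \<le> (1 + \<beta> a) * measure mG (F t)"
    proof (cases "a = 0")
      case True
      then show ?thesis using z by simp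
    next
      case False
      have "emeasure mG (F (t + a)) / emeasure mG (F t) \<le> ennreal (1 + \<beta> a)"
        unfolding sup[rule_format, of a, symmetric, OF greaterThanLessThan_iff[THEN iffD2, OF
          conjI[OF le_neq_trans[OF a(1) False[symmetric]] a(3)]]]
        using t by (intro SUP_upper) simp
      then have "ennreal (measure mG (F (t + a)) / measure mG (F t)) \<le> ennreal (1 + \<beta> a)"
        using t a F_measure_pos[OF t] by (simp add: emeasure_F divide_ennreal)
      then have "measure mG (F (t + a)) / measure mG (F t) \<le> 1 + \<beta> a"
        using ba by (subst (asm) ennreal_le_iff) auto
      then show ?thesis using F_measure_pos[OF t] by (simp add: pos_divide_le_eq)
    qed
    also have "\<dots> \<le> (1 + \<epsilon>) * measure mG (F t)"
      using ba by (intro mult_right_mono) auto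
    finally show "measure mG (F (t + a)) \<le> (1 + \<epsilon>) * measure mG (F t)" .
  qed
qed

text \<open>The ergodic average of a local count before normalisation. For relatively compact boxes
  and positive \<open>t\<close> the integral is at most a constant times the finite mass of
  \<open>F t\<close>, so \<open>enn2real\<close> loses nothing.\<close>

definition box_integral :: "'g set \<Rightarrow> 'h set \<Rightarrow> ('g \<times> 'h) set \<Rightarrow> real \<Rightarrow> real" where
  "box_integral U B y t = enn2real (\<integral>\<^sup>+g. cnt (U \<times> B) (translate (- g, 0) y) * indicator (F t) g
    \<partial>mG)"

lemma box_integral_bound:
  assumes n: "\<forall>y\<in>space mY. cnt (U \<times> B) y \<le> of_nat n" and y: "y \<in> space mY" and t: "t > 0"
  shows "(\<integral>\<^sup>+g. cnt (U \<times> B) (translate (- g, 0) y) * indicator (F t) g \<partial>mG)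
    \<le> of_nat n * emeasure mG (F t)"
proof -
  have "translate (- g, 0) y \<in> space mY" for g using y by (auto simp: space_mY translate_coset)
  then have "(\<integral>\<^sup>+g. cnt (U \<times> B) (translate (- g, 0) y) * indicator (F t) g \<partial>mG)
      \<le> (\<integral>\<^sup>+g. of_nat n * indicator (F t) g \<partial>mG)"
    using n by (intro nn_integral_mono mult_right_mono) auto
  also have "\<dots> = of_nat n * emeasure mG (F t)"
    using F_sets[OF t] by (rule nn_integral_cmult_indicator)
  finally show ?thesis .
qed

lemma box_integral_finite:
  assumes n: "\<forall>y\<in>space mY. cnt (U \<times> B) y \<le> of_nat n" and y: "y \<in> space mY" and t: "t > 0"
  shows "(\<integral>\<^sup>+g. cnt (U \<times> B) (translate (- g, 0) y) * indicator (F t) g \<partial>mG)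
    = ennreal (box_integral U B y t)"
    and "box_integral U B y t \<le> n * measure mG (F t)"
proof -
  have le: "(\<integral>\<^sup>+g. cnt (U \<times> B) (translate (- g, 0) y) * indicator (F t) g \<partial>mG)
    \<le> ennreal (n * measure mG (F t))"
    using box_integral_bound[OF assms]
    by (simp add: emeasure_F[OF t] ennreal_of_nat_eq_real_of_nat ennreal_mult)
  then have fin: "(\<integral>\<^sup>+g. cnt (U \<times> B) (translate (- g, 0) y) * indicator (F t) g \<partial>mG) < top"
    by (rule order.strict_trans1) simp
  then show eq: "(\<integral>\<^sup>+g. cnt (U \<times> B) (translate (- g, 0) y) * indicator (F t) g \<partial>mG)
    = ennreal (box_integral U B y t)"
    unfolding box_integral_def by simp
  show "box_integral U B y t \<le> n * measure mG (F t)"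
    using le unfolding eq by (subst (asm) ennreal_le_iff) auto
qed

lemma ball_average_box:
  assumes U: "open U" and B: "B \<in> sets borel"
    and n: "\<forall>y\<in>space mY. cnt (U \<times> B) y \<le> of_nat n" and y: "y \<in> space mY" and t: "t > 0"
  shows "ball_average mG F t (\<lambda>y. complex_of_real (enn2real (cnt (U \<times> B) y))) y
    = complex_of_real (box_integral U B y t / measure mG (F t))"
proof -
  let ?c = "\<lambda>g. cnt (U \<times> B) (translate (- g, 0) y)"
  have m: "?c \<in> borel_measurable mG" by (rule cnt_shift_measurable[OF y U B])
  have tr: "translate (- g, 0) y \<in> space mY" for g using y by (auto simp: space_mY translate_coset)
  have e: "ennreal (enn2real (?c g)) = ?c g" for g
    using n[rule_format, OF tr[of g]]
      by (intro ennreal_enn2real) (auto simp: ennreal_of_nat_eq_real_of_nat intro: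
      order.strict_trans1)
  have m': "(\<lambda>g. enn2real (?c g)) \<in> borel_measurable (uniform_measure mG (F t))"
    using m by simp
  have "(LINT g|uniform_measure mG (F t). enn2real (?c g))
    = enn2real (\<integral>\<^sup>+g. ?c g \<partial>uniform_measure mG (F t))"
    using integral_eq_nn_integral[OF m'] by (simp add: e)
  also have "(\<integral>\<^sup>+g. ?c g \<partial>uniform_measure mG (F t))
    = (\<integral>\<^sup>+g. ?c g * indicator (F t) g \<partial>mG) / emeasure mG (F t)"
    using m F_sets[OF t] by (rule nn_integral_uniform_measure)
  also have "\<dots> = ennreal (box_integral U B y t / measure mG (F t))"
    using F_measure_pos[OF t] unfolding box_integral_finite(1)[OF n y t] emeasure_F[OF t]
    by (intro divide_ennreal) (auto simp: box_integral_def)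
  also have "enn2real \<dots> = box_integral U B y t / measure mG (F t)"
    by (simp add: box_integral_def)
  finally have "(LINT g|uniform_measure mG (F t). enn2real (?c g))
    = box_integral U B y t / measure mG (F t)" .
  then show ?thesis
    unfolding ball_average_def act_fst_def by (simp del: of_real_divide)
qed

text \<open>Counts in a relatively compact box are bounded, hence square integrable, and their mean
  over the quotient is the intensity of the box, which factorises.\<close>

lemma box_average_tendsto:
  assumes U: "open U" "U \<subseteq> K" "compact K" and B: "B \<in> sets borel" "B \<subseteq> L" "compact L"
  shows "AE y in mY. ((\<lambda>t. box_integral U B y t / measure mG (F t))
    \<longlongrightarrow> dens * measure mG U * measure mH B) at_top"
proof -
  obtain n :: nat where n: "\<forall>y\<in>space mY. cnt (U \<times> B) y \<le> of_nat n"
    using cnt_box_bound[OF U(3,2) B(3,2)] by metis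
  have UB: "U \<times> B \<in> sets borel" using U B by (intro Times_borel) auto
  define f where "f y = complex_of_real (enn2real (cnt (U \<times> B) y))" for y
  have [measurable]: "cnt (U \<times> B) \<in> borel_measurable mY" using UB by (rule cnt_measurable)
  have f [measurable]: "f \<in> borel_measurable mY" unfolding f_def by measurable
  have e: "ennreal (enn2real (cnt (U \<times> B) y)) = cnt (U \<times> B) y" if "y \<in> space mY" for y
    using n[rule_format, OF that]
      by (intro ennreal_enn2real) (auto simp: ennreal_of_nat_eq_real_of_nat intro:
      order.strict_trans1)
  have nf: "cmod (f y) \<le> n" if "y \<in> space mY" for y
  proof -
    have "ennreal (enn2real (cnt (U \<times> B) y)) \<le> ennreal n"
      using n[rule_format, OF that] e[OF that] by (simp add: ennreal_of_nat_eq_real_of_nat)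
    then have "enn2real (cnt (U \<times> B) y) \<le> n" by (subst (asm) ennreal_le_iff) auto
    then show ?thesis by (simp add: f_def)
  qed
  have sq: "integrable mY (\<lambda>y. (cmod (f y))\<^sup>2)"
  proof (rule integrable_const_bound[where B = "(real n)\<^sup>2"])
    show "AE y in mY. norm ((cmod (f y))\<^sup>2) \<le> (real n)\<^sup>2"
      using nf by (intro AE_I2) (simp add: power_mono)
  qed measurable
  have "(LINT y|mY. f y) = complex_of_real (LINT y|mY. enn2real (cnt (U \<times> B) y))"
    unfolding f_def by simp
  also have "(LINT y|mY. enn2real (cnt (U \<times> B) y)) = enn2real (\<integral>\<^sup>+y. cnt (U \<times> B) y \<partial>mY)"
    by (subst integral_eq_nn_integral) (auto simp: e cong: nn_integral_cong)
  also have "(\<integral>\<^sup>+y. cnt (U \<times> B) y \<partial>mY) = ennreal dens * emeasure mG U * emeasure mH B"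
    using UB U B emeasure_intensity_Times[of U B] by (simp add: emeasure_intensity)
  also have "enn2real \<dots> = dens * measure mG U * measure mH B"
    using dens_pos by (simp add: enn2real_mult measure_def)
  finally have int: "(LINT y|mY. f y) = complex_of_real (dens * measure mG U * measure mH B)" .
  have "AE y in mY. ((\<lambda>t. ball_average mG F t f y)
    \<longlongrightarrow> complex_of_real (dens * measure mG U * measure mH B)) at_top"
    using good f sq unfolding ae_good_def int[symmetric] by blast
  then show ?thesis
    using AE_space
  proof eventually_elim
    case (elim y)
    have "eventually (\<lambda>t. ball_average mG F t f y
      = complex_of_real (box_integral U B y t / measure mG (F t))) at_top"
      using eventually_gt_at_top[of "0::real"]
      by eventually_elim (unfold f_def, rule ball_average_box[OF U(1) B(1) n elim(2)])
    from tendsto_cong[OF this] elim(1)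
    have "((\<lambda>t. complex_of_real (box_integral U B y t / measure mG (F t)))
      \<longlongrightarrow> complex_of_real (dens * measure mG U * measure mH B)) at_top"
      by simp
    then show ?case by (simp only: tendsto_of_real_iff)
  qed
qed

text \<open>Generic representatives are dense, so one of the form \<open>(u, v) + x\<close> with
  small \<open>(u, v)\<close> exists next to any representative \<open>x\<close> of
  \<open>y\<close>.\<close>

lemma nbhd_coset_exists:
  assumes y: "y \<in> space mY" and N: "open N" "0 \<in> N" and \<delta>: "\<delta> > 0" and Q: "AE y in mY. Q y"
  obtains u v where "d 0 u < \<delta>" "v \<in> N" "Q (translate (u, v) y)"
proof -
  obtain x where x: "y = left_coset \<Gamma> x" using y by (auto simp: space_mY)
  let ?V = "(\<lambda>z. z - x) -` ({u. d 0 u < \<delta>} \<times> N)"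
  have "open ?V" unfolding diff_conv_add_uminus
    by (intro open_vimage open_Times open_ball N continuous_intros)
  moreover have "x \<in> ?V" using N \<delta> by (simp add: zero_prod_def)
  ultimately obtain z where z: "z \<in> ?V" "Q (left_coset \<Gamma> z)"
    using AE_coset_dense[OF Q] by blast
  obtain u v where uv: "z - x = (u, v)" by (cases "z - x")
  then have "z = (u, v) + x" by (metis diff_add_cancel)
  then have "translate (u, v) y = left_coset \<Gamma> z" by (simp add: x translate_coset)
  then show ?thesis using that[of u v] z uv by auto
qed

lemma card_le_translate:
  fixes p :: "'a::group_add"
  assumes fin: "finite (translate p y \<inter> B)" and sub: "\<And>q. q \<in> y \<Longrightarrow> q \<in> A \<Longrightarrow> p + q \<in> B"
  shows "card (y \<inter> A) \<le> card (translate p y \<inter> B)"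
proof -
  have "(+) p ` (y \<inter> A) \<subseteq> translate p y \<inter> B" using sub by (auto simp: translate_def)
  then have "card ((+) p ` (y \<inter> A)) \<le> card (translate p y \<inter> B)" by (rule card_mono[OF fin])
  then show ?thesis using card_translate[of p "y \<inter> A"] by (simp only: translate_def)
qed

lemma measure_ball_pos:
  assumes "\<delta> > 0"
  shows "measure mG {u. d 0 u < \<delta>} > 0" "emeasure mG {u. d 0 u < \<delta>}
    = ennreal (measure mG {u. d 0 u < \<delta>})"
proof -
  have "emeasure mG {u. d 0 u < \<delta>} \<le> emeasure mG {u. d 0 u \<le> \<delta>}"
    by (intro emeasure_mono) (auto simp: DG intro: borel_compact compact_cball)
  also have "\<dots> < \<infinity>" by (intro DG(4) compact_cball)
  finally show e: "emeasure mG {u. d 0 u < \<delta>} = ennreal (measure mG {u. d 0 u < \<delta>})"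
    by (intro emeasure_eq_ennreal_measure) simp
  have "0 \<in> {u. d 0 u < \<delta>}" using assms by simp
  then have "emeasure mG {u. d 0 u < \<delta>} > 0" by (intro haar_open_pos[OF haar_G] open_ball) blast
  then show "measure mG {u. d 0 u < \<delta>} > 0" unfolding e by simp
qed

lemma card_box_le_integral:
  assumes y: "y \<in> space mY" and \<delta>: "\<delta> > 0" and B: "B \<in> sets borel" "B \<subseteq> L" "compact L"
    and t: "t > 0" "t' > 0" and sub: "\<And>x u. x \<in> F t \<Longrightarrow> d 0 u < \<delta> \<Longrightarrow> x + u \<in> F t'"
  shows "card (y \<inter> (F t \<times> B)) * measure mG {u. d 0 u < \<delta>} \<le> box_integral {u. d 0 u < \<delta>} B y t'"
proof -
  let ?U = "{u. d 0 u < \<delta>}"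
  have "?U \<subseteq> {u. d 0 u \<le> \<delta>}" by auto
  then obtain n :: nat where n: "\<forall>y\<in>space mY. cnt (?U \<times> B) y \<le> of_nat n"
    using cnt_box_bound[OF compact_cball _ B(3,2)] by metis
  have "cnt (F t \<times> B) y * emeasure mG ?U \<le> ennreal (box_integral ?U B y t')"
    unfolding box_integral_finite(1)[OF n y t(2), symmetric]
    using F_compact[OF t(1)] F_sets[OF t(2)] sub ball_uminus
    by (intro count_upper[OF y open_ball _ _ _ B]) (auto simp: DG)
  moreover have "cnt (F t \<times> B) y = of_nat (card (y \<inter> (F t \<times> B)))"
    by (intro cnt_finite finite_coset_Times[OF y F_compact[OF t(1)] _ B(3,2)]) simp
  ultimately have "ennreal (card (y \<inter> (F t \<times> B)) * measure mG ?U)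
    \<le> ennreal (box_integral ?U B y t')"
    by (simp add: measure_ball_pos[OF \<delta>] ennreal_of_nat_eq_real_of_nat ennreal_mult)
  then show ?thesis by (subst (asm) ennreal_le_iff) (auto simp: box_integral_def)
qed

lemma integral_le_card_box:
  assumes y: "y \<in> space mY" and \<delta>: "\<delta> > 0" and B: "B \<subseteq> L" "compact L"
    and t: "t > 0" "t' > 0" and sub: "\<And>x u. x \<in> F t \<Longrightarrow> d 0 u < \<delta> \<Longrightarrow> x + u \<in> F t'"
  shows "box_integral {u. d 0 u < \<delta>} B y t \<le> card (y \<inter> (F t' \<times> B)) * measure mG {u. d 0 u < \<delta>}"
proof -
  let ?U = "{u. d 0 u < \<delta>}"
  have "?U \<subseteq> {u. d 0 u \<le> \<delta>}" by auto
  then obtain n :: nat where n: "\<forall>y\<in>space mY. cnt (?U \<times> B) y \<le> of_nat n"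
    using cnt_box_bound[OF compact_cball _ B(2,1)] by metis
  have "ennreal (box_integral ?U B y t) \<le> cnt (F t' \<times> B) y * emeasure mG ?U"
    unfolding box_integral_finite(1)[OF n y t(1), symmetric]
    using F_compact[OF t(2)] sub ball_uminus
    by (intro count_lower[OF y open_ball _ _ B]) auto
  moreover have "cnt (F t' \<times> B) y = of_nat (card (y \<inter> (F t' \<times> B)))"
    by (intro cnt_finite finite_coset_Times[OF y F_compact[OF t(2)] _ B(2,1)]) simp
  ultimately have "ennreal (box_integral ?U B y t)
    \<le> ennreal (card (y \<inter> (F t' \<times> B)) * measure mG ?U)"
    by (simp add: measure_ball_pos[OF \<delta>] ennreal_of_nat_eq_real_of_nat ennreal_mult)
  then show ?thesis by (subst (asm) ennreal_le_iff) auto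
qed

text \<open>The bound is uniform in the coset as well as in \<open>t\<close>, because it rests on
  the uniform bound for local counts and not on the ergodic theorem. It later supplies the
  dominating constant; the factor 2 is one admissible step with
  \<open>\<epsilon> = 1\<close>.\<close>

lemma card_box_bounded:
  assumes B: "compact B"
  obtains C where "\<And>y t. y \<in> space mY \<Longrightarrow> t > 0 \<Longrightarrow> card (y \<inter> (F t \<times> B)) \<le> C * measure mG (F t)"
proof -
  obtain \<delta> a where \<delta>: "\<delta> > 0" "a \<ge> 0"
    "\<And>t x u. t > 0 \<Longrightarrow> x \<in> F t \<Longrightarrow> d 0 u < \<delta> \<Longrightarrow> x + u \<in> F (t + a) \<and> u + x \<in> F (t + a)"
    "\<And>t. t > 0 \<Longrightarrow> measure mG (F (t + a)) \<le> (1 + 1) * measure mG (F t)"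
    using admissible_step[of 1] by (metis zero_less_one)
  let ?U = "{u. d 0 u < \<delta>}"
  have "?U \<subseteq> {u. d 0 u \<le> \<delta>}" by auto
  then obtain n :: nat where n: "\<forall>y\<in>space mY. cnt (?U \<times> B) y \<le> of_nat n"
    using cnt_box_bound[OF compact_cball _ B subset_refl] by metis
  have U: "measure mG ?U > 0" by (rule measure_ball_pos[OF \<delta>(1)])
  have "card (y \<inter> (F t \<times> B)) \<le> (n * 2 / measure mG ?U) * measure mG (F t)"
    if y: "y \<in> space mY" and t: "t > 0" for y t
  proof -
    have "card (y \<inter> (F t \<times> B)) * measure mG ?U \<le> box_integral ?U B y (t + a)"
      using B t \<delta> by (intro card_box_le_integral[OF y \<delta>(1) _ subset_refl B]) (auto intro:
        borel_compact)
    also have "\<dots> \<le> n * measure mG (F (t + a))"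
      using t \<delta> by (intro box_integral_finite(2)[OF n y]) auto
    also have "\<dots> \<le> n * (2 * measure mG (F t))"
      using \<delta>(4)[OF t] by (intro mult_left_mono) auto
    finally show ?thesis using U by (simp add: field_simps)
  qed
  then show ?thesis using that by blast
qed

text \<open>
  The ergodic theorem controls almost every coset; the given one is compared with a nearby generic
  one, which perturbs \<open>F t\<close> on the left (absorbed by symmetry and admissibility) and the window.
\<close>

lemma generic_nearby:
  assumes y: "y \<in> space mY" and e: "e > 0" and N: "open N" "0 \<in> N"
    and B: "B \<in> sets borel" "B \<subseteq> L" "compact L"
  obtains \<delta> b u v where "\<delta> > 0" "b \<ge> 0"
    "\<And>t x u. t > 0 \<Longrightarrow> x \<in> F t \<Longrightarrow> d 0 u < \<delta> \<Longrightarrow> x + u \<in> F (t + b) \<and> u + x \<in> F (t + b)"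
    "\<And>t. t > 0 \<Longrightarrow> 1 / measure mG (F t) \<le> (1 + e) * (1 + e) / measure mG (F (t + 2 * b))"
    "d 0 u < \<delta>" "v \<in> N"
    "((\<lambda>t. box_integral {u. d 0 u < \<delta>} B (translate (u, v) y) t / measure mG (F t) / measure mG {u.
      d 0 u < \<delta>})
      \<longlongrightarrow> dens * measure mH B) at_top"
proof -
  obtain \<delta> b where \<delta>: "\<delta> > 0" "b \<ge> 0"
    "\<And>t x u. t > 0 \<Longrightarrow> x \<in> F t \<Longrightarrow> d 0 u < \<delta> \<Longrightarrow> x + u \<in> F (t + b) \<and> u + x \<in> F (t + b)"
    "\<And>t. t > 0 \<Longrightarrow> measure mG (F (t + b)) \<le> (1 + e) * measure mG (F t)"
    using admissible_step[OF e] by metis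
  let ?U = "{u. d 0 u < \<delta>}"
  have "AE y in mY. ((\<lambda>t. box_integral ?U B y t / measure mG (F t))
    \<longlongrightarrow> dens * measure mG ?U * measure mH B) at_top"
    by (rule box_average_tendsto[OF open_ball _ compact_cball[of 0 \<delta>] B]) auto
  from nbhd_coset_exists[OF y N \<delta>(1) this]
  obtain u v where uv: "d 0 u < \<delta>" "v \<in> N"
    and lim: "((\<lambda>t. box_integral ?U B (translate (u, v) y) t / measure mG (F t))
      \<longlongrightarrow> dens * measure mG ?U * measure mH B) at_top"
    by blast
  have U: "measure mG ?U > 0" by (rule measure_ball_pos[OF \<delta>(1)])
  have "((\<lambda>t. box_integral ?U B (translate (u, v) y) t / measure mG (F t) / measure mG ?U)
      \<longlongrightarrow> dens * measure mG ?U * measure mH B / measure mG ?U) at_top"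
    using U lim by (intro tendsto_divide tendsto_const) auto
  then have lim': "((\<lambda>t. box_integral ?U B (translate (u, v) y) t / measure mG (F t) / measure mG
    ?U)
      \<longlongrightarrow> dens * measure mH B) at_top"
    using U by simp
  \<comment> \<open>Two increments \<open>b\<close> are charged: one for the translation by
    \<open>u\<close>, one for spreading the points over the ball.\<close>
  have "1 / measure mG (F t) \<le> (1 + e) * (1 + e) / measure mG (F (t + 2 * b))" if t: "t > 0" for t
  proof -
    have tb: "t + b > 0" "t + 2 * b > 0" using t \<delta> by auto
    have "measure mG (F (t + b + b)) \<le> (1 + e) * measure mG (F (t + b))" by (rule \<delta>(4)[OF tb(1)])
    also have "\<dots> \<le> (1 + e) * ((1 + e) * measure mG (F t))" using \<delta>(4)[OF t] e
      by (intro mult_left_mono) auto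
    finally have "measure mG (F (t + 2 * b)) \<le> (1 + e) * ((1 + e) * measure mG (F t))"
      by (simp add: add.assoc)
    then show ?thesis using F_measure_pos[OF t] F_measure_pos[OF tb(2)] by (simp add: field_simps)
  qed
  from that[OF \<delta>(1-3) this uv lim'] show ?thesis .
qed

text \<open>From above, an open \<open>V\<close> slightly larger than the closure of
  \<open>B\<close> absorbs the displacement \<open>v\<close> of the window; from below, a compact
  \<open>K\<close> inside the interior does. The null frontier makes the two densities meet.\<close>

theorem card_box_tendsto:
  assumes y: "y \<in> space mY" and B: "B \<subseteq> L" "compact L" and fr: "emeasure mH (frontier B) = 0"
  shows "((\<lambda>t. card (y \<inter> (F t \<times> B)) / measure mG (F t)) \<longlongrightarrow> dens * measure mH (closure B)) at_top"
proof -
  have clL: "closure B \<subseteq> L" using B by (simp add: closure_minimal compact_imp_closed)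
  have cl: "compact (closure B)" using compact_Int_closed[OF B(2) closed_closure[of B]] clL
    by (simp add: Int_absorb1)
  have int: "measure mH (interior B) = measure mH (closure B)"
  proof -
    have "emeasure mH (closure B) \<noteq> \<infinity>" using DH(4)[OF cl] by simp
    moreover have "closure B - interior B = frontier B" by (simp add: frontier_def)
    moreover have "measure mH (closure B - interior B)
      = measure mH (closure B) - measure mH (interior B)"
      using calculation(1) interior_subset[of B] closure_subset[of B]
      by (intro measure_Diff) (auto simp: DH)
    ultimately show ?thesis using fr by (simp add: measure_def)
  qed
  have cont: "((\<lambda>e. (1 + e) * (1 + e) * c) \<longlongrightarrow> c) (at_right 0)" for c :: real
  proof -
    have "((\<lambda>e. (1 + e) * (1 + e) * c) \<longlongrightarrow> (1 + 0) * (1 + 0) * c) (at_right 0)"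
      by (intro tendsto_intros)
    then show ?thesis by simp
  qed
  \<comment> \<open>A strict inequality leaves room for the square of \<open>1 + e\<close>, one
    factor for each of the two admissible steps.\<close>
  have small: "\<exists>e>0. (1 + e) * (1 + e) * c < a" if "c < a" for c a :: real
  proof -
    have "eventually (\<lambda>e. (1 + e) * (1 + e) * c < a \<and> e > 0) (at_right 0)"
      using order_tendstoD(2)[OF cont that] eventually_at_right_less[of "0::real"]
        by eventually_elim auto
    then show ?thesis
      using eventually_happens'[of "at_right (0::real)"] trivial_limit_at_right_real by blast
  qed
  show ?thesis
  proof (rule order_tendstoI)
    fix a assume a: "dens * measure mH (closure B) < a"
    then have "measure mH (closure B) < a / dens" using dens_pos by (simp add: field_simps)
    then obtain V K where V: "open V" "compact K" "closure B \<subseteq> V" "V \<subseteq> K" "measure mH V < a / dens"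
      using compact_outer_regular[OF invH cl] by metis
    then have "dens * measure mH V < a" using dens_pos by (simp add: field_simps)
    then obtain e where e: "e > 0" "(1 + e) * (1 + e) * (dens * measure mH V) < a" using small
      by blast
    obtain N where N: "open N" "0 \<in> N" "\<And>v k. v \<in> N \<Longrightarrow> k \<in> closure B \<Longrightarrow> v + k \<in> V"
      using compact_translate_nbhd[OF cl V(1,3)] by metis
    obtain \<delta> b u v where g: "\<delta> > 0" "b \<ge> 0"
      "\<And>t x u. t > 0 \<Longrightarrow> x \<in> F t \<Longrightarrow> d 0 u < \<delta> \<Longrightarrow> x + u \<in> F (t + b) \<and> u + x \<in> F (t + b)"
      "\<And>t. t > 0 \<Longrightarrow> 1 / measure mG (F t) \<le> (1 + e) * (1 + e) / measure mG (F (t + 2 * b))"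
      "d 0 u < \<delta>" "v \<in> N"
      "((\<lambda>t. box_integral {u. d 0 u < \<delta>} V (translate (u, v) y) t / measure mG (F t) / measure mG
        {u. d 0 u < \<delta>})
        \<longlongrightarrow> dens * measure mH V) at_top"
      by (rule generic_nearby[OF y e(1) N(1,2) borel_open[OF V(1)] V(4,2)]) blast
    let ?U = "{u. d 0 u < \<delta>}"
    define y' where "y' = translate (u, v) y"
    have y': "y' \<in> space mY" using y by (auto simp: y'_def space_mY translate_coset)
    have U: "measure mG ?U > 0" by (rule measure_ball_pos[OF g(1)])
    have bound: "card (y \<inter> (F t \<times> B)) / measure mG (F t)
        \<le> (1 + e) * (1 + e) * (box_integral ?U V y' (t + 2 * b) / measure mG (F (t
          + 2 * b)) / measure mG ?U)"
      if t: "t > 0" for t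
    proof -
      have tb: "t + b > 0" "t + 2 * b > 0" using t g by auto
      have fin: "finite (y' \<inter> (F (t + b) \<times> V))"
        by (rule finite_coset_Times[OF y' F_compact[OF tb(1)] _ V(2,4)]) simp
      have "card (y \<inter> (F t \<times> B)) \<le> card (y' \<inter> (F (t + b) \<times> V))"
        unfolding y'_def
      proof (rule card_le_translate)
        show "finite (translate (u, v) y \<inter> (F (t + b) \<times> V))" using fin by (simp add: y'_def)
        fix q assume "q \<in> F t \<times> B"
        then show "(u, v) + q \<in> F (t + b) \<times> V"
          using g(3)[OF t _ g(5)] N(3)[OF g(6)] closure_subset[of B] by (auto simp: plus_prod_def)
      qed
      then have "card (y \<inter> (F t \<times> B)) * measure mG ?U \<le> card (y' \<inter> (F (t + b) \<times> V)) * measure mG ?U"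
        using U by (intro mult_right_mono) auto
      also have "\<dots> \<le> box_integral ?U V y' (t + 2 * b)"
        using V tb g(3)[of "t + b"]
          by (intro card_box_le_integral[OF y' g(1) _ V(4,2)]) (auto simp: add.assoc)
      finally have "card (y \<inter> (F t \<times> B)) \<le> box_integral ?U V y' (t + 2 * b) / measure mG ?U"
        using U by (simp add: pos_le_divide_eq)
      from mult_mono[OF this g(4)[OF t]] show ?thesis by (simp add: box_integral_def mult_ac)
    qed
    have shift: "filterlim (\<lambda>t. t + 2 * b) at_top at_top"
      by (intro filterlim_tendsto_add_at_top[OF tendsto_const, of "\<lambda>t. t" at_top
        "2 * b", unfolded add.commute[of "2 * b"]] filterlim_ident)
    have "((\<lambda>t. (1 + e) * (1 + e) * (box_integral ?U V y' (t + 2 * b) / measure mG (F (t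
      + 2 * b)) / measure mG ?U))
        \<longlongrightarrow> (1 + e) * (1 + e) * (dens * measure mH V)) at_top"
      using filterlim_compose[OF g(7) shift] unfolding y'_def by (intro tendsto_mult tendsto_const)
    from order_tendstoD(2)[OF this e(2)] eventually_gt_at_top[of "0::real"]
    show "eventually (\<lambda>t. card (y \<inter> (F t \<times> B)) / measure mG (F t) < a) at_top"
      by eventually_elim (use bound in \<open>blast intro: le_less_trans\<close>)
  next
    fix a assume a: "a < dens * measure mH (closure B)"
    then have "a / dens < measure mH (interior B)" using dens_pos int by (simp add: field_simps)
    moreover have "interior B \<subseteq> L" using B interior_subset by blast
    ultimately obtain K where K: "compact K" "K \<subseteq> interior B" "a / dens < measure mH K"
      using open_inner_regular[OF invH open_interior _ B(2)] by metis
    then have "a < dens * measure mH K" using dens_pos by (simp add: field_simps)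
    then obtain e where e: "e > 0" "(1 + e) * (1 + e) * a < dens * measure mH K" using small
      by blast
    obtain N where N: "open N" "0 \<in> N" "\<And>v k. v \<in> N \<Longrightarrow> k \<in> K \<Longrightarrow> - v + k \<in> interior B"
      using compact_translate_nbhd[OF K(1) open_interior K(2)] by metis
    obtain \<delta> b u v where g: "\<delta> > 0" "b \<ge> 0"
      "\<And>t x u. t > 0 \<Longrightarrow> x \<in> F t \<Longrightarrow> d 0 u < \<delta> \<Longrightarrow> x + u \<in> F (t + b) \<and> u + x \<in> F (t + b)"
      "\<And>t. t > 0 \<Longrightarrow> 1 / measure mG (F t) \<le> (1 + e) * (1 + e) / measure mG (F (t + 2 * b))"
      "d 0 u < \<delta>" "v \<in> N"
      "((\<lambda>t. box_integral {u. d 0 u < \<delta>} K (translate (u, v) y) t / measure mG (F t) / measure mG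
        {u. d 0 u < \<delta>})
        \<longlongrightarrow> dens * measure mH K) at_top"
      by (rule generic_nearby[OF y e(1) N(1,2) borel_compact[OF K(1)] subset_refl K(1)]) blast
    let ?U = "{u. d 0 u < \<delta>}"
    define y' where "y' = translate (u, v) y"
    have y': "y' \<in> space mY" using y by (auto simp: y'_def space_mY translate_coset)
    \<comment> \<open>The lower bound carries points of the generic coset back to \<open>y\<close>,
      hence moves them by \<open>- (u, v)\<close>.\<close>
    have yy: "y = translate (- (u, v)) y'"
      by (simp only: y'_def translate_translate left_minus translate_0)
    have U: "measure mG ?U > 0" by (rule measure_ball_pos[OF g(1)])
    have bound: "box_integral ?U K y' t / measure mG (F t) / measure mG ?U
        \<le> (1 + e) * (1 + e) * (card (y \<inter> (F (t + 2 * b) \<times> B)) / measure mG (F (t + 2 * b)))"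
      if t: "t > 0" for t
    proof -
      have tb: "t + b > 0" "t + 2 * b > 0" using t g by auto
      have fin: "finite (y \<inter> (F (t + 2 * b) \<times> B))"
        by (rule finite_coset_Times[OF y F_compact[OF tb(2)] _ B(2,1)]) simp
      have "card (y' \<inter> (F (t + b) \<times> K)) \<le> card (translate (- (u, v)) y' \<inter> (F (t + 2 * b) \<times> B))"
      proof (rule card_le_translate)
        show "finite (translate (- (u, v)) y' \<inter> (F (t + 2 * b) \<times> B))" using fin yy by simp
        fix q assume "q \<in> F (t + b) \<times> K"
        then show "- (u, v) + q \<in> F (t + 2 * b) \<times> B"
          using g(3)[OF tb(1) _ ball_uminus[OF g(5)]] N(3)[OF g(6)] interior_subset[of B]
          by (auto simp: plus_prod_def uminus_prod_def add.assoc)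
      qed
      then have "card (y' \<inter> (F (t + b) \<times> K)) * measure mG ?U \<le> card (y \<inter> (F (t
        + 2 * b) \<times> B)) * measure mG ?U"
        using U unfolding yy[symmetric] by (intro mult_right_mono) auto
      moreover have "box_integral ?U K y' t \<le> card (y' \<inter> (F (t + b) \<times> K)) * measure mG ?U"
        using t tb g(3)[OF t] by (intro integral_le_card_box[OF y' g(1) subset_refl K(1)]) auto
      ultimately have "box_integral ?U K y' t \<le> card (y \<inter> (F (t + 2 * b) \<times> B)) * measure mG ?U"
        by (rule order.trans[rotated])
      then have "box_integral ?U K y' t / measure mG ?U \<le> card (y \<inter> (F (t + 2 * b) \<times> B))"
        using U by (simp add: pos_divide_le_eq)
      from mult_mono[OF this g(4)[OF t]] show ?thesis by (simp add: mult_ac)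
    qed
    \<comment> \<open>The estimate bounds the count at \<open>t + 2 * b\<close> from below by the
      average at \<open>t\<close>, so it is read at \<open>t = s - 2 * b\<close>, which is positive
      once \<open>s > 2 * b\<close>.\<close>
    have shift: "filterlim (\<lambda>s. s - 2 * b) at_top at_top"
      using filterlim_tendsto_add_at_top[OF tendsto_const[of "- (2 * b)"] filterlim_ident[of
        "at_top :: real filter"]] by simp
    have "((\<lambda>s. box_integral ?U K y' (s - 2 * b) / measure mG (F (s - 2 * b)) / measure mG ?U)
        \<longlongrightarrow> dens * measure mH K) at_top"
      using filterlim_compose[OF g(7) shift] unfolding y'_def .
    from order_tendstoD(1)[OF this e(2)] eventually_gt_at_top[of "2 * b"]
    show "eventually (\<lambda>s. a < card (y \<inter> (F s \<times> B)) / measure mG (F s)) at_top"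
    proof eventually_elim
      case (elim s)
      have "(1 + e) * (1 + e) * a < (1 + e) * (1 + e) * (card (y \<inter> (F s \<times> B)) / measure mG (F s))"
        using elim bound[of "s - 2 * b"] by simp
      moreover have "0 < (1 + e) * (1 + e)" using e(1) by simp
      ultimately show ?case by (simp only: mult_less_cancel_left_pos)
    qed
  qed
qed

end

subsection \<open>The hull of a model set\<close>

context lattice_quotient
begin

text \<open>A separating neighbourhood translated to \<open>x\<close> meets the subgroup in at most
  one point, which can be removed when \<open>x\<close> lies outside.\<close>

lemma closed_lattice: "closed \<Gamma>"
proof -
  obtain V where V: "open V" "0 \<in> V" "\<And>p q. p \<in> V \<Longrightarrow> q \<in> V \<Longrightarrow> - p + q \<in> \<Gamma> \<Longrightarrow> p = q"
    by (rule separating_nbhd) blast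
  have "\<exists>U. open U \<and> x \<in> U \<and> U \<subseteq> - \<Gamma>" if x: "x \<notin> \<Gamma>" for x
  proof -
    have one: "p = q" if "p \<in> translate x V \<inter> \<Gamma>" "q \<in> translate x V \<inter> \<Gamma>" for p q
    proof -
      have "- (- x + p) + (- x + q) = - p + q" by (simp add: minus_add add.assoc)
      moreover have "- p + q \<in> \<Gamma>" using that subgroup(2)[OF subgroup(3)] by auto
      ultimately have "- x + p = - x + q" using that by (intro V(3)) (simp_all add: mem_translate)
      then show ?thesis by simp
    qed
    have xV: "x \<in> translate x V" using V(2) by (simp add: mem_translate)
    show ?thesis
    proof (cases "translate x V \<inter> \<Gamma> = {}")
      case True
      then show ?thesis using xV open_translate[OF V(1)] by blast
    next
      case False
      then obtain p where p: "p \<in> translate x V \<inter> \<Gamma>" by blast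
      have "open (translate x V - {p})" using open_translate[OF V(1)] by (intro open_Diff) auto
      moreover have "x \<in> translate x V - {p}" using xV p x by auto
      moreover have "translate x V - {p} \<subseteq> - \<Gamma>" using one[OF _ p] by auto
      ultimately show ?thesis by blast
    qed
  qed
  then have "open (- \<Gamma>)" by (subst open_subopen) auto
  then show ?thesis by (simp add: closed_def)
qed

lemma coset_0: "left_coset \<Gamma> 0 = \<Gamma>"
  by (simp add: left_coset_def translate_0)

end

lemma openin_chabauty_hit: "open V \<Longrightarrow> openin chabauty_fell {C. closed C \<and> C \<inter> V \<noteq> {}}"
  unfolding chabauty_fell_def by (rule topology_generated_by_Basis) blast

lemma openin_chabauty_miss: "compact K \<Longrightarrow> openin chabauty_fell {C. closed C \<and> C \<inter> K = {}}"
  unfolding chabauty_fell_def by (rule topology_generated_by_Basis) blast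

text \<open>The model set of an arbitrary coset. Avoiding the inverse of the projection makes it
  meaningful for every \<open>y\<close>, and the orbit of the model set becomes the family of slices
  of the cosets of \<open>(g, 0)\<close>.\<close>

definition slice :: "('g \<times> 'h) set \<Rightarrow> 'h set \<Rightarrow> 'g set" where
  "slice y B = {a. \<exists>b\<in>B. (a, b) \<in> y}"

lemma model_set_slice:
  assumes "inj_on fst \<Gamma>"
  shows "model_set \<Gamma> W = slice \<Gamma> W"
proof -
  have "star_map \<Gamma> a = b" if "(a, b) \<in> \<Gamma>" for a b
    using the_inv_into_f_f[OF assms that] by (simp add: star_map_def)
  then show ?thesis by (force simp: model_set_def slice_def)
qed

lemma translate_slice:
  fixes \<Gamma> :: "('g::group_add \<times> 'h::group_add) set"
  shows "translate g (slice \<Gamma> W) = slice (translate (g, 0) \<Gamma>) W"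
  by (auto simp: set_eq_iff mem_translate slice_def uminus_prod_def plus_prod_def)

context cut_project
begin

text \<open>Any point of a coset represents it. Cosets whose slices hit a relatively compact
  \<open>V\<close> thus have representatives in a fixed compact set, which starts the compactness
  argument for the hull.\<close>

lemma slice_hit_eq:
  assumes "slice (left_coset \<Gamma> x) W \<inter> V \<noteq> {}"
  obtains a b where "a \<in> V" "b \<in> W" "left_coset \<Gamma> x = left_coset \<Gamma> (a, b)"
proof -
  obtain a b where "a \<in> V" "b \<in> W" "(a, b) \<in> left_coset \<Gamma> x"
    using assms by (auto simp: slice_def)
  then show ?thesis using that coset_eq by metis
qed

text \<open>
  If no coset with a representative \<open>c\<close> in the compact set \<open>K \<times> W\<close> sandwiched \<open>P\<close>, each such \<open>c\<close>
  would be separated from \<open>P\<close> by a Fell neighbourhood; finitely many of these would isolate \<open>P\<close>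
  from the orbit.
\<close>

lemma unsandwiched_separated:
  assumes W: "compact W" and P: "closed P"
    and not: "\<not> (slice (left_coset \<Gamma> c) (interior W) \<subseteq> P \<and> P \<subseteq> slice (left_coset \<Gamma> c) W)"
  shows "\<exists>N T. open N \<and> c \<in> N \<and> openin chabauty_fell T \<and> P \<in> T \<and>
    (\<forall>z\<in>N. slice (left_coset \<Gamma> z) W \<notin> T)"
proof (cases "slice (left_coset \<Gamma> c) (interior W) \<subseteq> P")
  case False
  then obtain q b0 where q: "q \<notin> P" "b0 \<in> interior W" "(q, b0) \<in> left_coset \<Gamma> c"
    by (auto simp: slice_def)
  \<comment> \<open>The lattice element leading from \<open>c\<close> to the offending point; held
    fixed, it supplies every nearby coset with a point over \<open>Q\<close> and inside
    \<open>W\<close>.\<close>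
  define \<gamma> where "\<gamma> = - c + (q, b0)"
  have \<gamma>: "\<gamma> \<in> \<Gamma>" "c + \<gamma> = (q, b0)" using q(3)
    by (simp_all add: \<gamma>_def mem_coset add.assoc[symmetric])
  have "open (- P)" "q \<in> - P" using P q by (simp_all add: open_Compl)
  then obtain V Q where V: "open V" "compact Q" "q \<in> V" "V \<subseteq> Q" "Q \<subseteq> - P"
    by (rule lcsc_compact_neighbourhood)
  define N where "N = (\<lambda>z. z + \<gamma>) -` (V \<times> interior W)"
  have "open N" unfolding N_def by (intro open_vimage open_Times V open_interior continuous_intros)
  moreover have "c \<in> N" using V q by (simp add: N_def \<gamma>)
  moreover have "openin chabauty_fell {C. closed C \<and> C \<inter> Q = {}}"
    by (rule openin_chabauty_miss[OF V(2)])
  moreover have "P \<in> {C. closed C \<and> C \<inter> Q = {}}" using P V by auto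
  moreover have "slice (left_coset \<Gamma> z) W \<notin> {C. closed C \<and> C \<inter> Q = {}}" if z: "z \<in> N" for z
  proof -
    obtain a b where ab: "z + \<gamma> = (a, b)" by (cases "z + \<gamma>")
    have "(a, b) \<in> left_coset \<Gamma> z" using coset_add[OF coset_self \<gamma>(1), of z] ab by simp
    moreover have "a \<in> Q" "b \<in> W" using z ab V interior_subset by (auto simp: N_def)
    ultimately show ?thesis by (auto simp: slice_def)
  qed
  ultimately show ?thesis by (intro exI[of _ N] exI[of _ "{C. closed C \<and> C \<inter> Q = {}}"] conjI ballI)
next
  case True
  then obtain q where q: "q \<in> P" "q \<notin> slice (left_coset \<Gamma> c) W" using not by auto
  \<comment> \<open>The condition that \<open>- z + (a, b)\<close> avoids \<open>\<Gamma>\<close> is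
    open because the lattice is closed, and the tube lemma makes it uniform over the compact
    \<open>W\<close>.\<close>
  define O' where "O' = (\<lambda>p::(('g \<times> 'h) \<times> 'g) \<times> 'h. - fst (fst p) + (snd (fst p), snd p)) -` (- \<Gamma>)"
  have oO: "open O'" unfolding O'_def
    by (intro open_vimage open_Compl closed_lattice continuous_intros)
  have "{(c, q)} \<times> W \<subseteq> O'" using q(2) by (auto simp: O'_def slice_def mem_coset)
  then obtain X where X: "(c, q) \<in> X" "open X" "X \<times> W \<subseteq> O'"
    using Elementary_Topology.tube_lemma[OF W oO] by metis
  obtain N Q where NQ: "open N" "open Q" "(c, q) \<in> N \<times> Q" "N \<times> Q \<subseteq> X"
    using X(2,1) by (rule open_prod_elim)
  have "slice (left_coset \<Gamma> z) W \<inter> Q = {}" if z: "z \<in> N" for z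
  proof -
    have "- z + (a, b) \<notin> \<Gamma>" if "a \<in> Q" "b \<in> W" for a b
    proof -
      have "((z, a), b) \<in> X \<times> W" using z that NQ by auto
      then show ?thesis using X(3) by (auto simp: O'_def)
    qed
    then show ?thesis by (auto simp: slice_def mem_coset)
  qed
  then have "slice (left_coset \<Gamma> z) W \<notin> {C. closed C \<and> C \<inter> Q \<noteq> {}}" if "z \<in> N" for z using that
    by simp
  moreover have "openin chabauty_fell {C. closed C \<and> C \<inter> Q \<noteq> {}}"
    by (rule openin_chabauty_hit[OF NQ(2)])
  moreover have "P \<in> {C. closed C \<and> C \<inter> Q \<noteq> {}}" using P q NQ by auto
  moreover have "open N" "c \<in> N" using NQ by simp_all
  ultimately show ?thesis by (intro exI[of _ N] exI[of _ "{C. closed C \<and> C \<inter> Q \<noteq> {}}"] conjI ballI)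
qed

lemma hull_sandwich:
  assumes W: "compact W" and P: "P \<in> trans_hull (slice \<Gamma> W)" "P \<noteq> {}"
  obtains y where "y \<in> space mY" "slice y (interior W) \<subseteq> P" "P \<subseteq> slice y W"
proof -
  have cl: "closed P"
    and near: "\<And>T. openin chabauty_fell T \<Longrightarrow> P \<in> T \<Longrightarrow> \<exists>g. translate g (slice \<Gamma> W) \<in> T"
    using P(1) unfolding trans_hull_def in_closure_of topspace_chabauty_fell by auto
  obtain p where p: "p \<in> P" using P(2) by blast
  \<comment> \<open>Translates of the model set that are Fell-close to \<open>P\<close> must hit
    \<open>V\<close>, since \<open>P\<close> contains \<open>p\<close>; here nonemptiness of
    \<open>P\<close> enters.\<close>
  obtain V K where VK: "open V" "compact K" "p \<in> V" "V \<subseteq> K"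
    using lcsc_compact_neighbourhood[OF open_UNIV UNIV_I] by metis
  have "\<exists>c. slice (left_coset \<Gamma> c) (interior W) \<subseteq> P \<and> P \<subseteq> slice (left_coset \<Gamma> c) W"
  proof (rule ccontr)
    assume *: "\<not> ?thesis"
    have "\<forall>c. \<exists>N T. open N \<and> c \<in> N \<and> openin chabauty_fell T \<and> P \<in> T \<and>
        (\<forall>z\<in>N. slice (left_coset \<Gamma> z) W \<notin> T)"
    proof
      fix c
      have "\<not> (slice (left_coset \<Gamma> c) (interior W) \<subseteq> P \<and> P \<subseteq> slice (left_coset \<Gamma> c) W)" using *
        by blast
      then show "\<exists>N T. open N \<and> c \<in> N \<and> openin chabauty_fell T \<and> P \<in> T \<and>
          (\<forall>z\<in>N. slice (left_coset \<Gamma> z) W \<notin> T)"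
        by (rule unsandwiched_separated[OF W cl])
    qed
    then obtain N T where NT': "\<forall>c. open (N c) \<and> c \<in> N c \<and> openin chabauty_fell (T c) \<and> P \<in> T c \<and>
        (\<forall>z\<in>N c. slice (left_coset \<Gamma> z) W \<notin> T c)"
      unfolding choice_iff by (elim exE)
    have NT: "\<And>c. open (N c)" "\<And>c. c \<in> N c" "\<And>c. openin chabauty_fell (T c)" "\<And>c. P \<in> T c"
        "\<And>c z. z \<in> N c \<Longrightarrow> slice (left_coset \<Gamma> z) W \<notin> T c"
      using NT'[rule_format] by blast+
    have cover: "K \<times> W \<subseteq> (\<Union>c\<in>K \<times> W. N c)" using NT(2) by blast
    obtain D where D: "D \<subseteq> K \<times> W" "finite D" "K \<times> W \<subseteq> (\<Union>c\<in>D. N c)"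
      by (rule compactE_image[OF compact_Times[OF VK(2) W] NT(1) cover])
    \<comment> \<open>\<open>topspace chabauty_fell\<close> is inserted so that the finite
      intersection runs over a nonempty family.\<close>
    define T' where "T' = {C. closed C \<and> C \<inter> V \<noteq> {}} \<inter> \<Inter>(insert (topspace chabauty_fell) (T ` D))"
    have "openin chabauty_fell T'"
      unfolding T'_def using D(2) NT(3)
      by (intro openin_Int openin_chabauty_hit VK(1) openin_Inter) auto
    moreover have "P \<in> T'" using cl p VK NT(4) by (auto simp: T'_def topspace_chabauty_fell)
    ultimately obtain g where g: "translate g (slice \<Gamma> W) \<in> T'" using near by metis
    have tg: "translate g (slice \<Gamma> W) = slice (left_coset \<Gamma> (g, 0)) W"
      by (simp add: translate_slice left_coset_def)
    have "slice (left_coset \<Gamma> (g, 0)) W \<inter> V \<noteq> {}" using g by (simp add: T'_def tg)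
    then obtain a b where ab: "a \<in> V" "b \<in> W" "left_coset \<Gamma> (g, 0) = left_coset \<Gamma> (a, b)"
      by (rule slice_hit_eq)
    then have "(a, b) \<in> K \<times> W" using VK(4) by (simp add: subsetD)
    then have "(a, b) \<in> (\<Union>c\<in>D. N c)" using D(3) by (rule subsetD[rotated])
    then obtain c where c: "c \<in> D" "(a, b) \<in> N c" by auto
    have "slice (left_coset \<Gamma> (a, b)) W \<in> T c" using g c(1) unfolding tg ab(3) T'_def by blast
    then show False using NT(5)[OF c(2)] by simp
  qed
  then obtain c where "slice (left_coset \<Gamma> c) (interior W) \<subseteq> P" "P \<subseteq> slice (left_coset \<Gamma> c) W"
    by blast
  then show ?thesis using that[of "left_coset \<Gamma> c"] by (simp add: space_mY)
qed

end

subsection \<open>Sampled autocorrelation of a model set\<close>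

locale model = sampling \<Gamma> mY mG mH d F
  for \<Gamma> :: "('g::lcsc_group_add \<times> 'h::lcsc_group_add) set" and mY mG mH d F +
  fixes W :: "'h set"
  assumes inj_fst: "inj_on fst \<Gamma>" and compact_W: "compact W"
    and frontier_W: "emeasure mH (frontier W) = 0"
begin

text \<open>Limits in the Fell topology may keep or lose points over the frontier of the window, so
  hull elements are described by two bounds rather than by equality with a slice.\<close>

definition sandwiched :: "('g \<times> 'h) set \<Rightarrow> 'g set \<Rightarrow> bool" where
  "sandwiched y P \<longleftrightarrow> y \<in> space mY \<and> slice y (interior W) \<subseteq> P \<and> P \<subseteq> slice y W"

text \<open>Every lattice vector that can join two points of a sandwiched set and has first
  coordinate in \<open>K\<close> is contained here. The set depends on \<open>K\<close> and
  \<open>W\<close> but not on \<open>P\<close> or \<open>t\<close>, so one finite index set serves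
  them all.\<close>

definition diffs :: "'g set \<Rightarrow> ('g \<times> 'h) set" where
  "diffs K = \<Gamma> \<inter> (K \<times> {- w + w' |w w'. w \<in> W \<and> w' \<in> W})"

definition window :: "'h set \<Rightarrow> 'h \<Rightarrow> 'h set" where
  "window V h = V \<inter> (\<lambda>w. w + h) -` V"

lemma finite_diffs:
  assumes "compact K"
  shows "finite (diffs K)"
proof -
  have "{- w + w' |w w'. w \<in> W \<and> w' \<in> W} = (\<lambda>p. - fst p + snd p) ` (W \<times> W)" by force
  moreover have "compact ((\<lambda>p. - fst p + snd p) ` (W \<times> W))"
    by (intro compact_continuous_image continuous_intros compact_Times compact_W)
  ultimately show ?thesis
    unfolding diffs_def using finite_coset_compact[OF compact_Times[OF assms], of _ 0]
      by (simp add: coset_0)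
qed

lemma inj_fst_coset:
  assumes y: "y \<in> space mY" and "(a, b) \<in> y" "(a, b') \<in> y"
  shows "b = b'"
proof -
  obtain x where x: "y = left_coset \<Gamma> x" using y by (auto simp: space_mY)
  have "- (a, b) + (a, b') \<in> \<Gamma>" using coset_diff[of "(a, b)" x "(a, b')"] assms x by simp
  then have "(0, - b + b') \<in> \<Gamma>" by (simp add: uminus_prod_def plus_prod_def)
  moreover have "(0, 0) \<in> \<Gamma>" using subgroup(1) by (simp add: zero_prod_def)
  ultimately have "- b + b' = 0" using inj_onD[OF inj_fst, of "(0, - b + b')" "(0, 0)"] by simp
  then show ?thesis by (metis add.right_neutral add_minus_cancel)
qed

lemma coset_shift: "y \<in> space mY \<Longrightarrow> p \<in> y \<Longrightarrow> \<delta> \<in> \<Gamma> \<Longrightarrow> p + \<delta> \<in> y"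
  unfolding space_mY by (erule imageE) (simp only: coset_add)

lemma coset_difference: "y \<in> space mY \<Longrightarrow> p \<in> y \<Longrightarrow> q \<in> y \<Longrightarrow> - p + q \<in> \<Gamma>"
  unfolding space_mY by (erule imageE) (simp only: coset_diff)

lemma sandwiched_finite:
  assumes P: "sandwiched y P" and A: "compact A"
  shows "finite (P \<inter> A)"
proof -
  have "P \<inter> A \<subseteq> fst ` (y \<inter> (A \<times> W))"
    using P by (force simp: sandwiched_def slice_def)
  moreover have "finite (y \<inter> (A \<times> W))"
    using P by (intro finite_coset_Times[OF _ A subset_refl compact_W subset_refl]) (simp add:
      sandwiched_def)
  ultimately show ?thesis by (meson finite_imageI finite_subset)
qed

text \<open>Two points of \<open>P\<close> lift to the same coset, so their difference lifts to a
  lattice vector; injectivity of the projection on \<open>\<Gamma>\<close> makes this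
  parametrisation of the contributing points one to one.\<close>

lemma infsum_differences:
  fixes f :: "'g \<Rightarrow> complex"
  assumes P: "sandwiched y P" and K: "compact K" "\<And>x. x \<notin> K \<Longrightarrow> f x = 0" and x: "x \<in> P"
  shows "(\<Sum>\<^sub>\<infinity>z\<in>P. f (- x + z)) = (\<Sum>\<delta>\<in>diffs K. if x + fst \<delta> \<in> P then f (fst \<delta>) else 0)"
proof -
  have y: "y \<in> space mY" using P by (simp add: sandwiched_def)
  obtain b where b: "b \<in> W" "(x, b) \<in> y" using P x by (auto simp: sandwiched_def slice_def)
  define D where "D = {\<delta> \<in> diffs K. x + fst \<delta> \<in> P}"
  have finD: "finite D" using finite_diffs[OF K(1)] by (simp add: D_def)
  have inj: "inj_on (\<lambda>\<delta>. x + fst \<delta>) D"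
    using inj_fst by (auto simp: inj_on_def D_def diffs_def)
  have "(\<Sum>\<^sub>\<infinity>z\<in>P. f (- x + z)) = (\<Sum>\<^sub>\<infinity>z\<in>(\<lambda>\<delta>. x + fst \<delta>) ` D. f (- x + z))"
  proof (rule infsum_cong_neutral)
    fix z assume z: "z \<in> P - (\<lambda>\<delta>. x + fst \<delta>) ` D"
    show "f (- x + z) = 0"
    proof (rule ccontr)
      assume "f (- x + z) \<noteq> 0"
      then have zK: "- x + z \<in> K" using K(2) by blast
      obtain b' where b': "b' \<in> W" "(z, b') \<in> y" using P z by (auto simp: sandwiched_def slice_def)
      have "(- x + z, - b + b') \<in> \<Gamma>"
        using coset_difference[OF y b(2) b'(2)] by (simp add: uminus_prod_def plus_prod_def)
      then have "(- x + z, - b + b') \<in> D"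
        using zK b b' z by (auto simp: D_def diffs_def add.assoc[symmetric])
      then have "x + (- x + z) \<in> (\<lambda>\<delta>. x + fst \<delta>) ` D" by force
      then show False using z by (simp add: add.assoc[symmetric])
    qed
  qed (auto simp: D_def)
  also have "\<dots> = (\<Sum>z\<in>(\<lambda>\<delta>. x + fst \<delta>) ` D. f (- x + z))"
    using finD by simp
  also have "\<dots> = (\<Sum>\<delta>\<in>D. f (fst \<delta>))"
    using inj by (subst sum.reindex) (simp_all add: add.assoc[symmetric])
  also have "\<dots> = (\<Sum>\<delta>\<in>diffs K. if x + fst \<delta> \<in> P then f (fst \<delta>) else 0)"
    unfolding D_def using finite_diffs[OF K(1)] by (simp add: sum.inter_filter)
  finally show ?thesis .
qed

lemma sampled_autocorrelation_eq:
  assumes P: "sandwiched y P" and K: "compact K" "\<And>x. x \<notin> K \<Longrightarrow> f x = 0" and t: "t > 0"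
  shows "sampled_autocorrelation mG P F t f =
    (\<Sum>\<delta>\<in>diffs K. f (fst \<delta>) * complex_of_real (card {x \<in> P \<inter> F t. x
      + fst \<delta> \<in> P} / measure mG (F t)))"
proof -
  have fin: "finite (P \<inter> F t)" by (rule sandwiched_finite[OF P F_compact[OF t]])
  have "(\<Sum>x\<in>P \<inter> F t. \<Sum>\<^sub>\<infinity>y\<in>P. f (- x + y))
      = (\<Sum>x\<in>P \<inter> F t. \<Sum>\<delta>\<in>diffs K. if x + fst \<delta> \<in> P then f (fst \<delta>) else 0)"
    by (rule sum.cong[OF refl]) (rule infsum_differences[OF P K], auto)
  also have "\<dots> = (\<Sum>\<delta>\<in>diffs K. \<Sum>x\<in>P \<inter> F t. if x + fst \<delta> \<in> P then f (fst \<delta>) else 0)"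
    by (rule sum.swap)
  also have "\<dots> = (\<Sum>\<delta>\<in>diffs K. f (fst \<delta>) * of_nat (card {x \<in> P \<inter> F t. x + fst \<delta> \<in> P}))"
    using fin by (intro sum.cong refl) (simp add: sum.inter_filter[symmetric])
  finally show ?thesis
    unfolding sampled_autocorrelation_def by (simp add: sum_divide_distrib)
qed

text \<open>The lift of \<open>x + fst \<delta>\<close> to the coset is unique, so it must be the
  lift of \<open>x\<close> shifted by \<open>\<delta>\<close>; hence both second coordinates fall in
  \<open>W\<close>.\<close>

lemma card_pairs_upper:
  assumes P: "sandwiched y P" and A: "compact A" and \<delta>: "\<delta> \<in> \<Gamma>"
  shows "card {x \<in> P \<inter> A. x + fst \<delta> \<in> P} \<le> card (y \<inter> (A \<times> window W (snd \<delta>)))"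
proof -
  have y: "y \<in> space mY" using P by (simp add: sandwiched_def)
  have "window W (snd \<delta>) \<subseteq> W" by (auto simp: window_def)
  then have fin: "finite (y \<inter> (A \<times> window W (snd \<delta>)))"
    using finite_coset_Times[OF y A subset_refl compact_W] by simp
  have "{x \<in> P \<inter> A. x + fst \<delta> \<in> P} \<subseteq> fst ` (y \<inter> (A \<times> window W (snd \<delta>)))"
  proof
    fix x assume x: "x \<in> {x \<in> P \<inter> A. x + fst \<delta> \<in> P}"
    obtain b where b: "b \<in> W" "(x, b) \<in> y" using P x by (auto simp: sandwiched_def slice_def)
    obtain b' where b': "b' \<in> W" "(x + fst \<delta>, b') \<in> y" using P x
      by (auto simp: sandwiched_def slice_def)
    have "(x + fst \<delta>, b + snd \<delta>) \<in> y" using coset_shift[OF y b(2) \<delta>] by (simp add: plus_prod_def)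
    then have "b' = b + snd \<delta>" using inj_fst_coset[OF y b'(2)] by simp
    then have "(x, b) \<in> y \<inter> (A \<times> window W (snd \<delta>))" using x b b' by (simp add: window_def)
    then show "x \<in> fst ` (y \<inter> (A \<times> window W (snd \<delta>)))" by force
  qed
  then show ?thesis using fin by (rule surj_card_le[rotated])
qed

lemma card_pairs_lower:
  assumes P: "sandwiched y P" and A: "compact A" and \<delta>: "\<delta> \<in> \<Gamma>"
  shows "card (y \<inter> (A \<times> window (interior W) (snd \<delta>))) \<le> card {x \<in> P \<inter> A. x + fst \<delta> \<in> P}"
proof -
  have y: "y \<in> space mY" using P by (simp add: sandwiched_def)
  have "inj_on fst (y \<inter> (A \<times> window (interior W) (snd \<delta>)))"
    using inj_fst_coset[OF y] by (auto simp: inj_on_def)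
  moreover have "fst ` (y \<inter> (A \<times> window (interior W) (snd \<delta>))) \<subseteq> {x \<in> P \<inter> A. x + fst \<delta> \<in> P}"
  proof
    fix x assume "x \<in> fst ` (y \<inter> (A \<times> window (interior W) (snd \<delta>)))"
    then obtain b where b: "(x, b) \<in> y" "x \<in> A" "b \<in> interior W" "b + snd \<delta> \<in> interior W"
      by (auto simp: window_def)
    have "(x + fst \<delta>, b + snd \<delta>) \<in> y" using coset_shift[OF y b(1) \<delta>] by (simp add: plus_prod_def)
    then show "x \<in> {x \<in> P \<inter> A. x + fst \<delta> \<in> P}" using b P by (auto simp: sandwiched_def slice_def)
  qed
  moreover have "finite {x \<in> P \<inter> A. x + fst \<delta> \<in> P}" using sandwiched_finite[OF P A]
    by (rule rev_finite_subset) auto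
  ultimately show ?thesis by (rule card_inj_on_le)
qed

lemma closed_W: "closed W" using compact_W by (rule compact_imp_closed)

text \<open>A point of \<open>window W h\<close> outside \<open>window (interior W) h\<close> lies
  in the frontier of \<open>W\<close> or in a right translate of that frontier. Right translation
  only rescales Haar measure, so both are null. The claims on frontiers and on the closure follow by
  trapping the relevant sets in this difference.\<close>

lemma window_null:
  shows "compact (window W h)" "window (interior W) h \<subseteq> window W h"
    "emeasure mH (window W h - window (interior W) h) = 0"
    "emeasure mH (frontier (window W h)) = 0" "emeasure mH (frontier (window (interior W) h)) = 0"
    "measure mH (closure (window (interior W) h)) = measure mH (window W h)"
proof -
  have cv: "closed ((\<lambda>w. w + h) -` W)" by (intro closed_vimage closed_W continuous_intros)
  have ov: "open ((\<lambda>w. w + h) -` interior W)" by (intro open_vimage open_interior continuous_intros)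
  show c: "compact (window W h)" unfolding window_def using compact_W cv
    by (rule compact_Int_closed)
  show sub: "window (interior W) h \<subseteq> window W h" using interior_subset[of W]
    by (auto simp: window_def)
  have o: "open (window (interior W) h)" unfolding window_def by (intro open_Int open_interior ov)
  obtain e where e: "\<And>A. A \<in> sets borel \<Longrightarrow> emeasure mH ((\<lambda>y. y + h) -` A) = e * emeasure mH A"
    using haar_right_translate[OF haar_H, of h] by metis
  have fW: "frontier W \<in> sets borel" by (intro borel_closed frontier_closed)
  have vf: "(\<lambda>w. w + h) -` frontier W \<in> sets borel"
    by (intro borel_closed closed_vimage frontier_closed continuous_intros)
  have n: "frontier W \<union> (\<lambda>w. w + h) -` frontier W \<in> null_sets mH"
    using fW vf frontier_W e[OF fW] by (intro null_sets.Un null_setsI) (auto simp: DH)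
  have null: "A \<in> null_sets mH" if "A \<subseteq> window W h - window (interior W) h" "A \<in> sets borel" for A
  proof (rule null_sets_subset[OF n])
    show "A \<in> sets mH" using that DH by simp
    have "W - interior W \<subseteq> frontier W" using closed_W by (simp add: frontier_def)
    then show "A \<subseteq> frontier W \<union> (\<lambda>w. w + h) -` frontier W" using that(1) by (auto simp: window_def)
  qed
  have b: "window W h \<in> sets borel" "window (interior W) h \<in> sets borel"
    using c o by (auto intro: borel_compact)
  show 0: "emeasure mH (window W h - window (interior W) h) = 0" using null[OF subset_refl] b
    by auto
  have clo: "closure (window (interior W) h) \<subseteq> window W h" "closure (window W h) = window W h"
    using sub c by (simp_all add: closure_minimal compact_imp_closed)
  have "window (interior W) h \<subseteq> interior (window W h)" using sub o by (rule interior_maximal)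
  then have "frontier (window W h) \<subseteq> window W h - window (interior W) h" using clo
    by (auto simp: frontier_def)
  then show "emeasure mH (frontier (window W h)) = 0"
    by (intro null_setsD1[OF null]) (auto intro: borel_closed frontier_closed)
  have "frontier (window (interior W) h) \<subseteq> window W h - window (interior W) h"
    using clo o by (auto simp: frontier_def interior_open)
  then show "emeasure mH (frontier (window (interior W) h)) = 0"
    by (intro null_setsD1[OF null]) (auto intro: borel_closed frontier_closed)
  have "window W h - closure (window (interior W) h) \<in> null_sets mH"
    using closure_subset[of "window (interior W) h"] b by (intro null) auto
  then have "emeasure mH (window W h \<union> closure (window (interior W) h))
      = emeasure mH (closure (window (interior W) h))"
    using emeasure_Un_null_set[of "closure (window (interior W) h)" mH
      "window W h - closure (window (interior W) h)"]
    by (simp add: DH Un_commute)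
  moreover have "window W h \<union> closure (window (interior W) h) = window W h" using clo by auto
  ultimately show "measure mH (closure (window (interior W) h)) = measure mH (window W h)"
    by (simp add: measure_def)
qed

lemma card_pairs_tendsto:
  assumes P: "sandwiched y P" and \<delta>: "\<delta> \<in> \<Gamma>"
  shows "((\<lambda>t. card {x \<in> P \<inter> F t. x + fst \<delta> \<in> P} / measure mG (F t))
    \<longlongrightarrow> dens * measure mH (window W (snd \<delta>))) at_top"
proof (rule tendsto_sandwich)
  have y: "y \<in> space mY" using P by (simp add: sandwiched_def)
  note w = window_null[of "snd \<delta>"]
  show "((\<lambda>t. card (y \<inter> (F t \<times> window (interior W) (snd \<delta>))) / measure mG (F t))
    \<longlongrightarrow> dens * measure mH (window W (snd \<delta>))) at_top"
    using card_box_tendsto[OF y w(2,1,5)] by (simp add: w(6))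
  show "((\<lambda>t. card (y \<inter> (F t \<times> window W (snd \<delta>))) / measure mG (F t))
    \<longlongrightarrow> dens * measure mH (window W (snd \<delta>))) at_top"
    using card_box_tendsto[OF y subset_refl w(1,4)] w(1) by (simp add: compact_imp_closed)
  show "\<forall>\<^sub>F t in at_top. card (y \<inter> (F t \<times> window (interior W) (snd \<delta>))) / measure mG (F t)
      \<le> card {x \<in> P \<inter> F t. x + fst \<delta> \<in> P} / measure mG (F t)"
    using eventually_gt_at_top[of "0::real"]
    by eventually_elim
      (rule divide_right_mono[OF of_nat_mono[OF card_pairs_lower[OF P F_compact \<delta>]] measure_nonneg])
  show "\<forall>\<^sub>F t in at_top. card {x \<in> P \<inter> F t. x + fst \<delta> \<in> P} / measure mG (F t)
      \<le> card (y \<inter> (F t \<times> window W (snd \<delta>))) / measure mG (F t)"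
    using eventually_gt_at_top[of "0::real"]
    by eventually_elim
      (rule divide_right_mono[OF of_nat_mono[OF card_pairs_upper[OF P F_compact \<delta>]] measure_nonneg])
qed

definition limit_autocorrelation :: "'g set \<Rightarrow> ('g \<Rightarrow> complex) \<Rightarrow> complex" where
  "limit_autocorrelation K f
    = (\<Sum>\<delta>\<in>diffs K. f (fst \<delta>) * complex_of_real (dens * measure mH (window W (snd \<delta>))))"

lemma sampled_autocorrelation_tendsto:
  assumes P: "sandwiched y P" and K: "compact K" "\<And>x. x \<notin> K \<Longrightarrow> f x = 0"
  shows "((\<lambda>t. sampled_autocorrelation mG P F t f) \<longlongrightarrow> limit_autocorrelation K f) at_top"
proof -
  have "((\<lambda>t. \<Sum>\<delta>\<in>diffs K. f (fst \<delta>) * complex_of_real (card {x \<in> P \<inter> F t. x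
    + fst \<delta> \<in> P} / measure mG (F t)))
      \<longlongrightarrow> limit_autocorrelation K f) at_top"
    unfolding limit_autocorrelation_def
    by (intro tendsto_sum tendsto_mult tendsto_const tendsto_of_real card_pairs_tendsto[OF P]) (simp
      add: diffs_def)
  moreover have "eventually (\<lambda>t. sampled_autocorrelation mG P F t f =
      (\<Sum>\<delta>\<in>diffs K. f (fst \<delta>) * complex_of_real (card {x \<in> P \<inter> F t. x
        + fst \<delta> \<in> P} / measure mG (F t)))) at_top"
    using eventually_gt_at_top[of "0::real"]
    by eventually_elim (rule sampled_autocorrelation_eq[OF P K])
  ultimately show ?thesis by (simp only: tendsto_cong)
qed

text \<open>The constant depends on neither the coset nor \<open>P\<close> nor \<open>t\<close>, as
  dominated convergence over the hull will require.\<close>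

lemma sampled_autocorrelation_bounded:
  fixes f :: "'g \<Rightarrow> complex"
  assumes K: "compact K" "\<And>x. x \<notin> K \<Longrightarrow> f x = 0"
  obtains C where "\<And>y P t. sandwiched y P \<Longrightarrow> t > 0 \<Longrightarrow> cmod (sampled_autocorrelation mG P F t f) \<le> C"
proof -
  obtain C where C: "\<And>y t. y \<in> space mY \<Longrightarrow> t > 0 \<Longrightarrow> card (y \<inter> (F t \<times> W)) \<le> C * measure mG (F t)"
    using card_box_bounded[OF compact_W] by metis
  have "cmod (sampled_autocorrelation mG P F t f) \<le> (\<Sum>\<delta>\<in>diffs K. cmod (f (fst \<delta>)) * C)"
    if P: "sandwiched y P" and t: "t > 0" for y P t
  proof -
    have y: "y \<in> space mY" using P by (simp add: sandwiched_def)
    have m: "measure mG (F t) > 0" by (rule F_measure_pos[OF t])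
    have b: "card {x \<in> P \<inter> F t. x + fst \<delta> \<in> P} / measure mG (F t) \<le> C" if \<delta>: "\<delta> \<in> diffs K" for \<delta>
    proof -
      have "card {x \<in> P \<inter> F t. x + fst \<delta> \<in> P} \<le> card (y \<inter> (F t \<times> window W (snd \<delta>)))"
        using \<delta> by (intro card_pairs_upper[OF P F_compact[OF t]]) (simp add: diffs_def)
      also have "\<dots> \<le> card (y \<inter> (F t \<times> W))"
        using finite_coset_Times[OF y F_compact[OF t] subset_refl compact_W subset_refl]
        by (intro card_mono) (auto simp: window_def)
      finally have "real (card {x \<in> P \<inter> F t. x + fst \<delta> \<in> P}) \<le> C * measure mG (F t)"
        using C[OF y t] by linarith
      then show ?thesis using m by (simp add: pos_divide_le_eq)
    qed
    have "cmod (sampled_autocorrelation mG P F t f)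
        \<le> (\<Sum>\<delta>\<in>diffs K. cmod (f (fst \<delta>) * complex_of_real (card {x \<in> P \<inter> F t. x
          + fst \<delta> \<in> P} / measure mG (F t))))"
      by (subst sampled_autocorrelation_eq[OF P K t]) (auto intro: norm_sum)
    also have "\<dots> \<le> (\<Sum>\<delta>\<in>diffs K. cmod (f (fst \<delta>)) * C)"
      using b m unfolding norm_mult norm_of_real by (intro sum_mono mult_left_mono) auto
    finally show ?thesis .
  qed
  then show ?thesis using that by blast
qed

end

subsection \<open>Compactly supported test functions\<close>

text \<open>Real and nonnegative, so that nonnegative integrals and monotone limits apply; complex
  test functions are assembled from these at the end.\<close>

definition bump :: "('a::topological_space \<Rightarrow> real) \<Rightarrow> bool" where
  "bump u \<longleftrightarrow> continuous_on UNIV u \<and> (\<forall>x. 0 \<le> u x) \<and> (\<exists>K. compact K \<and> (\<forall>x. x \<notin> K \<longrightarrow> u x = 0))"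

lemma bumpD:
  assumes "bump u"
  shows "continuous_on UNIV u" "0 \<le> u x"
  using assms by (simp_all add: bump_def)

lemma bump_support:
  assumes "bump u"
  obtains K where "compact K" "\<And>x. x \<notin> K \<Longrightarrow> u x = 0"
  using assms unfolding bump_def by (elim conjE exE) (rule that, auto)

lemma continuous_bounded_support:
  fixes f :: "'a::topological_space \<Rightarrow> 'b::real_normed_vector"
  assumes "continuous_on UNIV f" "compact K" "\<And>x. x \<notin> K \<Longrightarrow> f x = 0"
  obtains C where "0 \<le> C" "\<And>x. norm (f x) \<le> C"
proof -
  have "bounded (f ` K)"
    using assms by (intro compact_imp_bounded compact_continuous_image) (auto intro:
      continuous_on_subset)
  then obtain C where C: "\<And>x. x \<in> K \<Longrightarrow> norm (f x) \<le> C" by (auto simp: bounded_iff)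
  have "norm (f x) \<le> max C 0" for x
    using C[of x] assms(3)[of x] by (cases "x \<in> K") auto
  then show ?thesis using that[of "max C 0"] by simp
qed

lemma bump_bounded:
  assumes "bump u"
  obtains C where "0 \<le> C" "\<And>x. u x \<le> C"
proof -
  obtain K where K: "compact K" "\<And>x. x \<notin> K \<Longrightarrow> u x = 0" using assms by (rule bump_support) blast
  obtain C where "0 \<le> C" "\<And>x. norm (u x) \<le> C"
    using continuous_bounded_support[OF bumpD(1)[OF assms] K] by metis
  then have "\<And>x. u x \<le> C" using bumpD(2)[OF assms] by simp
  then show ?thesis using that \<open>0 \<le> C\<close> by blast
qed

lemma bump_add: assumes "bump u" "bump v" shows "bump (\<lambda>x. u x + v x)"
proof -
  obtain K where K: "compact K" "\<And>x. x \<notin> K \<Longrightarrow> u x = 0" using assms(1) by (rule bump_support) blast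
  obtain L where L: "compact L" "\<And>x. x \<notin> L \<Longrightarrow> v x = 0" using assms(2) by (rule bump_support) blast
  have "compact (K \<union> L)" "\<forall>x. x \<notin> K \<union> L \<longrightarrow> u x + v x = 0" using K L by auto
  moreover have "continuous_on UNIV (\<lambda>x. u x + v x)" using assms by (intro continuous_on_add bumpD)
  ultimately show ?thesis unfolding bump_def using assms by (auto simp: bumpD)
qed

lemma Cc_I:
  fixes f :: "'a::t2_space \<Rightarrow> complex"
  assumes "continuous_on UNIV f" "compact K" "\<And>x. x \<notin> K \<Longrightarrow> f x = 0"
  shows "f \<in> Cc"
proof -
  have "{x. f x \<noteq> 0} \<subseteq> K" using assms(3) by auto
  then have "closure {x. f x \<noteq> 0} \<subseteq> K" using assms(2)
    by (simp add: closure_minimal compact_imp_closed)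
  then have "compact (closure {x. f x \<noteq> 0})"
    using compact_Int_closed[OF assms(2) closed_closure[of "{x. f x \<noteq> 0}"]]
      by (simp add: Int_absorb1)
  then show ?thesis using assms(1) by (simp add: Cc_def)
qed

lemma bump_complex_Cc:
  fixes u v :: "'a::t2_space \<Rightarrow> real"
  assumes "bump u" "bump v"
  shows "(\<lambda>x. complex_of_real (u x) + c * complex_of_real (v x)) \<in> Cc"
proof -
  obtain K where K: "compact K" "\<And>x. x \<notin> K \<Longrightarrow> u x = 0" using assms(1) by (rule bump_support) blast
  obtain L where L: "compact L" "\<And>x. x \<notin> L \<Longrightarrow> v x = 0" using assms(2) by (rule bump_support) blast
  show ?thesis
  proof (rule Cc_I)
    show "continuous_on UNIV (\<lambda>x. complex_of_real (u x) + c * complex_of_real (v x))"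
      using assms by (intro continuous_intros bumpD)
    show "compact (K \<union> L)" using K L by auto
  qed (use K L in auto)
qed

lemma Cc_support:
  assumes "f \<in> Cc"
  shows "continuous_on UNIV f" "compact (closure {x. f x \<noteq> 0})" "x \<notin> closure {x. f x \<noteq> 0} \<Longrightarrow> f x = 0"
  using assms closure_subset[of "{x. f x \<noteq> 0}"] by (auto simp: Cc_def)

lemma radon_integrable:
  fixes f :: "'a::lcsc_group_add \<Rightarrow> 'b::{banach, second_countable_topology}"
  assumes m: "radon_measure m" and f: "f \<in> borel_measurable borel"
    and K: "compact K" "\<And>x. x \<notin> K \<Longrightarrow> f x = 0" and C: "\<And>x. norm (f x) \<le> C"
  shows "integrable m f"
proof -
  have s: "sets m = sets borel" using m by (simp add: radon_measure_def)
  have fin: "emeasure m K < \<infinity>" using m K by (simp add: radon_measure_def)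
  have "integrable m (\<lambda>x. C * indicator K x)"
    using K fin s by (intro integrable_mult_right) (auto simp: borel_compact)
  moreover have "f \<in> borel_measurable m" using f measurable_cong_sets[OF s refl] by blast
  moreover have "AE x in m. norm (f x) \<le> norm (C * indicator K x)"
  proof (rule AE_I2)
    show "norm (f x) \<le> norm (C * indicator K x)" for x
      using K(2)[of x] C[of x] by (cases "x \<in> K") (auto intro: order_trans)
  qed
  ultimately show ?thesis by (rule Bochner_Integration.integrable_bound)
qed

lemma radon_integrable_continuous:
  fixes f :: "'a::lcsc_group_add \<Rightarrow> 'b::{banach, second_countable_topology}"
  assumes m: "radon_measure m" and f: "continuous_on UNIV f" and K: "compact K" "\<And>x. x \<notin> K \<Longrightarrow> f x
    = 0"
  shows "integrable m f"
proof -
  obtain C where "\<And>x. norm (f x) \<le> C" using continuous_bounded_support[OF f K] by metis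
  then show ?thesis using radon_integrable[OF m borel_measurable_continuous_onI[OF f] K] by blast
qed

lemma bump_measurable: "bump u \<Longrightarrow> u \<in> borel_measurable borel"
  by (intro borel_measurable_continuous_onI bumpD)

context sampling
begin

lemma d_triangle: "d x z \<le> d x y + d y z"
  by (rule metric.triangle) simp_all

text \<open>\<open>d\<close> is a parameter and not the metric of a type class, so continuity goes
  through the openness of its balls.\<close>

lemma lipschitz_continuous:
  assumes "\<And>x y. \<bar>h x - h y\<bar> \<le> d x y"
  shows "continuous_on UNIV (h :: 'g \<Rightarrow> real)"
  unfolding continuous_on_def
proof (intro ballI tendstoI)
  fix x e assume e: "(0::real) < e"
  have "eventually (\<lambda>y. y \<in> {y. d x y < e}) (nhds x)"
    using e by (intro eventually_nhds_in_open open_ball) simp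
  then have "eventually (\<lambda>y. dist (h y) (h x) < e) (nhds x)"
  proof eventually_elim
    case (elim y)
    then show ?case using assms[of x y] by (simp add: dist_real_def abs_minus_commute)
  qed
  then show "eventually (\<lambda>y. dist (h y) (h x) < e) (at x within UNIV)"
    unfolding eventually_at_filter by (rule eventually_mono) simp
qed

text \<open>A truncated distance to the complement of \<open>U\<close>, scaled by \<open>n\<close>
  and capped at 1, increases to the indicator; a cutoff in \<open>d 0 x\<close> adds compact support
  because the metric is proper.\<close>

lemma open_indicator_approx:
  assumes U: "open (U :: 'g set)"
  obtains u :: "nat \<Rightarrow> 'g \<Rightarrow> real" where "\<And>n. bump (u n)" "\<And>x. incseq (\<lambda>n. u n x)"
    "\<And>x. (\<lambda>n. u n x) \<longlonglongrightarrow> indicator U x"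
proof -
  \<comment> \<open>The element 1 keeps the set nonempty, so that its infimum makes sense when
    \<open>U\<close> is everything.\<close>
  define S where "S x = insert 1 (d x ` (- U))" for x
  define h where "h x = Inf (S x)" for x
  have bdd: "bdd_below (S x)" for x by (intro bdd_belowI[of _ 0]) (auto simp: S_def)
  have ne: "S x \<noteq> {}" for x by (simp add: S_def)
  have lip1: "h x - d x y \<le> h y" for x y
    unfolding h_def[of y]
  proof (rule cInf_greatest[OF ne])
    fix e assume "e \<in> S y"
    then consider "e = 1" | z where "z \<notin> U" "e = d y z" by (auto simp: S_def)
    then show "h x - d x y \<le> e"
    proof cases
      case 1
      have "h x \<le> 1" unfolding h_def by (rule cInf_lower[OF _ bdd]) (simp add: S_def)
      then show ?thesis using 1 metric.nonneg[of x y] by linarith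
    next
      case 2
      have "h x \<le> d x z" unfolding h_def by (rule cInf_lower[OF _ bdd]) (use 2 in \<open>simp add: S_def\<close>)
      then show ?thesis using 2 d_triangle[of x z y] by linarith
    qed
  qed
  have ch: "continuous_on UNIV h"
  proof (rule lipschitz_continuous)
    show "\<bar>h x - h y\<bar> \<le> d x y" for x y using lip1[of x y] lip1[of y x] metric.commute[of x y]
      by linarith
  qed
  have cd: "continuous_on UNIV (\<lambda>x. d 0 x)"
  proof (rule lipschitz_continuous)
    show "\<bar>d 0 x - d 0 y\<bar> \<le> d x y" for x y
      using d_triangle[of 0 x y] d_triangle[of 0 y x] metric.commute[of x y] by linarith
  qed
  have h0: "0 \<le> h x" for x unfolding h_def by (rule cInf_greatest[OF ne]) (auto simp: S_def)
  have hU: "h x > 0" if x: "x \<in> U" for x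
  proof -
    have "openin metric.mtopology U" using U adm by (simp add: admissible_metric_def)
    then obtain r where r: "r > 0" "metric.mball x r \<subseteq> U" using x
      by (auto simp: metric.openin_mtopology)
    have "min 1 r \<le> h x" unfolding h_def
    proof (rule cInf_greatest[OF ne])
      fix e assume "e \<in> S x"
      then consider "e = 1" | z where "z \<notin> U" "e = d x z" by (auto simp: S_def)
      then show "min 1 r \<le> e"
      proof cases
        case 2
        then have "z \<notin> metric.mball x r" using r by auto
        then show ?thesis using 2 by (simp add: metric.in_mball)
      qed simp
    qed
    then show ?thesis using r by linarith
  qed
  have hnU: "h x = 0" if "x \<notin> U" for x
  proof -
    have "h x \<le> d x x" unfolding h_def
      by (rule cInf_lower[OF _ bdd]) (use that in \<open>simp add: S_def\<close>)
    then show ?thesis using h0[of x] by simp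
  qed
  define p where "p n x = min 1 (real n * h x)" for n x
  define q where "q n x = max 0 (min 1 (real n + 1 - d 0 x))" for n x
  have pn: "0 \<le> p n x" and qn: "0 \<le> q n x" for n x using h0[of x] by (simp_all add: p_def q_def)
  show ?thesis
  proof (rule that[of "\<lambda>n x. p n x * q n x"])
    show "bump (\<lambda>x. p n x * q n x)" for n
      unfolding bump_def
    proof (intro conjI allI exI impI)
      show "continuous_on UNIV (\<lambda>x. p n x * q n x)"
        unfolding p_def q_def by (intro continuous_intros ch cd)
      show "0 \<le> p n x * q n x" for x using pn qn by simp
      show "compact {x. d 0 x \<le> real n + 1}" by (rule compact_cball)
      show "p n x * q n x = 0" if "x \<notin> {x. d 0 x \<le> real n + 1}" for x using that
        by (simp add: q_def)
    qed
    show "incseq (\<lambda>n. p n x * q n x)" for x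
    proof (rule incseq_SucI)
      fix n
      have "real n * h x \<le> real (Suc n) * h x" using h0[of x] by (intro mult_right_mono) auto
      then have "p n x \<le> p (Suc n) x" unfolding p_def by linarith
      moreover have "q n x \<le> q (Suc n) x" unfolding q_def by simp
      ultimately show "p n x * q n x \<le> p (Suc n) x * q (Suc n) x" using pn qn by (intro mult_mono)
    qed
    show "(\<lambda>n. p n x * q n x) \<longlonglongrightarrow> indicator U x" for x
    proof (cases "x \<in> U")
      case True
      have "eventually (\<lambda>n. p n x * q n x = 1) sequentially"
        using eventually_ge_at_top[of "nat \<lceil>1 / h x\<rceil>"] eventually_ge_at_top[of "nat \<lceil>d 0 x\<rceil>"]
      proof eventually_elim
        case (elim n)
        have "1 / h x \<le> real n" "d 0 x \<le> real n" using elim by linarith+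
        then have "p n x = 1" "q n x = 1"
          using hU[OF True] by (simp_all add: p_def q_def pos_divide_le_eq)
        then show ?case by simp
      qed
      then show ?thesis using True by (simp add: tendsto_eventually)
    next
      case False
      then show ?thesis by (simp add: p_def hnU)
    qed
  qed
qed

end

text \<open>Monotone convergence. Two measures that agree on all products of two bumps thereby agree
  on open boxes.\<close>

lemma nn_integral_double_approx:
  fixes N :: "('a::lcsc_group_add \<times> 'a) measure"
  assumes N: "sets N = sets borel"
    and u: "\<And>n. bump (u n)" "\<And>x. incseq (\<lambda>n. u n x)" "\<And>x. (\<lambda>n. u n x) \<longlonglongrightarrow> indicator U x"
    and v: "\<And>n. bump (v n)" "\<And>x. incseq (\<lambda>n. v n x)" "\<And>x. (\<lambda>n. v n x) \<longlonglongrightarrow> indicator V x"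
    and UV: "open U" "open V"
  shows "(\<lambda>n. \<integral>\<^sup>+p. ennreal (u n (fst p) * v n (snd p)) \<partial>N) \<longlonglongrightarrow> emeasure N (U \<times> V)"
proof -
  have "(\<lambda>n. \<integral>\<^sup>+p. ennreal (u n (fst p) * v n (snd p)) \<partial>N)
    \<longlonglongrightarrow> (\<integral>\<^sup>+p. ennreal (indicator U (fst p) * indicator V (snd p)) \<partial>N)"
  proof (rule nn_integral_LIMSEQ)
    show "incseq (\<lambda>n p. ennreal (u n (fst p) * v n (snd p)))"
      using u(2) v(2) bumpD(2)[OF u(1)] bumpD(2)[OF v(1)]
      by (auto simp: incseq_def le_fun_def intro!: ennreal_leI mult_mono)
    show "(\<lambda>p. ennreal (u n (fst p) * v n (snd p))) \<in> borel_measurable N" for n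
    proof -
      have "continuous_on UNIV (\<lambda>p. u n (fst p) * v n (snd p))"
        by (intro continuous_on_mult continuous_on_compose2[OF bumpD(1)[OF u(1)]
          continuous_on_fst[OF continuous_on_id]]
            continuous_on_compose2[OF bumpD(1)[OF v(1)] continuous_on_snd[OF continuous_on_id]])
              auto
      then have "(\<lambda>p. u n (fst p) * v n (snd p)) \<in> borel_measurable borel"
        by (rule borel_measurable_continuous_onI)
      then have "(\<lambda>p. u n (fst p) * v n (snd p)) \<in> borel_measurable N"
        using measurable_cong_sets[OF N refl] by blast
      then show ?thesis by measurable
    qed
    show "(\<lambda>n. ennreal (u n (fst p) * v n (snd p)))
      \<longlonglongrightarrow> ennreal (indicator U (fst p) * indicator V (snd p))" for p
      by (intro tendsto_ennrealI tendsto_mult u v)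
  qed
  also have "(\<integral>\<^sup>+p. ennreal (indicator U (fst p) * indicator V (snd p)) \<partial>N)
    = (\<integral>\<^sup>+p. indicator (U \<times> V) p \<partial>N)"
    by (intro nn_integral_cong) (auto simp: indicator_def)
  also have "\<dots> = emeasure N (U \<times> V)"
    using UV N by (intro nn_integral_indicator) (simp add: open_Times borel_open)
  finally show ?thesis .
qed

lemma sets_borel_open_Times:
  "sets (borel :: ('a::second_countable_topology \<times> 'b::second_countable_topology) measure)
    = sigma_sets UNIV {U \<times> V |U V. open U \<and> open V}"
proof -
  have "sets (borel \<Otimes>\<^sub>M borel) = sets (sigma (space borel \<times> space borel)
      {a \<times> b |a b. a \<in> {U. open (U :: 'a set)} \<and> b \<in> {V. open (V :: 'b set)}})"
    by (rule sets_pair_eq[where Ca = "{UNIV}" and Cb = "{UNIV}"]) (auto simp: borel_def)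
  then show ?thesis unfolding borel_prod by (simp add: sets_measure_of)
qed

subsection \<open>Identification of the autocorrelation\<close>

locale autocorrelated = model \<Gamma> mY mG mH d F W
  for \<Gamma> :: "('g::lcsc_group_add \<times> 'h::lcsc_group_add) set" and mY mG mH d F W +
  fixes \<nu> :: "'g set measure" and \<eta> :: "'g measure"
  assumes inv_\<nu>: "invariant_prob (punctured_hull_top (slice \<Gamma> W)) \<nu>"
    and autocorr: "autocorrelation mG \<nu> \<eta>"
begin

sublocale nu: prob_space \<nu>
  using inv_\<nu> by (simp add: invariant_prob_def)

lemma topspace_hull: "topspace (punctured_hull_top (slice \<Gamma> W)) = trans_hull (slice \<Gamma> W) - {{}}"
  unfolding punctured_hull_top_def topspace_subtopology trans_hull_def
  using closure_of_subset_topspace by (rule Int_absorb1[OF order.trans[OF Diff_subset]])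

lemma space_nu: "space \<nu> = trans_hull (slice \<Gamma> W) - {{}}"
proof -
  have "space \<nu> = space (borel_of (punctured_hull_top (slice \<Gamma> W)))"
    using inv_\<nu> by (intro sets_eq_imp_space_eq) (simp add: invariant_prob_def)
  then show ?thesis by (simp add: borel_of_def topspace_hull space_measure_of_conv)
qed

lemma openin_sets_nu:
  assumes "openin chabauty_fell T"
  shows "{P \<in> space \<nu>. P \<in> T} \<in> sets \<nu>"
proof -
  let ?X = "punctured_hull_top (slice \<Gamma> W)"
  have "openin ?X (T \<inter> (trans_hull (slice \<Gamma> W) - {{}}))"
    unfolding punctured_hull_top_def openin_subtopology using assms by auto
  moreover have "T \<inter> (trans_hull (slice \<Gamma> W) - {{}}) = {P \<in> space \<nu>. P \<in> T}"
    by (auto simp: space_nu)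
  ultimately have "{P \<in> space \<nu>. P \<in> T} \<in> {U. openin ?X U}" by simp
  moreover have "{U. openin ?X U} \<subseteq> Pow (topspace ?X)" using openin_subset by auto
  ultimately have "{P \<in> space \<nu>. P \<in> T} \<in> sets (borel_of ?X)"
    unfolding borel_of_def by (simp add: sets_measure_of sigma_sets.Basic)
  then show ?thesis using inv_\<nu> by (simp add: invariant_prob_def)
qed

lemma hull_sandwiched:
  assumes "P \<in> space \<nu>"
  obtains y where "sandwiched y P"
proof -
  have "P \<in> trans_hull (slice \<Gamma> W)" "P \<noteq> {}" using assms by (simp_all add: space_nu)
  then obtain y where "y \<in> space mY" "slice y (interior W) \<subseteq> P" "P \<subseteq> slice y W"
    by (rule hull_sandwich[OF compact_W])
  then show ?thesis using that[of y] by (simp add: sandwiched_def)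
qed

lemma hull_closed: "P \<in> space \<nu> \<Longrightarrow> closed P"
proof -
  assume "P \<in> space \<nu>"
  then have "P \<in> chabauty_fell closure_of (range (\<lambda>g. translate g (slice \<Gamma> W)))"
    by (simp add: space_nu trans_hull_def)
  then have "P \<in> topspace chabauty_fell" by (rule subsetD[OF closure_of_subset_topspace])
  then show ?thesis by (simp add: topspace_chabauty_fell)
qed

lemma hull_finite: "P \<in> space \<nu> \<Longrightarrow> compact K \<Longrightarrow> finite (P \<inter> K)"
  by (erule hull_sandwiched) (rule sandwiched_finite)

lemma hull_card_bound:
  assumes K: "compact K"
  obtains n where "\<And>P. P \<in> space \<nu> \<Longrightarrow> card (P \<inter> K) \<le> n"
proof -
  obtain n where n: "\<And>x. finite (left_coset \<Gamma> x \<inter> (K \<times> W))" "\<And>x. card (left_coset \<Gamma> x \<inter> (K \<times> W))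
    \<le> n"
    using card_coset_bound[OF compact_Times[OF K compact_W]] by metis
  have "card (P \<inter> K) \<le> n" if "P \<in> space \<nu>" for P
    using that
  proof (rule hull_sandwiched)
    fix y assume y: "sandwiched y P"
    then obtain x where x: "y = left_coset \<Gamma> x" by (auto simp: sandwiched_def space_mY)
    have "P \<inter> K \<subseteq> fst ` (left_coset \<Gamma> x \<inter> (K \<times> W))"
      using y unfolding x by (force simp: sandwiched_def slice_def)
    then have "card (P \<inter> K) \<le> card (left_coset \<Gamma> x \<inter> (K \<times> W))" by (rule surj_card_le[OF n(1)])
    then show ?thesis using n(2)[of x] by simp
  qed
  then show ?thesis using that by blast
qed

text \<open>\<open>P \<times> P\<close> meets \<open>V\<close> iff \<open>V\<close> contains an open
  box \<open>A \<times> B\<close> with both sides hit by \<open>P\<close>, and hitting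
  \<open>A\<close> and \<open>B\<close> is an open event in the Fell topology.\<close>

sublocale pairs: random_set \<nu> "\<lambda>P. P \<times> P" "exhaustion :: nat \<Rightarrow> ('g \<times> 'g) set"
proof
  fix V :: "('g \<times> 'g) set" assume V: "open V"
  define T where "T = (\<Union>(A, B)\<in>{(A, B). open A \<and> open B \<and> A \<times> B \<subseteq> V}.
    {C. closed C \<and> C \<inter> A \<noteq> {}} \<inter> {C. closed C \<and> C \<inter> B \<noteq> {}})"
  have "openin chabauty_fell T"
    unfolding T_def by (intro openin_Union) (auto intro!: openin_Int openin_chabauty_hit)
  then have "{P \<in> space \<nu>. P \<in> T} \<in> sets \<nu>" by (rule openin_sets_nu)
  moreover have "{P \<in> space \<nu>. P \<in> T} = {P \<in> space \<nu>. P \<times> P \<inter> V \<noteq> {}}"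
  proof (intro Collect_cong conj_cong refl iffI)
    fix P assume "P \<in> T"
    then obtain A B x y where "A \<times> B \<subseteq> V" "x \<in> P \<inter> A" "y \<in> P \<inter> B" by (auto simp: T_def)
    then have "(x, y) \<in> P \<times> P \<inter> V" by auto
    then show "P \<times> P \<inter> V \<noteq> {}" by blast
  next
    fix P assume P: "P \<in> space \<nu>" "P \<times> P \<inter> V \<noteq> {}"
    then obtain x y where xy: "x \<in> P" "y \<in> P" "(x, y) \<in> V" by auto
    obtain A B where "open A" "open B" "(x, y) \<in> A \<times> B" "A \<times> B \<subseteq> V"
      using V xy(3) by (rule open_prod_elim)
    then show "P \<in> T" using xy hull_closed[OF P(1)] by (auto simp: T_def)
  qed
  ultimately show "{P \<in> space \<nu>. P \<times> P \<inter> V \<noteq> {}} \<in> sets \<nu>" by simp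
next
  fix P n assume P: "P \<in> space \<nu>"
  obtain K where K: "compact K" "(exhaustion n :: ('g \<times> 'g) set) \<subseteq> K" using exhaustion(2)[of n]
    by auto
  have "compact (fst ` K)" "compact (snd ` K)"
    using K(1) by (auto intro!: compact_continuous_image continuous_on_fst continuous_on_snd
      continuous_on_id)
  then have "finite ((P \<inter> fst ` K) \<times> (P \<inter> snd ` K))" using hull_finite[OF P] by simp
  moreover have "P \<times> P \<inter> exhaustion n \<subseteq> (P \<inter> fst ` K) \<times> (P \<inter> snd ` K)"
    using K(2) by force
  ultimately show "finite (P \<times> P \<inter> exhaustion n)" by (rule rev_finite_subset)
qed (rule exhaustion(1) exhaustion(3) exhaustion(4))+

section \<open>Periodizations of bumps and their inner products\<close>

definition point_sum :: "('g \<Rightarrow> real) \<Rightarrow> 'g set \<Rightarrow> real" where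
  "point_sum u P = (\<Sum>\<^sub>\<infinity>x\<in>P. u x)"

lemma infsum_finite_support:
  fixes f :: "'g \<Rightarrow> 'b::{comm_monoid_add, t2_space}"
  assumes "finite (P \<inter> K)" "\<And>x. x \<notin> K \<Longrightarrow> f x = 0"
  shows "(\<Sum>\<^sub>\<infinity>x\<in>P. f x) = (\<Sum>x\<in>P \<inter> K. f x)"
proof -
  have "(\<Sum>\<^sub>\<infinity>x\<in>P. f x) = (\<Sum>\<^sub>\<infinity>x\<in>P \<inter> K. f x)"
    using assms(2) by (intro infsum_cong_neutral) auto
  then show ?thesis using assms(1) by simp
qed

lemma point_sum_eq:
  assumes "P \<in> space \<nu>" "compact K" "\<And>x. x \<notin> K \<Longrightarrow> u x = 0"
  shows "point_sum u P = (\<Sum>x\<in>P \<inter> K. u x)"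
  unfolding point_sum_def using hull_finite[OF assms(1,2)] assms(3) by (rule infsum_finite_support)

lemma point_sum_nonneg: "bump u \<Longrightarrow> 0 \<le> point_sum u P"
  unfolding point_sum_def by (intro infsum_nonneg bumpD)

lemma point_sum_bounded:
  assumes u: "bump u"
  obtains C where "\<And>P. P \<in> space \<nu> \<Longrightarrow> point_sum u P \<le> C"
proof -
  obtain K where K: "compact K" "\<And>x. x \<notin> K \<Longrightarrow> u x = 0" using u by (rule bump_support) blast
  obtain c where c: "0 \<le> c" "\<And>x. u x \<le> c" using u by (rule bump_bounded) blast
  obtain n where n: "\<And>P. P \<in> space \<nu> \<Longrightarrow> card (P \<inter> K) \<le> n" using hull_card_bound[OF K(1)] by blast
  have "point_sum u P \<le> real n * c" if P: "P \<in> space \<nu>" for P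
  proof -
    have "point_sum u P = (\<Sum>x\<in>P \<inter> K. u x)" by (rule point_sum_eq[OF P K])
    also have "\<dots> \<le> (\<Sum>x\<in>P \<inter> K. c)" by (intro sum_mono c)
    also have "\<dots> \<le> real n * c" using n[OF P] c by (simp add: mult_right_mono)
    finally show ?thesis .
  qed
  then show ?thesis using that by blast
qed

lemma point_sum_add:
  assumes u: "bump u" and v: "bump v" and P: "P \<in> space \<nu>"
  shows "point_sum (\<lambda>x. u x + v x) P = point_sum u P + point_sum v P"
proof -
  obtain K where K: "compact K" "\<And>x. x \<notin> K \<Longrightarrow> u x = 0" using u by (rule bump_support) blast
  obtain L where L: "compact L" "\<And>x. x \<notin> L \<Longrightarrow> v x = 0" using v by (rule bump_support) blast
  have KL: "compact (K \<union> L)" using K L by auto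
  have "point_sum (\<lambda>x. u x + v x) P = (\<Sum>x\<in>P \<inter> (K \<union> L). u x + v x)"
    by (rule point_sum_eq[OF P KL]) (use K L in auto)
  moreover have "point_sum u P = (\<Sum>x\<in>P \<inter> (K \<union> L). u x)" "point_sum v P = (\<Sum>x\<in>P \<inter> (K \<union> L). v x)"
    by (rule point_sum_eq[OF P KL]; use K L in auto)+
  ultimately show ?thesis by (simp add: sum.distrib)
qed

lemma cmod_periodization:
  assumes u: "bump u" and P: "P \<in> space \<nu>"
  shows "(cmod (periodization (\<lambda>x. complex_of_real (u x)) P))\<^sup>2 = point_sum u P * point_sum u P"
proof -
  obtain K where K: "compact K" "\<And>x. x \<notin> K \<Longrightarrow> u x = 0" using u by (rule bump_support) blast
  have "periodization (\<lambda>x. complex_of_real (u x)) P = (\<Sum>x\<in>P \<inter> K. complex_of_real (u x))"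
    unfolding periodization_def using K by (intro infsum_finite_support hull_finite[OF P]) auto
  also have "\<dots> = complex_of_real (point_sum u P)" by (simp add: point_sum_eq[OF P K])
  finally show ?thesis by (simp add: power2_eq_square)
qed

lemma nn_integral_pairs_finite:
  fixes f :: "'g \<Rightarrow> 'g \<Rightarrow> real"
  assumes P: "P \<in> space \<nu>" and K: "compact K" and L: "compact L" and nn: "\<And>x y. 0 \<le> f x y"
    and z: "\<And>x y. x \<notin> K \<or> y \<notin> L \<Longrightarrow> f x y = 0"
  shows "(\<integral>\<^sup>+p. ennreal (f (fst p) (snd p)) \<partial>count_space (P \<times> P))
    = ennreal (\<Sum>x\<in>P \<inter> K. \<Sum>y\<in>P \<inter> L. f x y)"
proof -
  have fin: "finite (P \<inter> K)" "finite (P \<inter> L)" using hull_finite[OF P] K L by auto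
  have "f (fst p) (snd p) = 0" if "p \<in> P \<times> P" "p \<notin> (P \<inter> K) \<times> (P \<inter> L)" for p
    using that by (intro z) (auto simp: mem_Times_iff)
  then have "(\<integral>\<^sup>+p. ennreal (f (fst p) (snd p)) \<partial>count_space (P \<times> P))
      = (\<Sum>p\<in>(P \<inter> K) \<times> (P \<inter> L). ennreal (f (fst p) (snd p)))"
    using fin by (intro nn_integral_count_space') auto
  also have "\<dots> = ennreal (\<Sum>p\<in>(P \<inter> K) \<times> (P \<inter> L). f (fst p) (snd p))" using nn by (intro sum_ennreal)
  also have "(\<Sum>p\<in>(P \<inter> K) \<times> (P \<inter> L). f (fst p) (snd p)) = (\<Sum>x\<in>P \<inter> K. \<Sum>y\<in>P \<inter> L. f x y)"
    by (simp add: sum.cartesian_product case_prod_beta)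
  finally show ?thesis .
qed

lemma nn_integral_pairs_bump:
  assumes u: "bump u" and v: "bump v" and P: "P \<in> space \<nu>"
  shows "(\<integral>\<^sup>+p. ennreal (u (fst p) * v (snd p)) \<partial>count_space (P \<times> P))
    = ennreal (point_sum u P * point_sum v P)"
proof -
  obtain K where K: "compact K" "\<And>x. x \<notin> K \<Longrightarrow> u x = 0" using u by (rule bump_support) blast
  obtain L where L: "compact L" "\<And>x. x \<notin> L \<Longrightarrow> v x = 0" using v by (rule bump_support) blast
  have "(\<integral>\<^sup>+p. ennreal (u (fst p) * v (snd p)) \<partial>count_space (P \<times> P))
    = ennreal (\<Sum>x\<in>P \<inter> K. \<Sum>y\<in>P \<inter> L. u x * v y)"
    using K L bumpD(2)[OF u] bumpD(2)[OF v] by (intro nn_integral_pairs_finite P) auto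
  then show ?thesis by (simp add: point_sum_eq[OF P K] point_sum_eq[OF P L] sum_product)
qed

lemma bump_pair_measurable:
  assumes u: "bump (u :: 'g \<Rightarrow> real)" and v: "bump (v :: 'g \<Rightarrow> real)"
  shows "(\<lambda>p. ennreal (u (fst p) * v (snd p))) \<in> borel_measurable borel"
proof -
  have [measurable]: "u \<in> borel_measurable borel" "v \<in> borel_measurable borel"
    using u v by (simp_all add: bump_measurable)
  have "(\<lambda>p. ennreal (u (fst p) * v (snd p))) \<in> borel_measurable (borel \<Otimes>\<^sub>M borel)" by measurable
  then show ?thesis unfolding borel_prod .
qed

lemma point_sum_measurable:
  assumes u: "bump u" and v: "bump v"
  shows "(\<lambda>P. point_sum u P * point_sum v P) \<in> borel_measurable \<nu>"
proof -
  have "(\<lambda>P. enn2real (\<integral>\<^sup>+p. ennreal (u (fst p) * v (snd p)) \<partial>count_space (P \<times> P))) \<in>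
    borel_measurable \<nu>"
    using pairs.nn_integral_point_measurable[OF bump_pair_measurable[OF u v]] by measurable
  then show ?thesis
    by (rule measurable_cong[THEN iffD1, rotated])
      (simp add: nn_integral_pairs_bump[OF u v] point_sum_nonneg[OF u] point_sum_nonneg[OF v])
qed

lemma point_sum_integrable:
  assumes u: "bump u" and v: "bump v"
  shows "integrable \<nu> (\<lambda>P. point_sum u P * point_sum v P)"
proof -
  obtain C where C: "\<And>P. P \<in> space \<nu> \<Longrightarrow> point_sum u P \<le> C" using u by (rule point_sum_bounded) blast
  obtain D where D: "\<And>P. P \<in> space \<nu> \<Longrightarrow> point_sum v P \<le> D" using v by (rule point_sum_bounded) blast
  have "norm (point_sum u P * point_sum v P) \<le> C * D" if P: "P \<in> space \<nu>" for P
  proof -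
    have "point_sum u P * point_sum v P \<le> C * D"
      using C[OF P] D[OF P] point_sum_nonneg[OF u, of P] point_sum_nonneg[OF v, of P]
        by (intro mult_mono) auto
    then show ?thesis using point_sum_nonneg[OF u, of P] point_sum_nonneg[OF v, of P] by simp
  qed
  then show ?thesis
    by (intro nu.integrable_const_bound[where B = "C * D"] AE_I2 point_sum_measurable u v)
qed

text \<open>The inner product of two periodizations in \<open>L2\<close> over the hull; the defining
  property of \<open>\<eta>\<close> speaks of such products only for equal arguments.\<close>

definition corr :: "('g \<Rightarrow> real) \<Rightarrow> ('g \<Rightarrow> real) \<Rightarrow> real" where
  "corr u v = (LINT P|\<nu>. point_sum u P * point_sum v P)"

text \<open>Campbell's formula for \<open>P \<times> P\<close>: a product function sums over pairs
  to a product of point sums.\<close>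

lemma corr_intensity:
  assumes u: "bump u" and v: "bump v"
  shows "(\<integral>\<^sup>+p. ennreal (u (fst p) * v (snd p)) \<partial>pairs.intensity) = ennreal (corr u v)"
proof -
  have "(\<integral>\<^sup>+p. ennreal (u (fst p) * v (snd p)) \<partial>pairs.intensity)
      = (\<integral>\<^sup>+P. ennreal (point_sum u P * point_sum v P) \<partial>\<nu>)"
    unfolding pairs.nn_integral_intensity[OF bump_pair_measurable[OF u v]]
    by (intro nn_integral_cong nn_integral_pairs_bump[OF u v])
  also have "\<dots> = ennreal (corr u v)"
    unfolding corr_def using point_sum_integrable[OF u v] point_sum_nonneg[OF u] point_sum_nonneg[OF
      v]
    by (intro nn_integral_eq_integral) auto
  finally show ?thesis .
qed

lemma corr_add:
  assumes u: "bump u" and v: "bump v"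
  shows "corr (\<lambda>x. u x + v x) (\<lambda>x. u x + v x) = corr u u + 2 * corr u v + corr v v"
proof -
  have "corr (\<lambda>x. u x + v x) (\<lambda>x. u x + v x) =
    (LINT P|\<nu>. point_sum u P * point_sum u P + 2 * (point_sum u P * point_sum v P)
      + point_sum v P * point_sum v P)"
    unfolding corr_def
    by (intro Bochner_Integration.integral_cong refl) (simp add: point_sum_add[OF u v]
      algebra_simps)
  also have "\<dots> = corr u u + 2 * corr u v + corr v v"
    unfolding corr_def using point_sum_integrable[OF u u] point_sum_integrable[OF u v]
      point_sum_integrable[OF v v]
    by simp
  finally show ?thesis .
qed

section \<open>The form induced by the autocorrelation measure and its polarisation\<close>

lemma radon_eta: "radon_measure \<eta>"
  using autocorr by (simp add: autocorrelation_def)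

lemma sets_eta: "sets \<eta> = sets borel"
  using radon_eta by (simp add: radon_measure_def)

lemma radon_mG: "radon_measure mG"
  using invG by (simp add: left_invariant_def)

text \<open>The convolution of the involution of \<open>u\<close> with \<open>v\<close>, after
  inverting the integration variable; in this shape it is an integral over the pairs
  \<open>x\<close>, \<open>x + z\<close>.\<close>

definition inner_corr :: "('g \<Rightarrow> real) \<Rightarrow> ('g \<Rightarrow> real) \<Rightarrow> 'g \<Rightarrow> real" where
  "inner_corr u v z = (LINT x|mG. u x * v (x + z))"

lemma inner_integrable:
  assumes u: "bump u" and v: "bump v"
  shows "integrable mG (\<lambda>x. u x * v (x + z))"
proof -
  obtain K where K: "compact K" "\<And>x. x \<notin> K \<Longrightarrow> u x = 0" using u by (rule bump_support) blast
  show ?thesis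
  proof (rule radon_integrable_continuous[OF radon_mG _ K(1)])
    show "continuous_on UNIV (\<lambda>x. u x * v (x + z))"
      by (intro continuous_on_mult bumpD(1)[OF u] continuous_on_compose2[OF bumpD(1)[OF v]]
        continuous_intros) auto
  qed (simp add: K)
qed

lemma inner_corr_nonneg: "bump u \<Longrightarrow> bump v \<Longrightarrow> 0 \<le> inner_corr u v z"
  unfolding inner_corr_def by (rule Bochner_Integration.integral_nonneg) (simp add: bumpD(2))

text \<open>The function vanishes off the compact set of all \<open>- x + y\<close> with
  \<open>x\<close> and \<open>y\<close> in the two supports, and is bounded by a multiple of the
  integral of \<open>u\<close>. Measurability from Fubini takes the place of continuity.\<close>

lemma inner_corr_integrable:
  assumes u: "bump u" and v: "bump v"
  shows "integrable \<eta> (inner_corr u v)"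
proof -
  obtain K where K: "compact K" "\<And>x. x \<notin> K \<Longrightarrow> u x = 0" using u by (rule bump_support) blast
  obtain L where L: "compact L" "\<And>x. x \<notin> L \<Longrightarrow> v x = 0" using v by (rule bump_support) blast
  obtain c where c: "0 \<le> c" "\<And>x. v x \<le> c" using v by (rule bump_bounded) blast
  interpret G: sigma_finite_measure mG by (rule DG(3))
  have [measurable]: "u \<in> borel_measurable borel" "v \<in> borel_measurable borel"
    using u v by (simp_all add: bump_measurable)
  note [measurable_cong] = DG(1)
  have "(\<lambda>z. LINT x|mG. u x * v (x + z)) \<in> borel_measurable borel" by measurable
  then have m: "inner_corr u v \<in> borel_measurable borel" by (simp add: inner_corr_def[abs_def])
  have iu: "integrable mG u" by (rule radon_integrable_continuous[OF radon_mG bumpD(1)[OF u] K])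
  have b: "norm (inner_corr u v z) \<le> c * (LINT x|mG. u x)" for z
  proof -
    have "inner_corr u v z \<le> (LINT x|mG. c * u x)"
      unfolding inner_corr_def using inner_integrable[OF u v] iu c bumpD(2)[OF u]
      by (intro integral_mono) (auto simp: mult.commute[of c] mult_left_mono)
    then show ?thesis using inner_corr_nonneg[OF u v, of z] by simp
  qed
  have eqQ: "(\<lambda>p. - fst p + snd p) ` (K \<times> L) = {- x + y |x y. x \<in> K \<and> y \<in> L}" by force
  have Q: "compact {- x + y |x y. x \<in> K \<and> y \<in> L}"
    unfolding eqQ[symmetric] by (intro compact_continuous_image continuous_intros compact_Times K L)
  have 0: "inner_corr u v z = 0" if z: "z \<notin> {- x + y |x y. x \<in> K \<and> y \<in> L}" for z
  proof -
    have "(\<lambda>x. u x * v (x + z)) = (\<lambda>x. 0)"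
    proof (rule ext, rule ccontr)
      fix x
      assume "u x * v (x + z) \<noteq> 0"
      then have "x \<in> K" "x + z \<in> L" using K(2)[of x] L(2)[of "x + z"] by auto
      moreover have "z = - x + (x + z)" by (simp add: add.assoc[symmetric])
      ultimately show False using z by blast
    qed
    then show ?thesis unfolding inner_corr_def by (simp only: integral_zero)
  qed
  show ?thesis by (rule radon_integrable[OF radon_eta m Q 0 b])
qed

definition eta_corr :: "('g \<Rightarrow> real) \<Rightarrow> ('g \<Rightarrow> real) \<Rightarrow> real" where
  "eta_corr u v = (LINT z|\<eta>. inner_corr u v z)"

text \<open>Unimodularity of the group enters here, through the substitution \<open>r \<mapsto> - r\<close>.\<close>

lemma conv_fun_involution:
  assumes f: "continuous_on UNIV (f :: 'g \<Rightarrow> complex)"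
  shows "conv_fun mG (involution f) f z = (LINT x|mG. cnj (f x) * f (x + z))"
proof -
  note [measurable_cong] = DG(1)
  have "distr mG borel uminus = mG"
  proof (rule measure_eqI)
    fix A assume "A \<in> sets (distr mG borel uminus)"
    then have A: "A \<in> sets borel" by simp
    then show "emeasure (distr mG borel uminus) A = emeasure mG A"
      using mG_uminus[OF A] by (subst emeasure_distr) (simp_all add: DG(2))
  qed (simp add: DG)
  then have "(LINT x|mG. cnj (f x) * f (x + z)) = (LINT x|distr mG borel uminus. cnj (f x) * f (x
    + z))" by simp
  also have "\<dots> = (LINT x|mG. cnj (f (- x)) * f (- x + z))"
  proof (rule integral_distr)
    show "uminus \<in> mG \<rightarrow>\<^sub>M borel" by measurable
    have "continuous_on UNIV (\<lambda>x. cnj (f x) * f (x + z))"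
      by (intro continuous_intros f continuous_on_compose2[OF f]) auto
    then show "(\<lambda>x. cnj (f x) * f (x + z)) \<in> borel_measurable borel"
      by (rule borel_measurable_continuous_onI)
  qed
  finally show ?thesis by (simp add: conv_fun_def involution_def)
qed

lemma eta_corr_diag:
  assumes u: "bump u"
  shows "eta_corr u u = corr u u"
proof -
  let ?f = "\<lambda>x. complex_of_real (u x)"
  have Cc: "?f \<in> Cc" using bump_complex_Cc[OF u u, of 0] by simp
  have "conv_fun mG (involution ?f) ?f z = complex_of_real (inner_corr u u z)" for z
  proof -
    have "conv_fun mG (involution ?f) ?f z = (LINT x|mG. complex_of_real (u x * u (x + z)))"
      unfolding conv_fun_involution[OF Cc_support(1)[OF Cc]] by simp
    then show ?thesis by (simp only: integral_complex_of_real inner_corr_def)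
  qed
  then have "complex_of_real (eta_corr u u) = (LINT z|\<eta>. conv_fun mG (involution ?f) ?f z)"
    by (simp add: eta_corr_def)
  also have "\<dots> = complex_of_real (LINT P|\<nu>. (cmod (periodization ?f P))\<^sup>2)"
    using autocorr Cc by (simp add: autocorrelation_def)
  also have "(LINT P|\<nu>. (cmod (periodization ?f P))\<^sup>2) = corr u u"
    unfolding corr_def by (intro Bochner_Integration.integral_cong refl cmod_periodization[OF u])
  finally show ?thesis by (simp only: of_real_eq_iff)
qed

text \<open>The values of \<open>\<eta>\<close> on \<open>f\<^sup>* * f\<close> with \<open>f = u + \<i> v\<close> are real, so the form is symmetric.\<close>

lemma eta_corr_sym:
  assumes u: "bump u" and v: "bump v"
  shows "eta_corr u v = eta_corr v u"
proof -
  let ?f = "\<lambda>x. complex_of_real (u x) + \<i> * complex_of_real (v x)"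
  have Cc: "?f \<in> Cc" by (rule bump_complex_Cc[OF u v])
  note I = inner_integrable[OF u u] inner_integrable[OF v v] inner_integrable[OF u v]
    inner_integrable[OF v u]
  note J = inner_corr_integrable[OF u u] inner_corr_integrable[OF v v] inner_corr_integrable[OF u v]
    inner_corr_integrable[OF v u]
  have "conv_fun mG (involution ?f) ?f z = complex_of_real (inner_corr u u z + inner_corr v v z)
      + \<i> * complex_of_real (inner_corr u v z - inner_corr v u z)" for z
  proof -
    have "conv_fun mG (involution ?f) ?f z = (LINT x|mG. complex_of_real (u x * u (x + z)
      + v x * v (x + z))
        + \<i> * complex_of_real (u x * v (x + z) - v x * u (x + z)))"
      unfolding conv_fun_involution[OF Cc_support(1)[OF Cc]]
      by (intro Bochner_Integration.integral_cong refl) (simp add: complex_eq_iff algebra_simps)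
    also have "\<dots> = (LINT x|mG. complex_of_real (u x * u (x + z) + v x * v (x + z)))
        + (LINT x|mG. \<i> * complex_of_real (u x * v (x + z) - v x * u (x + z)))"
      by (intro Bochner_Integration.integral_add integrable_of_real integrable_mult_right
          Bochner_Integration.integrable_add Bochner_Integration.integrable_diff I)
    also have "\<dots> = complex_of_real (LINT x|mG. u x * u (x + z) + v x * v (x + z))
        + \<i> * complex_of_real (LINT x|mG. u x * v (x + z) - v x * u (x + z))"
      by (simp only: integral_complex_of_real integral_mult_right_zero)
    finally show ?thesis using I by (simp add: inner_corr_def)
  qed
  then have "(LINT z|\<eta>. conv_fun mG (involution ?f) ?f z)
      = (LINT z|\<eta>. complex_of_real (inner_corr u u z + inner_corr v v z)
        + \<i> * complex_of_real (inner_corr u v z - inner_corr v u z))" by simp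
  also have "\<dots> = (LINT z|\<eta>. complex_of_real (inner_corr u u z + inner_corr v v z))
      + (LINT z|\<eta>. \<i> * complex_of_real (inner_corr u v z - inner_corr v u z))"
    by (intro Bochner_Integration.integral_add integrable_of_real integrable_mult_right
        Bochner_Integration.integrable_add Bochner_Integration.integrable_diff J)
  also have "\<dots> = complex_of_real (LINT z|\<eta>. inner_corr u u z + inner_corr v v z)
      + \<i> * complex_of_real (LINT z|\<eta>. inner_corr u v z - inner_corr v u z)"
    by (simp only: integral_complex_of_real integral_mult_right_zero)
  also have "(LINT z|\<eta>. inner_corr u v z - inner_corr v u z) = eta_corr u v - eta_corr v u"
    using J by (simp add: eta_corr_def)
  finally have "(LINT z|\<eta>. conv_fun mG (involution ?f) ?f z)
    = complex_of_real (LINT z|\<eta>. inner_corr u u z + inner_corr v v z)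
      + \<i> * complex_of_real (eta_corr u v - eta_corr v u)" .
  moreover have "(LINT z|\<eta>. conv_fun mG (involution ?f) ?f z)
    = complex_of_real (LINT P|\<nu>. (cmod (periodization ?f P))\<^sup>2)"
    using autocorr Cc unfolding autocorrelation_def by simp
  ultimately have "Im (complex_of_real (LINT P|\<nu>. (cmod (periodization ?f P))\<^sup>2))
    = eta_corr u v - eta_corr v u"
    by (simp del: of_real_diff)
  then show ?thesis by simp
qed

lemma inner_corr_add:
  assumes u: "bump u" and v: "bump v"
  shows "inner_corr (\<lambda>x. u x + v x) (\<lambda>x. u x + v x) z
    = inner_corr u u z + inner_corr u v z + inner_corr v u z + inner_corr v v z"
proof -
  note I = inner_integrable[OF u u] inner_integrable[OF v v] inner_integrable[OF u v]
    inner_integrable[OF v u]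
  have "inner_corr (\<lambda>x. u x + v x) (\<lambda>x. u x + v x) z
      = (LINT x|mG. u x * u (x + z) + u x * v (x + z) + v x * u (x + z) + v x * v (x + z))"
    unfolding inner_corr_def by (intro Bochner_Integration.integral_cong refl) (simp add:
      algebra_simps)
  then show ?thesis using I by (simp add: inner_corr_def)
qed

text \<open>Polarisation: the quadratic identity at \<open>u + v\<close> determines the sum of the
  two mixed terms, and symmetry splits it equally.\<close>

lemma eta_corr_eq:
  assumes u: "bump u" and v: "bump v"
  shows "eta_corr u v = corr u v"
proof -
  note J = inner_corr_integrable[OF u u] inner_corr_integrable[OF v v] inner_corr_integrable[OF u v]
    inner_corr_integrable[OF v u]
  have "eta_corr (\<lambda>x. u x + v x) (\<lambda>x. u x + v x) = eta_corr u u + eta_corr u v + eta_corr v u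
    + eta_corr v v"
    unfolding eta_corr_def inner_corr_add[OF u v] using J by simp
  moreover have "eta_corr (\<lambda>x. u x + v x) (\<lambda>x. u x + v x) = corr u u + 2 * corr u v + corr v v"
    using eta_corr_diag[OF bump_add[OF u v]] corr_add[OF u v] by simp
  ultimately show ?thesis
    using eta_corr_diag[OF u] eta_corr_diag[OF v] eta_corr_sym[OF u v] by simp
qed

section \<open>The second moment measure of the hull\<close>

definition pair_measure_eta :: "('g \<times> 'g) measure" where
  "pair_measure_eta = distr (mG \<Otimes>\<^sub>M \<eta>) borel (\<lambda>p. (fst p, fst p + snd p))"

lemma sets_mG_eta: "sets (mG \<Otimes>\<^sub>M \<eta>) = sets borel"
  using sets_pair_measure_cong[OF DG(1) sets_eta] unfolding borel_prod .

lemma nn_integral_pair_measure_eta: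
  assumes f: "f \<in> borel_measurable borel"
  shows "(\<integral>\<^sup>+p. f p \<partial>pair_measure_eta) = (\<integral>\<^sup>+z. \<integral>\<^sup>+x. f (x, x + z) \<partial>mG \<partial>\<eta>)"
proof -
  interpret G: sigma_finite_measure mG by (rule DG(3))
  interpret E: sigma_finite_measure \<eta> by (rule radon_measure_sigma_finite[OF radon_eta])
  interpret GE: pair_sigma_finite mG \<eta> ..
  have "(\<lambda>p::'g \<times> 'g. (fst p, fst p + snd p)) \<in> borel_measurable borel"
    by (intro borel_measurable_continuous_onI continuous_intros)
  then have T: "(\<lambda>p. (fst p, fst p + snd p)) \<in> mG \<Otimes>\<^sub>M \<eta> \<rightarrow>\<^sub>M borel"
    using measurable_cong_sets[OF sets_mG_eta refl] by blast
  have "(\<integral>\<^sup>+p. f p \<partial>pair_measure_eta) = (\<integral>\<^sup>+p. f (fst p, fst p + snd p) \<partial>(mG \<Otimes>\<^sub>M \<eta>))"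
    unfolding pair_measure_eta_def by (rule nn_integral_distr[OF T]) (simp add: f)
  also have "\<dots> = (\<integral>\<^sup>+z. \<integral>\<^sup>+x. f (fst (x, z), fst (x, z) + snd (x, z)) \<partial>mG \<partial>\<eta>)"
    by (rule GE.nn_integral_snd[symmetric]) (use measurable_compose[OF T f] in \<open>simp add:
      case_prod_beta\<close>)
  finally show ?thesis by simp
qed

lemma pair_measure_eta_bump:
  assumes u: "bump u" and v: "bump v"
  shows "(\<integral>\<^sup>+p. ennreal (u (fst p) * v (snd p)) \<partial>pair_measure_eta) = ennreal (corr u v)"
proof -
  have "(\<integral>\<^sup>+p. ennreal (u (fst p) * v (snd p)) \<partial>pair_measure_eta)
      = (\<integral>\<^sup>+z. \<integral>\<^sup>+x. ennreal (u x * v (x + z)) \<partial>mG \<partial>\<eta>)"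
    unfolding nn_integral_pair_measure_eta[OF bump_pair_measurable[OF u v]] by simp
  also have "\<dots> = (\<integral>\<^sup>+z. ennreal (inner_corr u v z) \<partial>\<eta>)"
    unfolding inner_corr_def using bumpD(2)[OF u] bumpD(2)[OF v]
    by (intro nn_integral_cong nn_integral_eq_integral inner_integrable u v) auto
  also have "\<dots> = ennreal (eta_corr u v)"
    unfolding eta_corr_def using inner_corr_nonneg[OF u v]
    by (intro nn_integral_eq_integral inner_corr_integrable u v) auto
  finally show ?thesis using eta_corr_eq[OF u v] by simp
qed

text \<open>Both measures integrate a product of bumps \<open>u\<close> and \<open>v\<close> to
  \<open>corr u v\<close>; bumps increase to indicators of open sets, and open boxes form an
  intersection-stable generator.\<close>

theorem intensity_pairs_eq: "pairs.intensity = pair_measure_eta"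
proof -
  let ?E = "{U \<times> V |U V. open (U :: 'g set) \<and> open (V :: 'g set)}"
  \<comment> \<open>Boxes of balls exhaust the product; their mean counts are finite since hull
    elements have uniformly bounded counts in compact sets.\<close>
  define A where "A n = {u. d 0 u < real n} \<times> {u. d 0 u < real n}" for n :: nat
  show ?thesis
  proof (rule measure_eqI_generator_eq[where E = ?E and \<Omega> = UNIV and A = A])
    show "Int_stable ?E"
      unfolding Int_stable_def
    proof (intro ballI)
      fix a b assume "a \<in> ?E" "b \<in> ?E"
      then obtain U V U' V' where "a = U \<times> V" "b = U' \<times> V'" "open U" "open V" "open U'" "open V'"
        by auto
      then show "a \<inter> b \<in> ?E"
        by (intro CollectI exI[of _ "U \<inter> U'"] exI[of _ "V \<inter> V'"]) (auto simp: Times_Int_Times)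
    qed
    show "?E \<subseteq> Pow UNIV" by simp
    show "sets pairs.intensity = sigma_sets UNIV ?E"
      by (simp only: pairs.sets_intensity sets_borel_open_Times)
    show "sets pair_measure_eta = sigma_sets UNIV ?E"
      by (simp only: pair_measure_eta_def sets_distr sets_borel_open_Times)
    show "range A \<subseteq> ?E" unfolding A_def using open_ball by auto
    have "\<exists>n. d 0 x < real n \<and> d 0 y < real n" for x y
    proof -
      obtain n :: nat where "max (d 0 x) (d 0 y) < real n" using reals_Archimedean2 by blast
      then show ?thesis by (intro exI[of _ n]) simp
    qed
    then show "(\<Union>i. A i) = UNIV" by (auto simp: A_def)
    show "emeasure pairs.intensity (A i) \<noteq> \<infinity>" for i
    proof -
      have A: "A i \<in> sets borel" unfolding A_def by (intro borel_open open_Times open_ball)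
      obtain n where n: "\<And>P. P \<in> space \<nu> \<Longrightarrow> card (P \<inter> {u. d 0 u \<le> real i}) \<le> n"
        using hull_card_bound[OF compact_cball] by blast
      have "pairs.cnt (A i) P \<le> ennreal (real n * real n)" if P: "P \<in> space \<nu>" for P
      proof -
        let ?B = "P \<inter> {u. d 0 u \<le> real i}"
        have fin: "finite ?B" by (rule hull_finite[OF P compact_cball])
        have "pairs.cnt (A i) P \<le> emeasure (count_space UNIV) (?B \<times> ?B)"
          unfolding pairs.cnt_def by (intro emeasure_mono) (auto simp: A_def)
        also have "\<dots> = ennreal (real (card ?B) * real (card ?B))"
          using fin by (simp add: emeasure_count_space card_cartesian_product
            ennreal_of_nat_eq_real_of_nat)
        also have "\<dots> \<le> ennreal (real n * real n)"
          using n[OF P] by (intro ennreal_leI mult_mono) auto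
        finally show ?thesis .
      qed
      then have "emeasure pairs.intensity (A i) \<le> (\<integral>\<^sup>+P. ennreal (real n * real n) \<partial>\<nu>)"
        unfolding pairs.emeasure_intensity[OF A] by (intro nn_integral_mono)
      also have "\<dots> < \<infinity>" by (simp add: nu.emeasure_space_1 ennreal_mult_less_top)
      finally show ?thesis by simp
    qed
    fix X assume "X \<in> ?E"
    then obtain U V where X: "X = U \<times> V" "open U" "open V" by auto
    obtain u where u: "\<And>n. bump (u n)" "\<And>x. incseq (\<lambda>n. u n x)" "\<And>x. (\<lambda>n. u n x) \<longlonglongrightarrow> indicator U x"
      using open_indicator_approx[OF X(2)] by blast
    obtain v where v: "\<And>n. bump (v n)" "\<And>x. incseq (\<lambda>n. v n x)" "\<And>x. (\<lambda>n. v n x) \<longlonglongrightarrow> indicator V x"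
      using open_indicator_approx[OF X(3)] by blast
    have "(\<lambda>n. ennreal (corr (u n) (v n))) \<longlonglongrightarrow> emeasure pairs.intensity (U \<times> V)"
      using nn_integral_double_approx[OF pairs.sets_intensity u v X(2,3)]
        by (simp add: corr_intensity u v)
    moreover have "(\<lambda>n. ennreal (corr (u n) (v n))) \<longlonglongrightarrow> emeasure pair_measure_eta (U \<times> V)"
    proof -
      have "sets pair_measure_eta = sets borel" by (simp add: pair_measure_eta_def)
      from nn_integral_double_approx[OF this u v X(2,3)] show ?thesis
        by (simp add: pair_measure_eta_bump u v)
    qed
    ultimately show "emeasure pairs.intensity X = emeasure pair_measure_eta X"
      unfolding X(1) by (rule LIMSEQ_unique)
  qed
qed

text \<open>Rewrites the sampled autocorrelation as a sum over \<open>P \<times> P\<close>, the form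
  to which Campbell's formula applies.\<close>

lemma sampled_autocorrelation_real:
  assumes r: "bump r" and P: "P \<in> space \<nu>" and t: "t > 0"
  shows "(\<integral>\<^sup>+p. ennreal (indicator (F t) (fst p) * r (- fst p + snd p)) \<partial>count_space (P \<times> P))
      = ennreal (measure mG (F t) * Re (sampled_autocorrelation mG P F t (\<lambda>x. complex_of_real (r
        x))))"
    and "0 \<le> Re (sampled_autocorrelation mG P F t (\<lambda>x. complex_of_real (r x)))"
proof -
  obtain K where K: "compact K" "\<And>x. x \<notin> K \<Longrightarrow> r x = 0" using r by (rule bump_support) blast
  \<comment> \<open>A compact set containing every \<open>y\<close> that can contribute:
    \<open>x\<close> in \<open>F t\<close> and \<open>- x + y\<close> in \<open>K\<close> force
    \<open>y\<close> into it.\<close>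
  define L where "L = {x + k |x k. x \<in> F t \<and> k \<in> K}"
  have "L = (\<lambda>p. fst p + snd p) ` (F t \<times> K)" unfolding L_def by force
  then have L: "compact L"
    by (simp only:) (intro compact_continuous_image continuous_intros compact_Times F_compact[OF t]
      K)
  have rL: "r (- x + y) = 0" if "x \<in> F t" "y \<notin> L" for x y
  proof (rule K(2))
    show "- x + y \<notin> K"
    proof
      assume "- x + y \<in> K"
      then have "x + (- x + y) \<in> L" unfolding L_def using that(1) by blast
      then show False using that(2) by (simp add: add.assoc[symmetric])
    qed
  qed
  let ?S = "\<Sum>x\<in>P \<inter> F t. \<Sum>y\<in>P \<inter> L. r (- x + y)"
  have 1: "(\<integral>\<^sup>+p. ennreal (indicator (F t) (fst p) * r (- fst p + snd p)) \<partial>count_space (P \<times> P))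
      = ennreal (\<Sum>x\<in>P \<inter> F t. \<Sum>y\<in>P \<inter> L. indicator (F t) x * r (- x + y))"
    using bumpD(2)[OF r] rL
    by (intro nn_integral_pairs_finite[OF P F_compact[OF t] L]) (auto simp: indicator_def)
  have 2: "(\<Sum>x\<in>P \<inter> F t. \<Sum>y\<in>P \<inter> L. indicator (F t) x * r (- x + y)) = ?S"
    by (intro sum.cong refl) simp
  have "(\<Sum>\<^sub>\<infinity>y\<in>P. complex_of_real (r (- x + y))) = complex_of_real (\<Sum>y\<in>P \<inter> L. r (- x + y))" if
    "x \<in> F t" for x
  proof -
    have "(\<Sum>\<^sub>\<infinity>y\<in>P. complex_of_real (r (- x + y))) = (\<Sum>y\<in>P \<inter> L. complex_of_real (r (- x + y)))"
      using rL[OF that] by (intro infsum_finite_support hull_finite[OF P L]) simp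
    then show ?thesis by simp
  qed
  then have "(\<Sum>x\<in>P \<inter> F t. \<Sum>\<^sub>\<infinity>y\<in>P. complex_of_real (r (- x + y))) = complex_of_real ?S"
    by simp
  then have 3: "sampled_autocorrelation mG P F t (\<lambda>x. complex_of_real (r x))
    = complex_of_real (?S / measure mG (F t))"
    by (simp add: sampled_autocorrelation_def)
  have nn: "0 \<le> ?S" using bumpD(2)[OF r] by (intro sum_nonneg)
  show "0 \<le> Re (sampled_autocorrelation mG P F t (\<lambda>x. complex_of_real (r x)))"
    unfolding 3 Re_complex_of_real using nn by (intro divide_nonneg_nonneg) simp_all
  show "(\<integral>\<^sup>+p. ennreal (indicator (F t) (fst p) * r (- fst p + snd p)) \<partial>count_space (P \<times> P))
      = ennreal (measure mG (F t) * Re (sampled_autocorrelation mG P F t (\<lambda>x. complex_of_real (r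
        x))))"
    unfolding 1 2 3 Re_complex_of_real using F_measure_pos[OF t] by simp
qed

lemma bump_integrable_eta:
  assumes r: "bump r"
  shows "integrable \<eta> r"
proof -
  obtain K where K: "compact K" "\<And>x. x \<notin> K \<Longrightarrow> r x = 0" using r by (rule bump_support) blast
  show ?thesis by (rule radon_integrable_continuous[OF radon_eta bumpD(1)[OF r] K])
qed

text \<open>In the coordinates \<open>(x, x + z)\<close> the summand becomes a function of
  \<open>x\<close> times a function of \<open>z\<close>, so its integral is the mass of
  \<open>F t\<close> times the integral of \<open>r\<close> against \<open>\<eta>\<close>. The mean
  is therefore exact at each \<open>t\<close>.\<close>

lemma sampled_autocorrelation_mean:
  assumes r: "bump r" and t: "t > 0"
  defines "\<sigma> \<equiv> \<lambda>P. Re (sampled_autocorrelation mG P F t (\<lambda>x. complex_of_real (r x)))"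
  shows "\<sigma> \<in> borel_measurable \<nu>" "(\<integral>\<^sup>+P. ennreal (\<sigma> P) \<partial>\<nu>) = ennreal (LINT x|\<eta>. r x)"
proof -
  let ?m = "measure mG (F t)"
  define f where "f p = ennreal (indicator (F t) (fst p) * r (- fst p + snd p))" for p :: "'g \<times> 'g"
  have m: "?m > 0" by (rule F_measure_pos[OF t])
  have [measurable]: "r \<in> borel_measurable borel" using r by (rule bump_measurable)
  have [measurable]: "F t \<in> sets borel" using F_sets[OF t] DG(1) by simp
  have "(\<lambda>p. ennreal (indicator (F t) (fst p) * r (- fst p
    + snd p))) \<in> borel_measurable (borel \<Otimes>\<^sub>M borel)"
    by measurable
  then have f: "f \<in> borel_measurable borel" unfolding borel_prod f_def .
  have eq: "(\<integral>\<^sup>+p. f p \<partial>count_space (P \<times> P)) = ennreal (?m * \<sigma> P)" if "P \<in> space \<nu>" for P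
    unfolding f_def \<sigma>_def by (rule sampled_autocorrelation_real(1)[OF r that t])
  have nn: "0 \<le> \<sigma> P" if "P \<in> space \<nu>" for P
    unfolding \<sigma>_def by (rule sampled_autocorrelation_real(2)[OF r that t])
  have "(\<lambda>P. enn2real (\<integral>\<^sup>+p. f p \<partial>count_space (P \<times> P)) / ?m) \<in> borel_measurable \<nu>"
    using pairs.nn_integral_point_measurable[OF f] by measurable
  then show meas: "\<sigma> \<in> borel_measurable \<nu>"
    by (rule measurable_cong[THEN iffD1, rotated]) (use m nn in \<open>simp add: eq\<close>)
  have "ennreal ?m * (\<integral>\<^sup>+P. ennreal (\<sigma> P) \<partial>\<nu>) = (\<integral>\<^sup>+P. ennreal ?m * ennreal (\<sigma> P) \<partial>\<nu>)"
    using meas by (intro nn_integral_cmult[symmetric]) simp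
  also have "\<dots> = (\<integral>\<^sup>+P. \<integral>\<^sup>+p. f p \<partial>count_space (P \<times> P) \<partial>\<nu>)"
    using m nn by (intro nn_integral_cong) (simp add: eq ennreal_mult)
  also have "\<dots> = (\<integral>\<^sup>+p. f p \<partial>pair_measure_eta)"
    unfolding intensity_pairs_eq[symmetric] by (rule pairs.nn_integral_intensity[OF f, symmetric])
  also have "\<dots> = (\<integral>\<^sup>+z. \<integral>\<^sup>+x. ennreal (r z) * indicator (F t) x \<partial>mG \<partial>\<eta>)"
    unfolding nn_integral_pair_measure_eta[OF f]
    by (intro nn_integral_cong) (auto simp: f_def add.assoc[symmetric] indicator_def)
  also have "\<dots> = (\<integral>\<^sup>+z. ennreal ?m * ennreal (r z) \<partial>\<eta>)"
    using F_sets[OF t] by (simp add: nn_integral_cmult_indicator emeasure_F[OF t] mult.commute)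
  also have "\<dots> = ennreal ?m * (\<integral>\<^sup>+z. ennreal (r z) \<partial>\<eta>)"
  proof (rule nn_integral_cmult)
    have "r \<in> borel_measurable \<eta>" using bump_integrable_eta[OF r]
      by (rule borel_measurable_integrable)
    then show "(\<lambda>z. ennreal (r z)) \<in> borel_measurable \<eta>" by measurable
  qed
  also have "(\<integral>\<^sup>+z. ennreal (r z) \<partial>\<eta>) = ennreal (LINT x|\<eta>. r x)"
    using bumpD(2)[OF r] by (intro nn_integral_eq_integral bump_integrable_eta r) auto
  finally have "ennreal ?m * (\<integral>\<^sup>+P. ennreal (\<sigma> P) \<partial>\<nu>) = ennreal ?m * ennreal (LINT x|\<eta>. r x)" .
  then show "(\<integral>\<^sup>+P. ennreal (\<sigma> P) \<partial>\<nu>) = ennreal (LINT x|\<eta>. r x)"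
    using m by (auto simp: ennreal_mult_cancel_left)
qed

text \<open>The means do not depend on the time, while the sampled values converge at every point of
  the hull to one and the same number and stay bounded; comparing the limits identifies that
  number.\<close>

lemma eta_bump:
  assumes r: "bump r" and K: "compact K" "\<And>x. x \<notin> K \<Longrightarrow> r x = 0"
  shows "complex_of_real (LINT x|\<eta>. r x) = limit_autocorrelation K (\<lambda>x. complex_of_real (r x))"
proof -
  let ?L = "limit_autocorrelation K (\<lambda>x. complex_of_real (r x))"
  \<comment> \<open>Integer times starting at 1: dominated convergence is applied to a sequence, and
    \<open>F t\<close> is controlled for positive \<open>t\<close> only.\<close>
  define s where "s n P = Re (sampled_autocorrelation mG P F (real (Suc n)) (\<lambda>x. complex_of_real (r
    x)))" for n P
  have K': "\<And>x. x \<notin> K \<Longrightarrow> complex_of_real (r x) = 0" using K by simp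
  have "\<exists>C. \<forall>y P t. sandwiched y P \<longrightarrow> t > 0 \<longrightarrow>
      cmod (sampled_autocorrelation mG P F t (\<lambda>x. complex_of_real (r x))) \<le> C"
    by (rule sampled_autocorrelation_bounded[where f =
      "\<lambda>x. complex_of_real (r x)", OF K(1)]) (erule K', blast)
  then obtain C where C: "\<And>y P t. sandwiched y P \<Longrightarrow> t > 0 \<Longrightarrow>
      cmod (sampled_autocorrelation mG P F t (\<lambda>x. complex_of_real (r x))) \<le> C"
    by blast
  have pos: "real (Suc n) > 0" for n by simp
  note mean = sampled_autocorrelation_mean[OF r pos, folded s_def]
  have s0: "0 \<le> s n P" if "P \<in> space \<nu>" for n P
    unfolding s_def by (rule sampled_autocorrelation_real(2)[OF r that pos])
  have r0: "0 \<le> (LINT x|\<eta>. r x)" using bumpD(2)[OF r] by (intro Bochner_Integration.integral_nonneg)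
  have int: "(LINT P|\<nu>. s n P) = (LINT x|\<eta>. r x)" for n
  proof -
    have "(LINT P|\<nu>. s n P) = enn2real (\<integral>\<^sup>+P. ennreal (s n P) \<partial>\<nu>)"
      using mean(1) s0 by (intro integral_eq_nn_integral AE_I2) auto
    then show ?thesis using mean(2)[of n] r0 by simp
  qed
  have "(\<lambda>n. LINT P|\<nu>. s n P) \<longlonglongrightarrow> (LINT P|\<nu>. Re ?L)"
  proof (rule integral_dominated_convergence[where w = "\<lambda>_. C"])
    show "AE P in \<nu>. (\<lambda>n. s n P) \<longlonglongrightarrow> Re ?L"
    proof (rule AE_I2)
      fix P assume "P \<in> space \<nu>"
      then obtain y where "sandwiched y P" by (rule hull_sandwiched)
      from sampled_autocorrelation_tendsto[OF this K(1) K']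
      have "((\<lambda>t. Re (sampled_autocorrelation mG P F t (\<lambda>x. complex_of_real (r x))))
        \<longlongrightarrow> Re ?L) at_top"
        by (intro tendsto_Re)
      then show "(\<lambda>n. s n P) \<longlonglongrightarrow> Re ?L"
        unfolding s_def
        by (rule filterlim_compose) (rule filterlim_compose[OF filterlim_real_sequentially
          filterlim_Suc])
    qed
    show "AE P in \<nu>. norm (s n P) \<le> C" for n
    proof (rule AE_I2)
      fix P assume P: "P \<in> space \<nu>"
      then obtain y where "sandwiched y P" by (rule hull_sandwiched)
      then have "cmod (sampled_autocorrelation mG P F (real (Suc n)) (\<lambda>x. complex_of_real (r x)))
        \<le> C"
        using C pos by blast
      then show "norm (s n P) \<le> C" unfolding s_def real_norm_def
        by (rule order_trans[OF abs_Re_le_cmod])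
    qed
  qed (use mean(1) in auto)
  then have "(LINT x|\<eta>. r x) = Re ?L"
    unfolding int by (simp add: nu.prob_space LIMSEQ_const_iff)
  moreover have "Im ?L = 0"
    unfolding limit_autocorrelation_def by simp
  ultimately show ?thesis by (simp add: complex_eq_iff)
qed

text \<open>The positive and negative parts of the real and imaginary parts are bumps vanishing off
  the same compact set, so all four sums run over the same \<open>diffs\<close> and combine
  linearly.\<close>

theorem eta_eq_limit:
  assumes f: "f \<in> Cc"
  shows "(LINT x|\<eta>. f x) = limit_autocorrelation (closure {x. f x \<noteq> 0}) f"
proof -
  let ?K = "closure {x. f x \<noteq> 0}"
  note S = Cc_support[OF f]
  define p1 p2 p3 p4 where "p1 x = max 0 (Re (f x))" and "p2 x = max 0 (- Re (f x))"
    and "p3 x = max 0 (Im (f x))" and "p4 x = max 0 (- Im (f x))" for x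
  have z: "p1 x = 0" "p2 x = 0" "p3 x = 0" "p4 x = 0" if "x \<notin> ?K" for x
    using S(3)[OF that] by (simp_all add: p1_def p2_def p3_def p4_def)
  have c: "continuous_on UNIV p1" "continuous_on UNIV p2" "continuous_on UNIV p3"
    "continuous_on UNIV p4"
    unfolding p1_def p2_def p3_def p4_def by (intro continuous_intros S(1))+
  have nn: "0 \<le> p1 x" "0 \<le> p2 x" "0 \<le> p3 x" "0 \<le> p4 x" for x
    by (simp_all add: p1_def p2_def p3_def p4_def)
  have b: "bump p1" "bump p2" "bump p3" "bump p4"
    unfolding bump_def using c nn z S(2) by blast+
  have dec: "f x = complex_of_real (p1 x) - complex_of_real (p2 x)
      + \<i> * (complex_of_real (p3 x) - complex_of_real (p4 x))" for x
    by (simp add: complex_eq_iff p1_def p2_def p3_def p4_def max_def)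
  note I = b[THEN bump_integrable_eta]
  note I' = I[THEN integrable_of_real[where 'a = complex]]
  have "(LINT x|\<eta>. f x) = (LINT x|\<eta>. complex_of_real (p1 x)) - (LINT x|\<eta>. complex_of_real (p2 x))
      + \<i> * ((LINT x|\<eta>. complex_of_real (p3 x)) - (LINT x|\<eta>. complex_of_real (p4 x)))"
    unfolding dec using I' by (simp add: Bochner_Integration.integral_add
      Bochner_Integration.integral_diff
        Bochner_Integration.integrable_diff integrable_mult_right del: integral_complex_of_real)
  also have "\<dots> = limit_autocorrelation ?K (\<lambda>x. complex_of_real (p1 x)) - limit_autocorrelation ?K
    (\<lambda>x. complex_of_real (p2 x))
      + \<i> * (limit_autocorrelation ?K (\<lambda>x. complex_of_real (p3 x)) - limit_autocorrelation ?K (\<lambda>x.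
        complex_of_real (p4 x)))"
    unfolding integral_complex_of_real
    using eta_bump[OF b(1) S(2) z(1)] eta_bump[OF b(2) S(2) z(2)] eta_bump[OF b(3) S(2) z(3)]
      eta_bump[OF b(4) S(2) z(4)]
    by simp
  also have "\<dots> = limit_autocorrelation ?K f"
    unfolding limit_autocorrelation_def sum_subtractf[symmetric] sum_distrib_left
      sum.distrib[symmetric]
    by (intro sum.cong refl) (subst dec, simp add: algebra_simps)
  finally show ?thesis .
qed

end

theorem theorem5p6:
  fixes mG :: "'g::lcsc_group_add measure"
    and mH :: "'h::lcsc_group_add measure"
    and \<Gamma> :: "('g \<times> 'h) set"
    and W0 :: "'h set"
    and P0 :: "'g set"
    and mY :: "('g \<times> 'h) set measure"
    and \<nu> :: "'g set measure"
    and \<eta> :: "'g measure"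
    and d :: "'g \<Rightarrow> 'g \<Rightarrow> real"
    and F :: "real \<Rightarrow> 'g set"
    and f :: "'g \<Rightarrow> complex"
  assumes "haar_measure mG" and "haar_measure mH"
    and "cut_and_project \<Gamma>"
    and "regular_window mH \<Gamma> W0"
    and "P0 = model_set \<Gamma> W0"
    and "invariant_prob (punctured_hull_top P0) \<nu>"
    and "autocorrelation mG \<nu> \<eta>"
    and "invariant_prob (quotient_top \<Gamma>) mY"
    and "admissible_metric d"
    and "weakly_admissible d mG F"
    and "\<And>t. t > 0 \<Longrightarrow> uminus ` F t = F t"
    and "ae_good mG F mY"
    and "f \<in> Cc"
  shows "((\<lambda>t. sampled_autocorrelation mG P0 F t f) \<longlongrightarrow> (LINT x|\<eta>. f x)) at_top"
proof -
  have inj: "inj_on fst \<Gamma>" and lat: "lattice_subgroup \<Gamma>"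
    using assms(3) by (simp_all add: cut_and_project_def)
  have P0: "P0 = slice \<Gamma> W0" using assms(5) model_set_slice[OF inj] by simp
  have W: "compact W0" "emeasure mH (frontier W0) = 0"
    using assms(4) by (simp_all add: regular_window_def)
  have hull: "invariant_prob (punctured_hull_top (slice \<Gamma> W0)) \<nu>"
    using assms(6) unfolding P0 .
  interpret autocorrelated \<Gamma> mY mG mH d F W0 \<nu> \<eta>
    by unfold_locales (fact lat inj W hull assms)+
  \<comment> \<open>\<open>\<Gamma>\<close> is the coset of 0 and \<open>P0\<close> is its own
    slice, so convergence at \<open>P0\<close> is an instance of the convergence for all sandwiched
    sets, with no exceptional null set.\<close>
  have "sandwiched \<Gamma> P0"
    unfolding sandwiched_def
  proof (intro conjI)
    have "left_coset \<Gamma> 0 \<in> space mY" unfolding space_mY by (rule rangeI)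
    then show "\<Gamma> \<in> space mY" unfolding coset_0 .
    show "slice \<Gamma> (interior W0) \<subseteq> P0" using interior_subset[of W0] by (auto simp: P0 slice_def)
    show "P0 \<subseteq> slice \<Gamma> W0" by (simp add: P0)
  qed
  then show ?thesis
    unfolding eta_eq_limit[OF assms(13)]
    using Cc_support[OF assms(13)] by (intro sampled_autocorrelation_tendsto)
qed

end
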